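(* Let $H:\mathbb{T}^d\times\mathbb{R}^d\to\mathbb{R}$ be a $C^2$ Tonelli Hamiltonian with associated Lagrangian $L$ satisfying (L1) and (L2), and let $F:\mathbb{T}^d\times\mathcal{P}(\mathbb{T}^d)\to\mathbb{R}$ satisfy (F1), (F2) and (F3) (all conditions are spelled out in the context). Then: (i) For each $\tau>0$ there is $m\in\mathcal{P}(\mathbb{T}^d)$ such that there exists a minimizing $\tau$-holonomic measure $\eta_{\tau,m}$ for the Lagrangian $L_m$ with $m=\pi\sharp\eta_{\tau,m}$. Such a (possibly non-unique) measure $m$ is denoted by $m_\tau$. (ii) There are a sequence $\tau_i\to 0$ (with $\tau_i>0$), measures $m_{\tau_i}\in\mathcal{P}(\mathbb{T}^d)$ as in (i) (with $\tau=\tau_i$) converging weakly-$*$ to some $m_0\in\mathcal{P}(\mathbb{T}^d)$, and continuous $\mathbb{Z}^d$-periodic solutions $u_{\tau_i,m_{\tau_i}}$ of the discrete Lax-Oleinik equation $$u(y)+\tau_i\bar L(\tau_i,m_{\tau_i})=\inf_{x\in\mathbb{R}^d}\big(u(x)+\mathcal{L}_{\tau_i,m_{\tau_i}}(x,y)\big),\quad\forall y\in\mathbb{R}^d,$$ such that $u_{\tau_i,m_{\tau_i}}$ converges uniformly on $\mathbb{T}^d$ to a function $u_0$, and $(u_0,m_0)$ is a solution of the stationary mean field games system $$H(x,Du)=F(x,m)+c(m)\ \text{ in }\mathbb{T}^d,\qquad \operatorname{div}\Big(m\,\frac{\partial H}{\partial p}(x,Du)\Big)=0\ \text{ in }\mathbb{T}^d,\qquad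 \int_{\mathbb{T}^d}dm=1.$$
   Context: $\mathbb{T}^d=\mathbb{R}^d/\mathbb{Z}^d$; functions on $\mathbb{T}^d$ are identified with $\mathbb{Z}^d$-periodic functions on $\mathbb{R}^d$. $\mathcal{P}(X)$ is the set of Borel probability measures on $X$; $\mathcal{P}(\mathbb{T}^d)$ carries the weak-$*$ topology, metrized by the Kantorovich-Rubinstein (1-Wasserstein) distance $d_1$. $\pi:\mathbb{T}^d\times\mathbb{R}^d\to\mathbb{T}^d$ is the projection and $\pi\sharp\mu$ the push-forward. $H$ Tonelli: $H$ is $C^2$, $\partial^2H/\partial p^2$ is positive definite everywhere, and $H$ is superlinear in $p$ uniformly in $x$. The Lagrangian is $L(x,v)=\sup_{p\in\mathbb{R}^d}(\langle p,v\rangle-H(x,p))$. It satisfies: (L1) $\partial^2L/\partial v^2(x,v)$ is positive definite for every $(x,v)$; (L2) for each $K>0$ there is $C(K)\in\mathbb{R}$ with $L(x,v)\ge K|v|+C(K)$ for all $(x,v)$. Conditions on $F$: (F1) for each $m$, $x\mapsto F(x,m)$ is $C^2$, and there is $F_\infty>0$ with $\|F(\cdot,m)\|_\infty,\|D_xF(\cdot,m)\|_\infty\le F_\infty$ for all $m$; (F2) $F$ and $D_xF$ are continuous on $\mathbb{T}^d\times\mathcal{P}(\mathbb{T}^d)$; (F3) there is $\mathrm{Lip}(F)>0$ with $|F(x,m_1)-F(x,m_2)|\le\mathrm{Lip}(F)\,d_1(m_1,m_2)$ for all $x,m_1,m_2$. For $m\in\mathcal{P}(\mathbb{T}^d)$: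 $H_m(x,p)=H(x,p)-F(x,m)$, $L_m(x,v)=L(x,v)+F(x,m)$, and $c(m)$ is the Mañé critical value of $H_m$, i.e. the unique real $k$ such that $H_m(x,Du)=k$ has a viscosity solution on $\mathbb{T}^d$. For $\tau>0$, $\mathcal{L}_{\tau,m}(x,y)=\tau\big(L(x,\frac{y-x}{\tau})+F(x,m)\big)$, $x,y\in\mathbb{R}^d$. A measure $\mu\in\mathcal{P}(\mathbb{T}^d\times\mathbb{R}^d)$ is $\tau$-holonomic if $\int\varphi(x+\tau v)\,d\mu(x,v)=\int\varphi(x)\,d\mu(x,v)$ for all $\varphi\in C(\mathbb{T}^d)$; $\mathcal{P}_\tau(\mathbb{T}^d\times\mathbb{R}^d)$ is the set of these. $\bar L(\tau,m)$ is the unique constant for which the equation $u(y)+\tau\bar L(\tau,m)=\inf_{x\in\mathbb{R}^d}(u(x)+\mathcal{L}_{\tau,m}(x,y))$, $y\in\mathbb{R}^d$, has a continuous $\mathbb{Z}^d$-periodic solution $u$; it is known that it exists and that $\bar L(\tau,m)=\min_{\mu\in\mathcal{P}_\tau(\mathbb{T}^d\times\mathbb{R}^d)}\int L_m\,d\mu$. A measure attaining this minimum is called a minimizing $\tau$-holonomic measure for $L_m$. A solution of the mean field games system is a pair $(u,m)\in C(\mathbb{T}^d)\times\mathcal{P}(\mathbb{T}^d)$ such that the first equation holds in the viscosity sense and the second in the sense of distributions. Viscosity sense: whenever $\varphi\in C^1(\mathbb{T}^d)$ and $u-\varphi$ has a local maximum (resp. minimum) at $x_0$, then $H(x_0,D\varphi(x_0))\le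 F(x_0,m)+c(m)$ (resp. $\ge$). Distributional sense: $\int_{\mathbb{T}^d}\langle Df(x),\frac{\partial H}{\partial p}(x,Du(x))\rangle\,dm(x)=0$ for all $f\in C^\infty(\mathbb{T}^d)$, where it is part of the meaning that $Du(x)$ exists for $m$-a.e. $x$. *)

theory Defs
  imports "HOL-Probability.Probability"
begin

section \<open>The flat torus\<close>

quotient_type 'n torus =
  "real ^ 'n::finite" / "\<lambda>x y. \<forall>i. x $ i - y $ i \<in> \<int>"
proof (rule equivpI)
  show "reflp (\<lambda>x y :: real ^ 'n. \<forall>i. x $ i - y $ i \<in> \<int>)"
    by (simp add: reflp_def)
  show "symp (\<lambda>x y :: real ^ 'n. \<forall>i. x $ i - y $ i \<in> \<int>)"
  proof (rule sympI, rule allI)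
    fix x y :: "real ^ 'n" and i
    assume "\<forall>i. x $ i - y $ i \<in> \<int>"
    then have "- (x $ i - y $ i) \<in> \<int>"
      by (intro Ints_minus) auto
    then show "y $ i - x $ i \<in> \<int>" by simp
  qed
  show "transp (\<lambda>x y :: real ^ 'n. \<forall>i. x $ i - y $ i \<in> \<int>)"
  proof (rule transpI, rule allI)
    fix x y z :: "real ^ 'n" and i
    assume "\<forall>i. x $ i - y $ i \<in> \<int>" "\<forall>i. y $ i - z $ i \<in> \<int>"
    then have "(x $ i - y $ i) + (y $ i - z $ i) \<in> \<int>"
      by (intro Ints_add) auto
    then show "x $ i - z $ i \<in> \<int>" by simp
  qed
qed

lift_definition torus_of :: "real ^ 'n \<Rightarrow> 'n::finite torus" is "\<lambda>x. x" .

lift_definition torus_shift :: "'n::finite torus \<Rightarrow> real ^ 'n \<Rightarrow> 'n torus" is "\<lambda>x v. x + v"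
  by simp

lemma torus_of_eq_iff: "torus_of a = torus_of b \<longleftrightarrow> (\<forall>i. a $ i - b $ i \<in> \<int>)"
  by transfer simp

lemma torus_shift_of: "torus_shift (torus_of a) v = torus_of (a + v)"
  by transfer simp

lemma torus_of_surj: "\<exists>a. torus_of a = x"
  by transfer (metis diff_self Ints_0)

lemma torus_of_add_cong: "torus_of a = torus_of b \<Longrightarrow> torus_of (a + c) = torus_of (b + c)"
  by (metis torus_shift_of)

instantiation torus :: (finite) metric_space
begin

definition dist_torus :: "'a torus \<Rightarrow> 'a torus \<Rightarrow> real" where
  "dist_torus x y = setdist {a. torus_of a = x} {b. torus_of b = y}"

definition uniformity_torus :: "('a torus \<times> 'a torus) filter" where
  "uniformity_torus = (INF e\<in>{0<..}. principal {(x, y). dist x y < e})"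

definition open_torus :: "'a torus set \<Rightarrow> bool" where
  "open_torus U \<longleftrightarrow> (\<forall>x\<in>U. eventually (\<lambda>(x', y). x' = x \<longrightarrow> y \<in> U) uniformity)"

lemma dist_torus_of: "dist (torus_of a) y = setdist {a} {b. torus_of b = y}"
proof (rule antisym)
  show "dist (torus_of a) y \<le> setdist {a} {b. torus_of b = y}"
    unfolding dist_torus_def by (rule setdist_le_sing) simp
  have "setdist {a} {b. torus_of b = y} \<le> dist a' b'"
    if "torus_of a' = torus_of a" "torus_of b' = y" for a' b'
  proof -
    have "torus_of (b' + (a - a')) = torus_of b'"
      using that(1) unfolding torus_of_eq_iff
      by (metis (no_types, lifting) add_diff_cancel_left' minus_diff_eq Ints_minus vector_minus_component)
    then have "setdist {a} {b. torus_of b = y} \<le> dist a (b' + (a - a'))"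
      using that by (intro setdist_le_dist) auto
    also have "\<dots> = dist a' b'"
      by (simp add: dist_norm algebra_simps)
    finally show ?thesis .
  qed
  then show "setdist {a} {b. torus_of b = y} \<le> dist (torus_of a) y"
    unfolding dist_torus_def using torus_of_surj by (intro le_setdistI) blast+
qed

lemma closed_torus_fibre: "closed {b :: real ^ 'a. torus_of b = y}"
proof -
  obtain a where a: "torus_of a = y" using torus_of_surj by blast
  have "{b. torus_of b = y} = (\<Inter>i. (\<lambda>b. b $ i - a $ i) -` \<int>)"
    unfolding a[symmetric] by (auto simp: torus_of_eq_iff)
  also have "closed \<dots>"
    by (intro closed_INT ballI closed_vimage) (auto intro!: continuous_intros)
  finally show ?thesis .
qed

instance proof
  fix x y z :: "'a torus"
  obtain a where a: "torus_of a = x" using torus_of_surj by blast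
  obtain c where c: "torus_of c = z" using torus_of_surj by blast
  have ne: "{b. torus_of b = y} \<noteq> {}" using torus_of_surj by blast
  show "(dist x y = 0) = (x = y)"
  proof
    assume "dist x y = 0"
    then have "setdist {a} {b. torus_of b = y} = 0"
      using dist_torus_of a by metis
    then have "a \<in> {b. torus_of b = y}"
      using setdist_eq_0_closed[OF closed_torus_fibre, of a y] ne by blast
    then show "x = y" using a by simp
  next
    assume "x = y"
    then show "dist x y = 0" by (simp add: dist_torus_def setdist_refl)
  qed
  have "dist x y \<le> setdist {a. torus_of a = x} {c} + setdist {c} {b. torus_of b = y}"
    unfolding dist_torus_def by (rule setdist_triangle)
  also have "\<dots> = dist z x + dist z y"
    by (simp add: c[symmetric] dist_torus_of setdist_sym[of _ "{c}"])
  finally show "dist x y \<le> dist x z + dist y z"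
    by (simp add: dist_torus_def setdist_sym)
qed (rule uniformity_torus_def open_torus_def)+

end

lemma dist_torus_of_le: "dist (torus_of a) (torus_of b) \<le> dist a b"
  unfolding dist_torus_def by (rule setdist_le_dist) auto

lemma continuous_on_torus_of [continuous_intros]: "continuous_on S torus_of"
  unfolding continuous_on_iff by (metis dist_torus_of_le le_less_trans)

text \<open>The metric induces the quotient topology.\<close>

lemma open_torus_iff: "open U \<longleftrightarrow> open (torus_of -` U)"
proof
  assume "open U"
  then show "open (torus_of -` U)"
    by (rule open_vimage) (rule continuous_on_torus_of)
next
  assume *: "open (torus_of -` U)"
  show "open U"
    unfolding open_dist
  proof
    fix x assume "x \<in> U"
    obtain a where a: "torus_of a = x" using torus_of_surj by blast
    then obtain e where e: "e > 0" "\<And>b. dist b a < e \<Longrightarrow> torus_of b \<in> U"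
      using * \<open>x \<in> U\<close> unfolding open_dist by (metis vimage_eq)
    have "y \<in> U" if "dist y x < e" for y
    proof -
      have "setdist {a} {b. torus_of b = y} < e"
        using that a by (metis dist_commute dist_torus_of)
      then obtain b where "torus_of b = y" "dist a b < e"
        using torus_of_surj by (metis (mono_tags, lifting) empty_iff insert_not_empty mem_Collect_eq setdist_ltE singletonD)
      then show ?thesis using e(2) by (metis dist_commute)
    qed
    then show "\<exists>e>0. \<forall>y. dist y x < e \<longrightarrow> y \<in> U" using e(1) by blast
  qed
qed

lemma open_torus_of_image: "open S \<Longrightarrow> open (torus_of ` S)"
proof -
  assume "open S"
  have "torus_of -` torus_of ` S = (\<Union>k\<in>{k. torus_of k = torus_of 0}. (+) k ` S)"
  proof (intro equalityI subsetI)
    fix a assume "a \<in> torus_of -` torus_of ` S"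
    then obtain s where s: "s \<in> S" "torus_of a = torus_of s" by auto
    then have "torus_of (a - s) = torus_of 0" by (simp add: torus_of_eq_iff)
    then show "a \<in> (\<Union>k\<in>{k. torus_of k = torus_of 0}. (+) k ` S)"
      using s(1) by (intro UN_I[of "a - s"]) (auto intro: image_eqI[of _ _ s])
  qed (auto simp: torus_of_eq_iff image_iff, metis add_diff_cancel_right' torus_of_eq_iff vector_add_component)
  then show ?thesis
    unfolding open_torus_iff using open_translation[OF \<open>open S\<close>] by (metis (no_types, lifting) open_UN)
qed

lemma compact_torus: "compact (UNIV :: 'n::finite torus set)"
proof -
  have "torus_of ` cbox 0 (1 :: real ^ 'n) = UNIV"
  proof (intro equalityI subsetI)
    fix x :: "'n torus"
    obtain a where a: "torus_of a = x" using torus_of_surj by blast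
    have "torus_of (\<chi> i. frac (a $ i)) = x"
      unfolding a[symmetric] by (simp add: torus_of_eq_iff frac_def)
    moreover have "(\<chi> i. frac (a $ i)) \<in> cbox 0 (1 :: real ^ 'n)"
      by (auto simp: mem_box_cart frac_ge_0 less_imp_le[OF frac_lt_1])
    ultimately show "x \<in> torus_of ` cbox 0 1" by blast
  qed simp
  then show ?thesis
    by (metis compact_cbox compact_continuous_image continuous_on_torus_of)
qed

instance torus :: (finite) polish_space
proof
  obtain B :: "(real ^ 'a) set set" where B: "countable B" "topological_basis B"
    using ex_countable_basis by blast
  have "topological_basis ((`) torus_of ` B)"
  proof (rule topological_basisI)
    show "open U" if U: "U \<in> (`) torus_of ` B" for U
    proof -
      obtain V where V: "U = torus_of ` V" "V \<in> B" using U by (rule imageE)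
      show ?thesis
        unfolding V(1) by (rule open_torus_of_image[OF topological_basis_open[OF B(2) V(2)]])
    qed
    fix U and x :: "'a torus" assume "open U" "x \<in> U"
    obtain a where "torus_of a = x" using torus_of_surj by blast
    have "open (torus_of -` U)" "a \<in> torus_of -` U"
      using \<open>open U\<close> \<open>x \<in> U\<close> \<open>torus_of a = x\<close> by (simp_all add: open_torus_iff)
    then obtain V where "V \<in> B" "a \<in> V" "V \<subseteq> torus_of -` U"
      by (rule topological_basisE[OF B(2)])
    then have "torus_of ` V \<in> (`) torus_of ` B" "x \<in> torus_of ` V" "torus_of ` V \<subseteq> U"
      using \<open>torus_of a = x\<close> by (auto intro: imageI)
    then show "\<exists>W\<in>(`) torus_of ` B. x \<in> W \<and> W \<subseteq> U"
      by (intro bexI[of _ "torus_of ` V"] conjI)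
  qed
  then have "open = generate_topology ((`) torus_of ` B)"
    by (rule topological_basis_imp_subbasis)
  then show "\<exists>B::'a torus set set. countable B \<and> open = generate_topology B"
    using countable_image[OF B(1)] by (intro exI[of _ "(`) torus_of ` B"] conjI)
  show "convergent X" if X: "Cauchy X" for X :: "nat \<Rightarrow> 'a torus"
  proof -
    obtain l where "X \<longlonglongrightarrow> l"
      using compact_imp_complete[OF compact_torus] X unfolding complete_def by blast
    then show ?thesis by (rule convergentI)
  qed
qed

section \<open>Differential calculus\<close>

text \<open>In finite dimensions \<open>C_k k f\<close> says that \<open>f\<close> is \<open>k\<close> times continuously
  differentiable: all directional derivatives of order \<open>k\<close> are continuous.\<close>

primrec C_k :: "nat \<Rightarrow> ('a::real_normed_vector \<Rightarrow> 'b::real_normed_vector) \<Rightarrow> bool" where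
  "C_k 0 f \<longleftrightarrow> continuous_on UNIV f"
| "C_k (Suc k) f \<longleftrightarrow> (\<forall>x. f differentiable (at x)) \<and>
     (\<forall>v. C_k k (\<lambda>x. frechet_derivative f (at x) v))"

definition gradient :: "('a::real_inner \<Rightarrow> real) \<Rightarrow> 'a \<Rightarrow> 'a" where
  "gradient f x = (THE D. GDERIV f x :> D)"

definition pos_def_hessian_at :: "('a::real_inner \<Rightarrow> real) \<Rightarrow> 'a \<Rightarrow> bool" where
  "pos_def_hessian_at f x \<longleftrightarrow> (\<exists>g A. (\<forall>y. GDERIV f y :> g y) \<and> (g has_derivative A) (at x) \<and>
     (\<forall>w. w \<noteq> 0 \<longrightarrow> 0 < A w \<bullet> w))"

definition torus_C_k :: "nat \<Rightarrow> ('n::finite torus \<Rightarrow> real) \<Rightarrow> bool" where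
  "torus_C_k k f \<longleftrightarrow> C_k k (\<lambda>x. f (torus_of x))"

definition torus_smooth :: "('n::finite torus \<Rightarrow> real) \<Rightarrow> bool" where
  "torus_smooth f \<longleftrightarrow> (\<forall>k. torus_C_k k f)"

definition torus_differentiable :: "('n::finite torus \<Rightarrow> real) \<Rightarrow> 'n torus \<Rightarrow> bool" where
  "torus_differentiable f x \<longleftrightarrow> (\<lambda>v. f (torus_shift x v)) differentiable (at 0)"

definition torus_gradient :: "('n::finite torus \<Rightarrow> real) \<Rightarrow> 'n torus \<Rightarrow> real ^ 'n" where
  "torus_gradient f x = gradient (\<lambda>v. f (torus_shift x v)) 0"

section \<open>Borel probability measures\<close>

definition borel_prob :: "'a::topological_space measure set" where
  "borel_prob = {m. prob_space m \<and> sets m = sets borel}"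

definition weak_star :: "'n::finite torus measure topology" where
  "weak_star = topology_generated_by
     {{m \<in> borel_prob. (\<integral>x. \<phi> x \<partial>m) \<in> U} | \<phi> U. continuous_on UNIV \<phi> \<and> open (U :: real set)}"

lemma topspace_weak_star: "topspace weak_star = borel_prob"
proof -
  have "borel_prob = {m :: 'n::finite torus measure. m \<in> borel_prob \<and> (\<integral>x. 0 \<partial>m) \<in> (UNIV :: real set)}"
    by simp
  then have "borel_prob \<in> {{m :: 'n::finite torus measure. m \<in> borel_prob \<and> (\<integral>x. \<phi> x \<partial>m) \<in> U} | \<phi> U.
      continuous_on UNIV \<phi> \<and> open (U :: real set)}"
    using continuous_on_const open_UNIV by blast
  then show ?thesis
    unfolding weak_star_def topology_generated_by_topspace by blast
qed

text \<open>The Kantorovich-Rubinstein distance in its dual form. The supremum is over a set bounded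
  by the diameter of the torus.\<close>

definition KR_dist :: "'n::finite torus measure \<Rightarrow> 'n torus measure \<Rightarrow> real" where
  "KR_dist m1 m2 = (SUP f \<in> {f. 1-lipschitz_on UNIV f}. (\<integral>x. f x \<partial>m1) - (\<integral>x. f x \<partial>m2))"

section \<open>Hamiltonians and Lagrangians\<close>

definition tonelli :: "('n::finite torus \<Rightarrow> real ^ 'n \<Rightarrow> real) \<Rightarrow> bool" where
  "tonelli H \<longleftrightarrow>
     C_k 2 (\<lambda>(x, p). H (torus_of x) p) \<and>
     (\<forall>x p. pos_def_hessian_at (H x) p) \<and>
     (\<forall>K. \<forall>\<^sub>F p in at_infinity. \<forall>x. K \<le> H x p / norm p)"

definition lagrangian :: "('n::finite torus \<Rightarrow> real ^ 'n \<Rightarrow> real) \<Rightarrow> 'n torus \<Rightarrow> real ^ 'n \<Rightarrow> real" where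
  "lagrangian H x v = (SUP p. p \<bullet> v - H x p)"

definition L1 :: "('n::finite torus \<Rightarrow> real ^ 'n \<Rightarrow> real) \<Rightarrow> bool" where
  "L1 L \<longleftrightarrow> (\<forall>x v. pos_def_hessian_at (L x) v)"

definition L2 :: "('n::finite torus \<Rightarrow> real ^ 'n \<Rightarrow> real) \<Rightarrow> bool" where
  "L2 L \<longleftrightarrow> (\<forall>K>0. \<exists>C. \<forall>x v. L x v \<ge> K * norm v + C)"

definition F1 :: "('n::finite torus \<Rightarrow> 'n torus measure \<Rightarrow> real) \<Rightarrow> bool" where
  "F1 F \<longleftrightarrow> (\<forall>m\<in>borel_prob. torus_C_k 2 (\<lambda>x. F x m)) \<and>
     (\<exists>F_inf>0. \<forall>m\<in>borel_prob. \<forall>x.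
        \<bar>F x m\<bar> \<le> F_inf \<and> norm (torus_gradient (\<lambda>y. F y m) x) \<le> F_inf)"

definition F2 :: "('n::finite torus \<Rightarrow> 'n torus measure \<Rightarrow> real) \<Rightarrow> bool" where
  "F2 F \<longleftrightarrow>
     continuous_map (prod_topology euclidean weak_star) euclidean (\<lambda>(x, m). F x m) \<and>
     continuous_map (prod_topology euclidean weak_star) euclidean
       (\<lambda>(x, m). torus_gradient (\<lambda>y. F y m) x)"

definition F3 :: "('n::finite torus \<Rightarrow> 'n torus measure \<Rightarrow> real) \<Rightarrow> bool" where
  "F3 F \<longleftrightarrow> (\<exists>Lip>0. \<forall>x. \<forall>m1\<in>borel_prob. \<forall>m2\<in>borel_prob.
     \<bar>F x m1 - F x m2\<bar> \<le> Lip * KR_dist m1 m2)"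

definition mfg_hamiltonian where
  "mfg_hamiltonian H F m x p = H x p - F x m"
  for H :: "'n::finite torus \<Rightarrow> real ^ 'n \<Rightarrow> real" and F :: "'n torus \<Rightarrow> 'n torus measure \<Rightarrow> real"

definition mfg_lagrangian where
  "mfg_lagrangian H F m x v = lagrangian H x v + F x m"
  for H :: "'n::finite torus \<Rightarrow> real ^ 'n \<Rightarrow> real" and F :: "'n torus \<Rightarrow> 'n torus measure \<Rightarrow> real"

section \<open>Viscosity solutions and the critical value\<close>

text \<open>Continuous viscosity solutions of \<open>H(x, Du) = f(x)\<close> on the torus.\<close>

definition viscosity_solution ::
  "('n::finite torus \<Rightarrow> real ^ 'n \<Rightarrow> real) \<Rightarrow> ('n torus \<Rightarrow> real) \<Rightarrow> ('n torus \<Rightarrow> real) \<Rightarrow> bool" where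
  "viscosity_solution H f u \<longleftrightarrow> continuous_on UNIV u \<and>
     (\<forall>\<phi> x. torus_C_k 1 \<phi> \<longrightarrow>
        ((\<forall>\<^sub>F y in nhds x. u y - \<phi> y \<le> u x - \<phi> x) \<longrightarrow> H x (torus_gradient \<phi> x) \<le> f x) \<and>
        ((\<forall>\<^sub>F y in nhds x. u y - \<phi> y \<ge> u x - \<phi> x) \<longrightarrow> H x (torus_gradient \<phi> x) \<ge> f x))"

definition critical_value :: "('n::finite torus \<Rightarrow> real ^ 'n \<Rightarrow> real) \<Rightarrow> real" where
  "critical_value H = (THE k. \<exists>u. viscosity_solution H (\<lambda>_. k) u)"

section \<open>The discrete problem\<close>

definition discrete_action ::
  "real \<Rightarrow> ('n::finite torus \<Rightarrow> real ^ 'n \<Rightarrow> real) \<Rightarrow> real ^ 'n \<Rightarrow> real ^ 'n \<Rightarrow> real" where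
  "discrete_action \<tau> L x y = \<tau> * L (torus_of x) ((1 / \<tau>) *\<^sub>R (y - x))"

definition lax_oleinik_solution ::
  "real \<Rightarrow> ('n::finite torus \<Rightarrow> real ^ 'n \<Rightarrow> real) \<Rightarrow> real \<Rightarrow> ('n torus \<Rightarrow> real) \<Rightarrow> bool" where
  "lax_oleinik_solution \<tau> L c u \<longleftrightarrow> continuous_on UNIV u \<and>
     (\<forall>y. u (torus_of y) + \<tau> * c = (INF x. u (torus_of x) + discrete_action \<tau> L x y))"

definition L_bar :: "real \<Rightarrow> ('n::finite torus \<Rightarrow> real ^ 'n \<Rightarrow> real) \<Rightarrow> real" where
  "L_bar \<tau> L = (THE c. \<exists>u. lax_oleinik_solution \<tau> L c u)"

definition holonomic :: "real \<Rightarrow> ('n::finite torus \<times> (real ^ 'n)) measure set" where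
  "holonomic \<tau> = {\<mu> \<in> borel_prob. \<forall>\<phi> :: 'n torus \<Rightarrow> real. continuous_on UNIV \<phi> \<longrightarrow>
     (\<integral>(x, v). \<phi> (torus_shift x (\<tau> *\<^sub>R v)) \<partial>\<mu>) = (\<integral>(x, v). \<phi> x \<partial>\<mu>)}"

text \<open>The Lagrangians considered are continuous and bounded below, so a measure for which
  \<open>L\<close> is not integrable has action \<open>+\<infinity>\<close> and does not compete; the Bochner integral would
  assign it the value \<open>0\<close>.\<close>

definition minimizing_holonomic ::
  "real \<Rightarrow> ('n::finite torus \<Rightarrow> real ^ 'n \<Rightarrow> real) \<Rightarrow> ('n torus \<times> (real ^ 'n)) measure \<Rightarrow> bool" where
  "minimizing_holonomic \<tau> L \<eta> \<longleftrightarrow>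
     \<eta> \<in> holonomic \<tau> \<and> integrable \<eta> (\<lambda>(x, v). L x v) \<and>
     (\<forall>\<mu>\<in>holonomic \<tau>. integrable \<mu> (\<lambda>(x, v). L x v) \<longrightarrow>
        (\<integral>(x, v). L x v \<partial>\<eta>) \<le> (\<integral>(x, v). L x v \<partial>\<mu>))"

definition discrete_equilibrium ::
  "('n::finite torus \<Rightarrow> real ^ 'n \<Rightarrow> real) \<Rightarrow> ('n torus \<Rightarrow> 'n torus measure \<Rightarrow> real) \<Rightarrow>
   real \<Rightarrow> 'n torus measure \<Rightarrow> bool" where
  "discrete_equilibrium H F \<tau> m \<longleftrightarrow> m \<in> borel_prob \<and>
     (\<exists>\<eta>. minimizing_holonomic \<tau> (mfg_lagrangian H F m) \<eta> \<and> m = distr \<eta> borel fst)"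

section \<open>The stationary mean field games system\<close>

text \<open>\<open>torus_gradient u\<close> has a fixed unspecified value where \<open>u\<close> is not differentiable; by the
  third conjunct this happens only on an \<open>m\<close>-null set. Requiring \<open>has_bochner_integral\<close> excludes
  that the integral is \<open>0\<close> for lack of integrability.\<close>

definition mfg_solution ::
  "('n::finite torus \<Rightarrow> real ^ 'n \<Rightarrow> real) \<Rightarrow> ('n torus \<Rightarrow> 'n torus measure \<Rightarrow> real) \<Rightarrow>
   ('n torus \<Rightarrow> real) \<Rightarrow> 'n torus measure \<Rightarrow> bool" where
  "mfg_solution H F u m \<longleftrightarrow> m \<in> borel_prob \<and>
     viscosity_solution H (\<lambda>x. F x m + critical_value (mfg_hamiltonian H F m)) u \<and>
     (AE x in m. torus_differentiable u x) \<and>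
     (\<forall>f. torus_smooth f \<longrightarrow>
        has_bochner_integral m
          (\<lambda>x. torus_gradient f x \<bullet> gradient (H x) (torus_gradient u x)) 0)"

end

theory Submission
  imports Defs "HOL-Complex_Analysis.Great_Picard"
begin

text \<open>For (i), fix \<open>\<tau>\<close>. Weak KAM solutions of the discrete equation have calibrated velocities bounded
  by a constant \<open>R\<close> that depends neither on \<open>\<tau>\<close> nor on the measure, so all minimizing measures of interest
  live on the compact set \<open>\<bar>v\<bar> \<le> R\<close>. Brouwer's theorem on mixtures of finitely many minimizing
  measures gives approximate equilibria, and these converge to an equilibrium.

  For (ii), equilibria and Lipschitz weak KAM solutions converge along a subsequence. Summing the
  discrete inequalities along straight and calibrated orbits shows that \<open>u0\<close> is a viscosity solution. Almost every
  point of the limit measure is a limit of points with calibrated orbits of length about \<open>\<epsilon>\<close> in both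
  time directions; perturbing these orbits bounds \<open>u0\<close> from above and below to first order with
  error \<open>O(\<epsilon>)\<close>. Hence \<open>u0\<close> is differentiable there, and equality in the Fenchel-Young inequality
  identifies the velocity as \<open>\<partial>H/\<partial>p (x, Du0(x))\<close>; holonomy then turns into the continuity equation.\<close>

section \<open>Functions on the torus\<close>

text \<open>Two obstacles shape the proof. First, the best response to a measure \<open>m\<close> is
  a set of minimizing measures in an infinite-dimensional space. Brouwer's theorem suffices because
  \<open>m\<close> acts only through the function F(x,m), these functions form a totally bounded
  family in the sup norm, the action is affine in the minimizing measure, and the minimal action
  moves by at most the sup distance of the functions F. Second, the discrete solutions are merely
  Lipschitz and weak limits of measures carry no pointwise information, so gradients cannot be
  passed to the limit. Instead each discrete solution is squeezed between affine functions, up to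
  \<epsilon>|h|, on a ball whose radius depends on \<epsilon> alone; such bounds survive uniform
  convergence. The perturbed time span must be of order \<epsilon>: L enters only as a Lipschitz
  function of x, and over that span the error from shifted base points is O(\<epsilon>|h|). The
  critical value c(m_0) appears as minus the limit of the constants \<open>L_bar\<close>; being
  defined through uniqueness, it is identified by a comparison principle.\<close>

lemma torus_shift_0 [simp]: "torus_shift x 0 = x"
  by transfer simp

lemma torus_shift_shift [simp]: "torus_shift (torus_shift x v) w = torus_shift x (v + w)"
  by transfer (simp add: add.assoc)

lemma dist_torus_shift: "dist x (torus_shift x v) \<le> norm v"
proof -
  obtain a where a: "torus_of a = x" using torus_of_surj by blast
  have "dist (torus_of a) (torus_of (a + v)) \<le> dist a (a + v)" by (rule dist_torus_of_le)
  then show ?thesis by (simp add: a[symmetric] torus_shift_of dist_norm)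
qed

text \<open>Fibres of \<open>torus_of\<close> are closed, so the infimum defining
  \<open>dist\<close> is attained. Estimates in \<open>dist x y\<close> can then be proved along one
  displacement vector of exactly that length.\<close>

lemma torus_displacement: "\<exists>v. torus_shift x v = y \<and> norm v = dist x y"
proof -
  obtain a where a: "torus_of a = x" using torus_of_surj by blast
  have "{b. torus_of b = y} \<noteq> {}" using torus_of_surj by blast
  then obtain b where b: "torus_of b = y" "dist a b = setdist {a} {b. torus_of b = y}"
    using setdist_compact_closed[of "{a}" "{b. torus_of b = y}"] closed_torus_fibre by auto
  have "torus_shift x (b - a) = y" using a b by (simp add: a[symmetric] torus_shift_of)
  moreover have "norm (b - a) = dist x y"
    using b(2) dist_torus_of[of a y] a by (simp add: dist_norm norm_minus_commute)
  ultimately show ?thesis by blast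
qed

lemma dist_torus_shift_le: "dist (torus_shift x v) (torus_shift y w) \<le> dist x y + norm (v - w)"
proof -
  obtain z where z: "torus_shift x z = y" "norm z = dist x y" using torus_displacement by blast
  have "dist (torus_shift x v) (torus_shift (torus_shift x v) (z + w - v)) \<le> norm (z + w - v)"
    by (rule dist_torus_shift)
  also have "\<dots> \<le> norm z + norm (v - w)"
    using norm_triangle_ineq[of z "w - v"] by (simp add: add_diff_eq norm_minus_commute)
  finally show ?thesis unfolding z(2) by (simp flip: z(1))
qed

lemma continuous_on_torus_shift [continuous_intros]:
  assumes "continuous_on S f" "continuous_on S g"
  shows "continuous_on S (\<lambda>z. torus_shift (f z) (g z))"
  unfolding continuous_on_def
proof
  fix z assume z: "z \<in> S"
  have "((\<lambda>y. dist (f y) (f z) + norm (g y - g z)) \<longlongrightarrow> 0) (at z within S)"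
  proof (rule tendsto_eq_rhs[OF tendsto_add])
    show "((\<lambda>y. dist (f y) (f z)) \<longlongrightarrow> 0) (at z within S)"
      using assms(1) z unfolding continuous_on_def by (blast intro: tendsto_dist_iff[THEN iffD1])
    show "((\<lambda>y. norm (g y - g z)) \<longlongrightarrow> 0) (at z within S)"
      using assms(2) z unfolding continuous_on_def dist_norm[symmetric] by (blast intro: tendsto_dist_iff[THEN iffD1])
  qed simp
  then have "((\<lambda>y. dist (torus_shift (f y) (g y)) (torus_shift (f z) (g z))) \<longlongrightarrow> 0) (at z within S)"
    by (rule Lim_null_comparison[rotated]) (simp add: dist_torus_shift_le)
  then show "((\<lambda>z. torus_shift (f z) (g z)) \<longlongrightarrow> torus_shift (f z) (g z)) (at z within S)"
    by (rule tendsto_dist_iff[THEN iffD2])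
qed

lemma continuous_torus_shift_map: "continuous_on UNIV (\<lambda>(x, v). torus_shift x v)"
  unfolding case_prod_unfold by (intro continuous_intros)

lemma tendsto_torus_shift [tendsto_intros]:
  assumes "(f \<longlongrightarrow> x) F" "(g \<longlongrightarrow> v) F"
  shows "((\<lambda>z. torus_shift (f z) (g z)) \<longlongrightarrow> torus_shift x v) F"
  using continuous_on_tendsto_compose[OF continuous_torus_shift_map tendsto_Pair[OF assms]] by simp

lemma torus_seq_compact:
  fixes x :: "nat \<Rightarrow> 'n::finite torus"
  obtains l r where "strict_mono r" "(x \<circ> r) \<longlonglongrightarrow> l"
  using compact_torus compact_imp_seq_compact unfolding seq_compact_def by (metis UNIV_I)

lemma torus_bounded_above:
  fixes f :: "'n::finite torus \<Rightarrow> real"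
  assumes "continuous_on UNIV f"
  obtains x where "\<And>y. f y \<le> f x"
  using continuous_attains_sup[OF compact_torus _ assms] by auto

lemma torus_bounded_below:
  fixes f :: "'n::finite torus \<Rightarrow> real"
  assumes "continuous_on UNIV f"
  obtains x where "\<And>y. f x \<le> f y"
  using continuous_attains_inf[OF compact_torus _ assms] by auto

lemma torus_abs_bounded:
  fixes f :: "'n::finite torus \<Rightarrow> real"
  assumes "continuous_on UNIV f"
  obtains B where "\<And>y. \<bar>f y\<bar> \<le> B"
proof -
  have "continuous_on UNIV (\<lambda>x. \<bar>f x\<bar>)" using assms by (intro continuous_intros)
  then show ?thesis using torus_bounded_above[of "\<lambda>x. \<bar>f x\<bar>"] that by blast
qed

lemma torus_dist_bounded: obtains D where "0 \<le> D" "\<And>x y :: 'n::finite torus. dist x y \<le> D"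
proof -
  have "bounded (UNIV :: 'n torus set)" using compact_imp_bounded[OF compact_torus] .
  then obtain a e where "\<forall>x::'n torus. dist a x \<le> e" unfolding bounded_def by auto
  then have "dist x y \<le> 2 * e" for x y :: "'n torus"
    by (smt (verit) dist_commute dist_triangle)
  then show ?thesis using that[of "2 * e"] by (metis zero_le_dist order_trans)
qed

text \<open>The classical theorem applies to the lifts on the unit cube. Its limit function is known
  only on the cube, with no matching of opposite faces, so it is transferred back through a choice
  of representatives.\<close>

lemma torus_Arzela_Ascoli:
  fixes f :: "nat \<Rightarrow> 'n::finite torus \<Rightarrow> real"
  assumes bound: "\<And>i x. \<bar>f i x\<bar> \<le> M" and lip: "\<And>i x y. \<bar>f i x - f i y\<bar> \<le> K * dist x y"
  obtains g r where "strict_mono r" "continuous_on UNIV g" "uniform_limit UNIV (\<lambda>i. f (r i)) g sequentially"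
proof -
  let ?S = "cbox 0 1 :: (real ^ 'n) set"
  have K: "\<bar>f i x - f i y\<bar> \<le> (\<bar>K\<bar> + 1) * dist x y" for i x y
    using lip[of i x y] zero_le_dist[of x y] by (smt (verit) mult_right_mono)
  have ec: "\<exists>d. 0 < d \<and> (\<forall>n y. y \<in> ?S \<and> norm(x - y) < d \<longrightarrow> norm(f n (torus_of x) - f n (torus_of y)) < e)"
    if "x \<in> ?S" "0 < e" for x e
  proof (intro exI[of _ "e / (\<bar>K\<bar> + 1)"] conjI allI impI)
    show "0 < e / (\<bar>K\<bar> + 1)" using that by simp
    fix n y assume "y \<in> ?S \<and> norm (x - y) < e / (\<bar>K\<bar> + 1)"
    then have "dist (torus_of x) (torus_of y) < e / (\<bar>K\<bar> + 1)"
      by (metis dist_norm dist_torus_of_le le_less_trans)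
    then have "(\<bar>K\<bar> + 1) * dist (torus_of x) (torus_of y) < e"
      by (simp add: pos_less_divide_eq mult.commute add_pos_nonneg)
    then show "norm(f n (torus_of x) - f n (torus_of y)) < e"
      using K[of n "torus_of x" "torus_of y"] by simp
  qed
  obtain g r where g: "continuous_on ?S g" "strict_mono (r :: nat \<Rightarrow> nat)"
    "\<And>e. 0 < e \<Longrightarrow> \<exists>N. \<forall>n x. n \<ge> N \<and> x \<in> ?S \<longrightarrow> norm(f (r n) (torus_of x) - g x) < e"
    by (rule Arzela_Ascoli[of ?S "\<lambda>n x. f n (torus_of x)" M]) (use bound ec in auto)
  define rep where "rep x = (SOME a. a \<in> ?S \<and> torus_of a = x)" for x :: "'n torus"
  have rep: "rep x \<in> ?S \<and> torus_of (rep x) = x" for x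
  proof -
    obtain a where a: "torus_of a = x" using torus_of_surj by blast
    have "torus_of (\<chi> i. frac (a $ i)) = x"
      unfolding a[symmetric] by (simp add: torus_of_eq_iff frac_def)
    moreover have "(\<chi> i. frac (a $ i)) \<in> ?S"
      by (auto simp: mem_box_cart frac_ge_0 less_imp_le[OF frac_lt_1])
    ultimately have "\<exists>a. a \<in> ?S \<and> torus_of a = x" by blast
    then show ?thesis unfolding rep_def by (rule someI_ex)
  qed
  have ul: "uniform_limit UNIV (\<lambda>i. f (r i)) (\<lambda>x. g (rep x)) sequentially"
    unfolding uniform_limit_iff eventually_sequentially
  proof (intro allI impI)
    fix e :: real assume "0 < e"
    then obtain N where "\<forall>n x. n \<ge> N \<and> x \<in> ?S \<longrightarrow> norm(f (r n) (torus_of x) - g x) < e" using g(3) by blast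
    then show "\<exists>N. \<forall>n\<ge>N. \<forall>x\<in>UNIV. dist (f (r n) x) (g (rep x)) < e"
      by (metis dist_norm rep)
  qed
  \<comment> \<open>\<open>rep\<close> may jump, so continuity is inherited from the uniformly
    convergent continuous functions instead of being composed from that of \<open>g\<close>.\<close>
  have "continuous_on UNIV (\<lambda>x. g (rep x))"
  proof (rule uniform_limit_theorem[OF _ ul])
    have "continuous_on UNIV (f i)" for i
    proof (rule lipschitz_on_continuous_on)
      show "(\<bar>K\<bar> + 1)-lipschitz_on UNIV (f i)"
        using K by (intro lipschitz_onI) (auto simp: dist_real_def)
    qed
    then show "\<forall>\<^sub>F n in sequentially. continuous_on UNIV (f (r n))" by simp
  qed simp
  then show ?thesis using ul g(2) that by blast
qed

section \<open>Gradients and the mean value theorem on the torus\<close>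

lemma GDERIV_iff_eps:
  fixes F :: "'a::real_inner \<Rightarrow> real"
  shows "GDERIV F x :> p \<longleftrightarrow> (\<forall>\<epsilon>>0. \<exists>\<rho>>0. \<forall>h. norm h < \<rho> \<longrightarrow> \<bar>F (x + h) - F x - h \<bullet> p\<bar> \<le> \<epsilon> * norm h)"
proof -
  have "GDERIV F x :> p \<longleftrightarrow> (\<forall>e>0. \<exists>d>0. \<forall>y. norm (y - x) < d \<longrightarrow> \<bar>F y - F x - (y - x) \<bullet> p\<bar> \<le> e * norm (y - x))"
    unfolding gderiv_def has_derivative_at_alt by (simp add: bounded_linear_inner_left)
  also have "\<dots> \<longleftrightarrow> (\<forall>\<epsilon>>0. \<exists>\<rho>>0. \<forall>h. norm h < \<rho> \<longrightarrow> \<bar>F (x + h) - F x - h \<bullet> p\<bar> \<le> \<epsilon> * norm h)"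
    by (metis add_diff_cancel_left' add.commute diff_add_cancel)
  finally show ?thesis .
qed

lemma gradient_eqI:
  assumes "GDERIV F x :> p" shows "gradient F x = p"
  unfolding gradient_def
proof (rule the_equality, rule assms)
  fix q assume "GDERIV F x :> q"
  then have "(\<lambda>h. h \<bullet> q) = (\<lambda>h. h \<bullet> p)"
    using assms unfolding gderiv_def by (rule has_derivative_unique)
  then have "(q - p) \<bullet> q = (q - p) \<bullet> p" by metis
  then have "(q - p) \<bullet> (q - p) = 0" by (simp add: inner_diff_right)
  then show "q = p" by simp
qed

lemma has_derivative_imp_GDERIV:
  fixes F :: "'a::euclidean_space \<Rightarrow> real"
  assumes "(F has_derivative D) (at x)"
  shows "GDERIV F x :> adjoint D 1"
proof -
  have "linear D" using assms has_derivative_bounded_linear bounded_linear.linear by blast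
  then have "D = (\<lambda>h. h \<bullet> adjoint D 1)" using adjoint_works[of D _ 1] by (auto simp: fun_eq_iff)
  then show ?thesis using assms unfolding gderiv_def by simp
qed

lemma differentiable_imp_GDERIV:
  fixes F :: "'a::euclidean_space \<Rightarrow> real"
  assumes "F differentiable (at x)"
  shows "GDERIV F x :> gradient F x"
  using assms has_derivative_imp_GDERIV gradient_eqI unfolding differentiable_def by metis

lemma torus_differentiable_GDERIV:
  "torus_differentiable f x \<Longrightarrow> GDERIV (\<lambda>v. f (torus_shift x v)) 0 :> torus_gradient f x"
  unfolding torus_differentiable_def torus_gradient_def by (rule differentiable_imp_GDERIV)

lemma torus_differentiableI:
  assumes "GDERIV (\<lambda>v. f (torus_shift x v)) 0 :> p"
  shows "torus_differentiable f x" "torus_gradient f x = p"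
  using assms gradient_eqI unfolding torus_differentiable_def torus_gradient_def gderiv_def differentiable_def by blast+

lemma torus_differentiable_eps:
  assumes "torus_differentiable f x" "\<epsilon> > 0"
  shows "\<exists>\<rho>>0. \<forall>h. norm h < \<rho> \<longrightarrow> \<bar>f (torus_shift x h) - f x - torus_gradient f x \<bullet> h\<bar> \<le> \<epsilon> * norm h"
  using torus_differentiable_GDERIV[OF assms(1)] assms(2) unfolding GDERIV_iff_eps by (simp add: inner_commute)

lemma C_k_continuous: "C_k k f \<Longrightarrow> continuous_on UNIV f"
  by (cases k) (auto intro!: differentiable_imp_continuous_on differentiable_at_imp_differentiable_on)

lemma torus_C_k_has_derivative:
  assumes "torus_C_k (Suc k) f"
  shows "((\<lambda>b. f (torus_of b)) has_derivative (\<lambda>h. h \<bullet> torus_gradient f (torus_of a))) (at a)"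
    "torus_differentiable f (torus_of a)"
proof -
  have "(\<lambda>b. f (torus_of b)) differentiable (at a)" using assms unfolding torus_C_k_def by simp
  then have d: "GDERIV (\<lambda>b. f (torus_of b)) a :> gradient (\<lambda>b. f (torus_of b)) a" (is "GDERIV _ _ :> ?p")
    by (rule differentiable_imp_GDERIV)
  then have "GDERIV (\<lambda>v. f (torus_shift (torus_of a) v)) 0 :> ?p"
    unfolding GDERIV_iff_eps by (simp add: torus_shift_of)
  note * = torus_differentiableI[OF this]
  show "torus_differentiable f (torus_of a)" by (rule *(1))
  show "((\<lambda>b. f (torus_of b)) has_derivative (\<lambda>h. h \<bullet> torus_gradient f (torus_of a))) (at a)"
    using d unfolding *(2) gderiv_def .
qed

lemma torus_C_k_differentiable: "torus_C_k (Suc k) f \<Longrightarrow> torus_differentiable f x"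
  using torus_C_k_has_derivative(2) torus_of_surj by metis

lemma torus_C_k_mvt:
  assumes "torus_C_k (Suc k) f"
  shows "\<exists>t\<in>{0<..<1}. f (torus_shift x h) - f x = torus_gradient f (torus_shift x (t *\<^sub>R h)) \<bullet> h"
proof -
  obtain a where a: "torus_of a = x" using torus_of_surj by blast
  define \<phi> where "\<phi> t = f (torus_of (a + t *\<^sub>R h))" for t
  have der: "(\<phi> has_derivative (\<lambda>s. (s *\<^sub>R h) \<bullet> torus_gradient f (torus_of (a + t *\<^sub>R h)))) (at t)" for t
  proof -
    have "((\<lambda>t. a + t *\<^sub>R h) has_derivative (\<lambda>s. s *\<^sub>R h)) (at t)"
      by (auto intro!: derivative_eq_intros)
    then show ?thesis
      unfolding \<phi>_def by (rule has_derivative_compose) (rule torus_C_k_has_derivative(1)[OF assms])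
  qed
  have "continuous_on {0..1} \<phi>"
    by (intro continuous_at_imp_continuous_on ballI has_derivative_continuous[OF der])
  then obtain t where t: "0 < t" "t < 1" "\<phi> 1 - \<phi> 0 = ((1 - 0) *\<^sub>R h) \<bullet> torus_gradient f (torus_of (a + t *\<^sub>R h))"
    by (rule mvt[OF zero_less_one _ der])
  have "\<phi> s = f (torus_shift x (s *\<^sub>R h))" for s
    unfolding \<phi>_def a[symmetric] torus_shift_of ..
  moreover have "torus_of (a + t *\<^sub>R h) = torus_shift x (t *\<^sub>R h)"
    unfolding a[symmetric] torus_shift_of ..
  ultimately show ?thesis using t by (intro bexI[of _ t]) (simp_all add: inner_commute)
qed

text \<open>Each coordinate of the gradient is a directional derivative, which is what
  \<open>C_k\<close> controls on the lift. As the metric induces the quotient topology, preimages of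
  open sets can be tested after composing with \<open>torus_of\<close>.\<close>

lemma torus_C_k_continuous_gradient:
  assumes "torus_C_k (Suc k) f"
  shows "continuous_on UNIV (torus_gradient f)"
proof -
  have frd: "frechet_derivative (\<lambda>b. f (torus_of b)) (at a) = (\<lambda>h. h \<bullet> torus_gradient f (torus_of a))" for a
    using frechet_derivative_at[OF torus_C_k_has_derivative(1)[OF assms]] by simp
  have "continuous_on UNIV (\<lambda>a. torus_gradient f (torus_of a))"
  proof (rule continuous_on_componentwise[THEN iffD2], rule ballI)
    fix i :: "real ^ 'a" assume "i \<in> Basis"
    have "continuous_on UNIV (\<lambda>x. frechet_derivative (\<lambda>b. f (torus_of b)) (at x) i)"
      using assms C_k_continuous unfolding torus_C_k_def by auto
    then show "continuous_on UNIV (\<lambda>x. torus_gradient f (torus_of x) \<bullet> i)" unfolding frd by (simp add: inner_commute)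
  qed
  then have "open ((\<lambda>a. torus_gradient f (torus_of a)) -` B)" if "open B" for B
    using that by (rule open_vimage[rotated])
  then show ?thesis
    unfolding continuous_on_open_vimage[OF open_UNIV] open_torus_iff by (simp add: vimage_def)
qed

section \<open>Hamiltonian and Lagrangian\<close>

text \<open>A point near \<open>x\<close> has a lift at the same distance from the given lift of
  \<open>x\<close>, so a modulus of continuity for the lifted function serves on the torus.\<close>

lemma continuous_on_torus_prodI:
  fixes f :: "'n::finite torus \<Rightarrow> 'a::metric_space \<Rightarrow> 'b::metric_space"
  assumes "continuous_on UNIV (\<lambda>(a, p). f (torus_of a) p)"
  shows "continuous_on UNIV (\<lambda>(x, p). f x p)"
  unfolding continuous_on_iff case_prod_unfold
proof (intro ballI allI impI)
  fix z :: "'n torus \<times> 'a" and e :: real assume "e > 0"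
  define x p where "x = fst z" and "p = snd z"
  obtain a where a: "torus_of a = x" using torus_of_surj by blast
  obtain d where d: "d > 0" "\<And>b q. dist (b, q) (a, p) < d \<Longrightarrow> dist (f (torus_of b) q) (f (torus_of a) p) < e"
    using assms \<open>e > 0\<close> unfolding continuous_on_iff by (metis (mono_tags, lifting) UNIV_I case_prod_conv)
  have "dist (f y q) (f x p) < e" if "dist (y, q) (x, p) < d" for y q
  proof -
    obtain v where v: "torus_shift x v = y" "norm v = dist x y" using torus_displacement by blast
    have "dist (a + v) a = dist y x" unfolding dist_norm[of "a + v" a] using v(2) by (simp add: dist_commute)
    then have "dist (a + v, q) (a, p) = dist (y, q) (x, p)" by (simp add: dist_Pair_Pair)
    then have "dist (f (torus_of (a + v)) q) (f (torus_of a) p) < e" using d(2) that by metis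
    then show ?thesis using v(1) a by (metis torus_shift_of)
  qed
  then show "\<exists>d>0. \<forall>z'\<in>UNIV. dist z' z < d \<longrightarrow> dist (f (fst z') (snd z')) (f (fst z) (snd z)) < e"
    using d(1) unfolding x_def p_def by (metis prod.collapse)
qed

lemma compact_continuous_bound:
  fixes f :: "'a::topological_space \<Rightarrow> real"
  assumes "compact K" "continuous_on K f"
  shows "\<exists>B. \<forall>z\<in>K. \<bar>f z\<bar> \<le> B"
  using compact_imp_bounded[OF compact_continuous_image[OF assms(2,1)]] unfolding bounded_iff by auto

lemma compact_subsequence:
  fixes f :: "nat \<Rightarrow> 'a::metric_space"
  assumes "compact S" "\<And>n. f n \<in> S"
  obtains l r where "l \<in> S" "strict_mono r" "(\<lambda>n. f (r n)) \<longlonglongrightarrow> l"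
  using seq_compactE[OF compact_imp_seq_compact[OF assms(1)], of f] assms(2) by (auto simp: o_def)

text \<open>The function \<open>f w - w \<bullet> p\<close> is minimal at \<open>v\<close>, so its
  derivative vanishes there. Applied to L this makes the dual momentum unique; applied to H it
  identifies velocities.\<close>

lemma subgradient_eq_gradient:
  fixes f :: "'a::real_inner \<Rightarrow> real"
  assumes "GDERIV f v :> g" and sub: "\<And>w. f v + p \<bullet> (w - v) \<le> f w"
  shows "p = g"
proof -
  have "(\<lambda>h. h \<bullet> (g - p)) = (\<lambda>h. 0)"
  proof (rule has_derivative_local_min)
    have "((\<lambda>w. f w - w \<bullet> p) has_derivative (\<lambda>h. h \<bullet> g - h \<bullet> p)) (at v)"
      using assms(1) unfolding gderiv_def
      by (intro has_derivative_diff has_derivative_inner_left has_derivative_ident)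
    then show "((\<lambda>w. f w - w \<bullet> p) has_derivative (\<lambda>h. h \<bullet> (g - p))) (at v)" by (simp add: inner_diff_right)
    show "\<forall>\<^sub>F y in at v. f v - v \<bullet> p \<le> f y - y \<bullet> p"
      using sub by (intro always_eventually) (simp add: inner_diff_right inner_commute[of p] algebra_simps)
  qed
  then have "(g - p) \<bullet> (g - p) = 0" by metis
  then show ?thesis by simp
qed

locale tonelli_hamiltonian =
  fixes H :: "'n::finite torus \<Rightarrow> real ^ 'n \<Rightarrow> real"
  assumes tonelli: "tonelli H" and L1_lagrangian: "L1 (lagrangian H)" and L2_lagrangian: "L2 (lagrangian H)"
begin

abbreviation L :: "'n torus \<Rightarrow> real ^ 'n \<Rightarrow> real" where "L \<equiv> lagrangian H"

definition HH :: "(real ^ 'n) \<times> (real ^ 'n) \<Rightarrow> real" where "HH = (\<lambda>(a, p). H (torus_of a) p)"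

lemma HH_differentiable: "HH differentiable (at z)"
  and HH_frechet_continuous: "continuous_on UNIV (\<lambda>z. frechet_derivative HH (at z) w)"
  and HH_continuous: "continuous_on UNIV HH"
proof -
  have "C_k (Suc (Suc 0)) HH" using tonelli unfolding tonelli_def HH_def numeral_2_eq_2 by blast
  then show "HH differentiable (at z)" "continuous_on UNIV (\<lambda>z. frechet_derivative HH (at z) w)"
    "continuous_on UNIV HH"
    using C_k_continuous[of "Suc 0" "\<lambda>z. frechet_derivative HH (at z) w"] C_k_continuous[of "Suc (Suc 0)" HH]
    by (simp_all del: split_paired_All)
qed

lemma HH_has_derivative: "(HH has_derivative frechet_derivative HH (at z)) (at z)"
  using HH_differentiable frechet_derivative_works by blast

lemma H_continuous: "continuous_on UNIV (\<lambda>(x, p). H x p)"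
  using HH_continuous unfolding HH_def by (rule continuous_on_torus_prodI)

lemma H_continuous_compose [continuous_intros]:
  "continuous_on S f \<Longrightarrow> continuous_on S g \<Longrightarrow> continuous_on S (\<lambda>z. H (f z) (g z))"
  using continuous_on_compose2[OF H_continuous, of S "\<lambda>z. (f z, g z)"] by (simp add: continuous_on_Pair)

lemma H_tendsto: "(f \<longlongrightarrow> x) G \<Longrightarrow> (g \<longlongrightarrow> p) G \<Longrightarrow> ((\<lambda>z. H (f z) (g z)) \<longlongrightarrow> H x p) G"
  using continuous_on_tendsto_compose[OF H_continuous tendsto_Pair] by simp

lemma H_GDERIV: "GDERIV (H x) p :> gradient (H x) p"
  using tonelli gradient_eqI unfolding tonelli_def pos_def_hessian_at_def by metis

text \<open>The gradient in \<open>p\<close> is the full derivative of the lift \<open>HH\<close>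
  evaluated at vectors \<open>(0, w)\<close>, and that derivative varies continuously by the C^2
  hypothesis.\<close>

lemma H_gradient_continuous: "continuous_on UNIV (\<lambda>(x, p). gradient (H x) p)"
proof (rule continuous_on_torus_prodI)
  have *: "frechet_derivative HH (at (a, p)) (0, w) = w \<bullet> gradient (H (torus_of a)) p" for a p w
  proof -
    have "((\<lambda>q. (a, q)) has_derivative (\<lambda>h. (0, h))) (at p)" by (intro derivative_intros)
    then have "((\<lambda>q. HH (a, q)) has_derivative (\<lambda>h. frechet_derivative HH (at (a, p)) (0, h))) (at p)"
      by (rule has_derivative_compose) (rule HH_has_derivative)
    then have "(H (torus_of a) has_derivative (\<lambda>h. frechet_derivative HH (at (a, p)) (0, h))) (at p)"
      by (simp add: HH_def)
    from has_derivative_unique[OF this H_GDERIV[unfolded gderiv_def]] show ?thesis by metis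
  qed
  show "continuous_on UNIV (\<lambda>(a, p). gradient (H (torus_of a)) p)"
  proof (rule continuous_on_componentwise[THEN iffD2], rule ballI)
    fix i :: "real ^ 'n" assume "i \<in> Basis"
    have "(\<lambda>z. (case z of (a, p) \<Rightarrow> gradient (H (torus_of a)) p) \<bullet> i) = (\<lambda>z. frechet_derivative HH (at z) (0, i))"
      by (auto simp: fun_eq_iff * inner_commute)
    then show "continuous_on UNIV (\<lambda>z. (case z of (a, p) \<Rightarrow> gradient (H (torus_of a)) p) \<bullet> i)"
      using HH_frechet_continuous[of "(0, i)"] by metis
  qed
qed

lemma H_lipschitz_x:
  obtains C where "C \<ge> 0" "\<And>x y p. norm p \<le> P \<Longrightarrow> \<bar>H x p - H y p\<bar> \<le> C * dist x y"
proof -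
  obtain D where D: "0 \<le> D" "\<And>x y :: 'n torus. dist x y \<le> D" using torus_dist_bounded by blast
  \<comment> \<open>Lifts of norm at most \<open>D\<close> reach every point of the torus, and a
    displacement adds at most \<open>D\<close> more, so the segment between the two chosen lifts
    stays in the ball of radius \<open>2 * D\<close>.\<close>
  define K where "K = (cball 0 (2 * D) :: (real ^ 'n) set) \<times> (cball 0 P :: (real ^ 'n) set)"
  have "\<exists>B. \<forall>z\<in>K. \<bar>frechet_derivative HH (at z) (i, 0)\<bar> \<le> B" for i
  proof -
    have "compact K" unfolding K_def by (intro compact_Times compact_cball)
    then show ?thesis
      by (rule compact_continuous_bound) (rule continuous_on_subset[OF HH_frechet_continuous], simp)
  qed
  then obtain B where B: "\<And>i z. z \<in> K \<Longrightarrow> \<bar>frechet_derivative HH (at z) (i, 0)\<bar> \<le> B i" by metis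
  define C where "C = (\<Sum>i\<in>Basis. \<bar>B i\<bar>)"
  have main: "\<bar>H x p - H y p\<bar> \<le> C * dist x y" if p: "norm p \<le> P" for x y p
  proof -
    obtain a where a: "torus_shift (torus_of 0) a = x" "norm a = dist (torus_of 0) x" using torus_displacement by blast
    obtain v where v: "torus_shift x v = y" "norm v = dist x y" using torus_displacement by blast
    have xy: "x = torus_of a" "y = torus_of (a + v)" using a(1) v(1) by (auto simp: torus_shift_of)
    have der: "((\<lambda>b. HH (b, p)) has_derivative (\<lambda>h. frechet_derivative HH (at (b, p)) (h, 0))) (at b within T)" for b T
    proof -
      have "((\<lambda>b. (b, p)) has_derivative (\<lambda>h. (h, 0))) (at b within T)" by (intro derivative_intros)
      then show ?thesis by (rule has_derivative_compose) (rule HH_has_derivative)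
    qed
    have bnd: "\<bar>frechet_derivative HH (at (b, p)) (h, 0)\<bar> \<le> C * norm h" if b: "b \<in> cball 0 (2 * D)" for b h
    proof -
      interpret bounded_linear "\<lambda>h. frechet_derivative HH (at (b, p)) (h, 0)"
        using der[of b UNIV] by (rule has_derivative_bounded_linear)
      have "frechet_derivative HH (at (b, p)) (h, 0)
          = frechet_derivative HH (at (b, p)) (\<Sum>i\<in>Basis. (h \<bullet> i) *\<^sub>R i, 0)" by (simp add: euclidean_representation)
      also have "\<dots> = (\<Sum>i\<in>Basis. (h \<bullet> i) * frechet_derivative HH (at (b, p)) (i, 0))"
        unfolding sum scaleR by simp
      also have "\<bar>\<dots>\<bar> \<le> (\<Sum>i\<in>Basis. norm h * \<bar>B i\<bar>)"
      proof (rule order_trans[OF sum_abs sum_mono])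
        fix i :: "real ^ 'n" assume "i \<in> Basis"
        have "(b, p) \<in> K" using b p by (simp add: K_def)
        then have "\<bar>frechet_derivative HH (at (b, p)) (i, 0)\<bar> \<le> \<bar>B i\<bar>"
          using B[of "(b, p)" i] by linarith
        then show "\<bar>(h \<bullet> i) * frechet_derivative HH (at (b, p)) (i, 0)\<bar> \<le> norm h * \<bar>B i\<bar>"
          unfolding abs_mult using Basis_le_norm[OF \<open>i \<in> Basis\<close>, of h] by (intro mult_mono) auto
      qed
      finally show ?thesis unfolding C_def by (simp add: sum_distrib_left mult.commute)
    qed
    have "norm (HH (a, p) - HH (a + v, p)) \<le> C * norm (a - (a + v))"
    proof (rule differentiable_bound[OF convex_cball der])
      show "onorm (\<lambda>h. frechet_derivative HH (at (b, p)) (h, 0)) \<le> C" if "b \<in> cball 0 (2 * D)" for b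
        using bnd[OF that] by (intro onorm_le) simp
      have "norm a \<le> D" "norm v \<le> D" using a(2) v(2) D(2) by metis+
      then show "a \<in> cball 0 (2 * D)" "a + v \<in> cball 0 (2 * D)"
        using norm_triangle_ineq[of a v] D(1) by auto
    qed
    then show ?thesis using v(2) by (simp add: HH_def xy[symmetric])
  qed
  show ?thesis by (rule that[OF _ main]) (simp_all add: C_def sum_nonneg)
qed

lemma H_coercive:
  assumes "K \<ge> 0"
  obtains C where "\<And>x p. H x p \<ge> K * norm p - C"
proof -
  obtain b where b: "\<And>p x. b \<le> norm p \<Longrightarrow> K \<le> H x p / norm p"
    using tonelli unfolding tonelli_def eventually_at_infinity by blast
  have "compact (UNIV \<times> cball 0 \<bar>b\<bar> :: ('n torus \<times> (real ^ 'n)) set)"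
    by (intro compact_Times compact_cball compact_torus)
  then obtain M where M: "\<And>x p. norm p \<le> \<bar>b\<bar> \<Longrightarrow> \<bar>H x p\<bar> \<le> M"
    using compact_continuous_bound[OF _ continuous_on_subset[OF H_continuous]] by fastforce
  have "H x p \<ge> K * norm p - (K * \<bar>b\<bar> + \<bar>M\<bar>)" for x p
  proof (cases "norm p \<le> \<bar>b\<bar>")
    case True
    then show ?thesis using M[OF True, of x] mult_left_mono[OF True assms] by linarith
  next
    case False
    then have "b \<le> norm p" "norm p > 0" by linarith+
    then have "K * norm p \<le> H x p" using b[of p x] by (simp add: pos_le_divide_eq)
    then show ?thesis using assms by (smt (verit) mult_nonneg_nonneg abs_ge_zero)
  qed
  then show ?thesis using that by blast
qed

section \<open>Legendre duality between H and L\<close>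

lemma L_maximizer:
  obtains P where "P \<ge> 0"
    "\<And>x v. norm v \<le> r \<Longrightarrow> \<exists>p. norm p \<le> P \<and> (\<forall>q. q \<bullet> v - H x q \<le> p \<bullet> v - H x p)"
proof -
  \<comment> \<open>The slope \<open>\<bar>r\<bar> + 1\<close> exceeds that of
    \<open>p \<bullet> v\<close> by one. Hence beyond radius \<open>\<bar>C\<bar> + M\<close>, where
    \<open>M\<close> bounds \<open>H x 0\<close>, the objective drops below its value at 0.\<close>
  obtain C where C: "\<And>x p. H x p \<ge> (\<bar>r\<bar> + 1) * norm p - C" using H_coercive[of "\<bar>r\<bar> + 1"] by auto
  have "continuous_on UNIV (\<lambda>x. H x 0)" by (intro continuous_intros)
  then obtain M where M: "\<And>x. \<bar>H x 0\<bar> \<le> M" using torus_abs_bounded by blast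
  have "M \<ge> 0" using M[of undefined] by linarith
  show ?thesis
  proof (rule that)
    show "0 \<le> \<bar>C\<bar> + M" using \<open>M \<ge> 0\<close> by simp
    fix x and v :: "real ^ 'n" assume v: "norm v \<le> r"
    have "continuous_on (cball 0 (\<bar>C\<bar> + M)) (\<lambda>p. p \<bullet> v - H x p)"
      by (intro continuous_intros)
    moreover have "\<not> \<bar>C\<bar> + M < 0" using \<open>M \<ge> 0\<close> by linarith
    ultimately obtain p where p: "norm p \<le> \<bar>C\<bar> + M" "\<And>q. norm q \<le> \<bar>C\<bar> + M \<Longrightarrow> q \<bullet> v - H x q \<le> p \<bullet> v - H x p"
      using continuous_attains_sup[of "cball 0 (\<bar>C\<bar> + M)" "\<lambda>p. p \<bullet> v - H x p"] by auto
    have "q \<bullet> v - H x q \<le> p \<bullet> v - H x p" if q: "norm q > \<bar>C\<bar> + M" for q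
    proof -
      have "q \<bullet> v \<le> norm q * \<bar>r\<bar>"
        using norm_cauchy_schwarz[of q v] v mult_left_mono[of "norm v" "\<bar>r\<bar>" "norm q"] by force
      then have "q \<bullet> v - H x q \<le> - H x 0"
        using C[of q x] q M[of x] abs_ge_self[of C] unfolding distrib_right mult.commute[of "norm q" "\<bar>r\<bar>"] by linarith
      also have "\<dots> \<le> p \<bullet> v - H x p" using p(2)[of 0] \<open>M \<ge> 0\<close> by simp
      finally show ?thesis .
    qed
    then show "\<exists>p. norm p \<le> \<bar>C\<bar> + M \<and> (\<forall>q. q \<bullet> v - H x q \<le> p \<bullet> v - H x p)"
      using p by (meson not_le)
  qed
qed

lemma L_eqI:
  assumes "\<And>q. q \<bullet> v - H x q \<le> p \<bullet> v - H x p"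
  shows "L x v = p \<bullet> v - H x p"
  unfolding lagrangian_def using assms by (intro cSup_eq_maximum) auto

lemma fenchel_young: "p \<bullet> v \<le> L x v + H x p"
proof -
  obtain q where "\<forall>q'. q' \<bullet> v - H x q' \<le> q \<bullet> v - H x q" using L_maximizer[of "norm v"] by (metis order_refl)
  then show ?thesis using L_eqI[of v x q] by (metis diff_le_eq)
qed

text \<open>The momentum dual to the velocity \<open>v\<close>, that is \<partial>L/\<partial>v; it
  realises the supremum in \<open>lagrangian\<close>, as \<open>L_b\<close> records.\<close>

definition b :: "'n torus \<Rightarrow> real ^ 'n \<Rightarrow> real ^ 'n" where "b x v = gradient (L x) v"

text \<open>A momentum with equality in Fenchel-Young is a subgradient of \<open>L x\<close> at
  \<open>v\<close>, and (L1) makes \<open>L x\<close> differentiable there.\<close>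

lemma b_unique:
  assumes "L x v = p \<bullet> v - H x p" shows "p = b x v"
proof -
  obtain g where g: "GDERIV (L x) v :> g"
    using L1_lagrangian unfolding L1_def pos_def_hessian_at_def by blast
  have "p = g" using g
  proof (rule subgradient_eq_gradient)
    show "L x v + p \<bullet> (w - v) \<le> L x w" for w
      using fenchel_young[of p w x] assms by (simp add: inner_diff_right)
  qed
  then show ?thesis unfolding b_def using gradient_eqI[OF g] by simp
qed

lemma L_b: "L x v = b x v \<bullet> v - H x (b x v)"
proof -
  obtain q where "\<forall>q'. q' \<bullet> v - H x q' \<le> q \<bullet> v - H x q" using L_maximizer[of "norm v"] by (metis order_refl)
  then have "L x v = q \<bullet> v - H x q" using L_eqI[of v x q] by blast
  then show ?thesis using b_unique by metis
qed

lemma b_bounded: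
  obtains P where "P \<ge> 0" "\<And>x v. norm v \<le> r \<Longrightarrow> norm (b x v) \<le> P"
proof -
  obtain P where P: "P \<ge> 0"
    "\<And>x v. norm v \<le> r \<Longrightarrow> \<exists>p. norm p \<le> P \<and> (\<forall>q. q \<bullet> v - H x q \<le> p \<bullet> v - H x p)"
    using L_maximizer by blast
  have "norm (b x v) \<le> P" if "norm v \<le> r" for x v
    using P(2)[OF that, of x] L_eqI b_unique by metis
  then show ?thesis using that P(1) by blast
qed

lemma L_le: "L x v - L x w \<le> b x v \<bullet> (v - w)"
  using fenchel_young[of "b x v" w x] L_b[of x v] by (simp add: inner_diff_right)

text \<open>Bounds on L come from bounds on momenta. For \<open>norm v \<le> r\<close> the
  maximizers have norm at most \<open>P\<close>, which is a Lipschitz constant in \<open>v\<close>;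
  keeping the maximizer of one base point as competitor at another transfers to L the Lipschitz
  constant of H in \<open>x\<close>.\<close>

lemma L_lipschitz:
  obtains C where "C \<ge> 0" "\<And>x v w. norm v \<le> r \<Longrightarrow> norm w \<le> r \<Longrightarrow> \<bar>L x v - L x w\<bar> \<le> C * norm (v - w)"
    "\<And>x y v. norm v \<le> r \<Longrightarrow> \<bar>L x v - L y v\<bar> \<le> C * dist x y"
    "\<And>x v. norm v \<le> r \<Longrightarrow> norm (b x v) \<le> C"
proof -
  obtain P where P: "P \<ge> 0" "\<And>x v. norm v \<le> r \<Longrightarrow> norm (b x v) \<le> P" using b_bounded by blast
  obtain C where C: "C \<ge> 0" "\<And>x y p. norm p \<le> P \<Longrightarrow> \<bar>H x p - H y p\<bar> \<le> C * dist x y"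
    using H_lipschitz_x by blast
  have 1: "L x v - L x w \<le> P * norm (v - w)" if "norm v \<le> r" for v w :: "real ^ 'n" and x
    using L_le[of x v w] norm_cauchy_schwarz[of "b x v" "v - w"] mult_right_mono[OF P(2)[OF that, of x], of "norm (v - w)"]
    by force
  have 2: "L x v - L y v \<le> C * dist x y" if "norm v \<le> r" for v :: "real ^ 'n" and x y :: "'n torus"
    using C(2)[OF P(2)[OF that, of x], of x y] fenchel_young[of "b x v" v y] L_b[of x v] by linarith
  show ?thesis
  proof (rule that[of "P + C"])
    show "\<bar>L x v - L x w\<bar> \<le> (P + C) * norm (v - w)" if "norm v \<le> r" "norm w \<le> r" for x v w
      using 1[OF that(1), of x w] 1[OF that(2), of x v] mult_nonneg_nonneg[OF C(1) norm_ge_zero[of "v - w"]]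
      by (simp add: distrib_right norm_minus_commute abs_le_iff)
    show "\<bar>L x v - L y v\<bar> \<le> (P + C) * dist x y" if "norm v \<le> r" for x y v
      using 2[OF that, of x y] 2[OF that, of y x] mult_nonneg_nonneg[OF P(1) zero_le_dist[of x y]]
      by (simp add: distrib_right dist_commute abs_le_iff)
    show "norm (b x v) \<le> P + C" if "norm v \<le> r" for x v using P(2)[OF that, of x] C(1) by linarith
  qed (use P C in simp)
qed

lemma L_continuous: "continuous_on UNIV (\<lambda>(x, v). L x v)"
proof (rule continuous_at_imp_continuous_on, clarify)
  fix x :: "'n torus" and v :: "real ^ 'n"
  obtain C where C: "C \<ge> 0"
    "\<And>x u w. norm u \<le> norm v + 1 \<Longrightarrow> norm w \<le> norm v + 1 \<Longrightarrow> \<bar>L x u - L x w\<bar> \<le> C * norm (u - w)"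
    "\<And>(x :: 'n torus) y u. norm u \<le> norm v + 1 \<Longrightarrow> \<bar>L x u - L y u\<bar> \<le> C * dist x y"
    using L_lipschitz[of "norm v + 1"] by metis
  have ev: "\<forall>\<^sub>F z in at (x, v). dist z (x, v) < 1" by (metis eventually_at zero_less_one)
  have "\<forall>\<^sub>F z in at (x, v). norm ((case z of (x, v) \<Rightarrow> L x v) - L x v) \<le> C * (dist (snd z) v + dist (fst z) x)"
    using ev
  proof (rule eventually_mono, clarify)
    fix y and w :: "real ^ 'n" assume "dist (y, w) (x, v) < 1"
    then have "dist w v < 1" using dist_snd_le[of "(y, w)" "(x, v)"] by simp
    then have w: "norm w \<le> norm v + 1" using norm_triangle_ineq2[of w v] by (simp add: dist_norm)
    show "norm (L y w - L x v) \<le> C * (dist (snd (y, w)) v + dist (fst (y, w)) x)"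
      using C(2)[OF w, of v y] C(3)[of v y x] by (simp add: distrib_left dist_norm)
  qed
  moreover have "((\<lambda>z. C * (dist (snd z) v + dist (fst z) x)) \<longlongrightarrow> 0) (at (x, v))"
    by (auto intro!: tendsto_eq_intros)
  ultimately have "((\<lambda>z. (case z of (x, v) \<Rightarrow> L x v) - L x v) \<longlongrightarrow> 0) (at (x, v))"
    by (rule Lim_null_comparison)
  then show "isCont (\<lambda>(x, v). L x v) (x, v)" unfolding isCont_def by (simp add: LIM_zero_iff)
qed

lemma L_continuous_compose [continuous_intros]:
  "continuous_on S f \<Longrightarrow> continuous_on S g \<Longrightarrow> continuous_on S (\<lambda>z. L (f z) (g z))"
  using continuous_on_compose2[OF L_continuous, of S "\<lambda>z. (f z, g z)"] by (simp add: continuous_on_Pair)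

lemma L_tendsto: "(f \<longlongrightarrow> x) G \<Longrightarrow> (g \<longlongrightarrow> p) G \<Longrightarrow> ((\<lambda>z. L (f z) (g z)) \<longlongrightarrow> L x p) G"
  using continuous_on_tendsto_compose[OF L_continuous tendsto_Pair] by simp

lemma L_superlinear: "\<exists>C. \<forall>x v. L x v \<ge> K * norm v + C"
proof -
  obtain C where "\<forall>x v. L x v \<ge> (\<bar>K\<bar> + 1) * norm v + C"
    using L2_lagrangian unfolding L2_def by (metis abs_ge_zero add_nonneg_pos zero_less_one)
  moreover have "(\<bar>K\<bar> + 1) * norm v \<ge> K * norm v" for v :: "real ^ 'n" by (intro mult_right_mono) auto
  ultimately show ?thesis by (meson add_le_cancel_right order_trans)
qed

text \<open>Differentiability in \<open>v\<close>, made uniform by compactness. A failure would, by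
  \<open>L_le\<close>, keep the momenta at \<open>v\<close> and \<open>v + e\<close> at least
  \<epsilon> apart while \<open>e\<close> tends to 0; in the limit both would satisfy equality in
  Fenchel-Young at the same point, against \<open>b_unique\<close>.\<close>

lemma L_first_order:
  assumes "\<epsilon> > 0"
  shows "\<exists>\<delta>>0. \<forall>x v e. norm v \<le> r \<longrightarrow> norm e \<le> \<delta> \<longrightarrow> L x (v + e) \<le> L x v + b x v \<bullet> e + \<epsilon> * norm e"
proof (rule ccontr)
  assume "\<not> ?thesis"
  then have "\<forall>n. \<exists>x v e. norm v \<le> r \<and> norm e \<le> inverse (real (Suc n)) \<and> L x (v + e) > L x v + b x v \<bullet> e + \<epsilon> * norm e"
    by (metis inverse_positive_iff_positive not_le of_nat_0_less_iff zero_less_Suc)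
  then obtain x v e where xve: "\<And>n. norm (v n) \<le> r" "\<And>n. norm (e n) \<le> inverse (real (Suc n))"
    "\<And>n. L (x n) (v n + e n) > L (x n) (v n) + b (x n) (v n) \<bullet> e n + \<epsilon> * norm (e n)" by metis
  obtain P where P: "\<And>x v. norm v \<le> r + 1 \<Longrightarrow> norm (b x v) \<le> P" using b_bounded by metis
  have e1: "norm (e n) \<le> 1" for n
    using xve(2)[of n] by (rule order_trans) (simp add: field_simps)
  have gap: "\<epsilon> \<le> norm (b (x n) (v n + e n) - b (x n) (v n))" for n
  proof (rule ccontr)
    assume "\<not> ?thesis"
    then have "(b (x n) (v n + e n) - b (x n) (v n)) \<bullet> e n \<le> \<epsilon> * norm (e n)"
      using norm_cauchy_schwarz[of "b (x n) (v n + e n) - b (x n) (v n)" "e n"]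
      by (smt (verit) mult_right_mono norm_ge_zero)
    then show False using xve(3)[of n] L_le[of "x n" "v n + e n" "v n"] by (simp add: inner_diff_left)
  qed
  define S where "S = (UNIV :: 'n torus set) \<times> cball (0 :: real ^ 'n) r \<times> cball (0 :: real ^ 'n) P \<times> cball (0 :: real ^ 'n) P"
  have "compact S" unfolding S_def by (intro compact_Times compact_cball compact_torus)
  moreover have "(x n, v n, b (x n) (v n), b (x n) (v n + e n)) \<in> S" for n
    using xve(1)[of n] e1[of n] P[of "v n" "x n"] P[of "v n + e n" "x n"] norm_triangle_ineq[of "v n" "e n"] unfolding S_def by auto
  ultimately obtain l s where s: "strict_mono s"
    "(\<lambda>n. (x (s n), v (s n), b (x (s n)) (v (s n)), b (x (s n)) (v (s n) + e (s n)))) \<longlonglongrightarrow> l"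
    using compact_subsequence[of S "\<lambda>n. (x n, v n, b (x n) (v n), b (x n) (v n + e n))"] by blast
  obtain x0 v0 p q where l: "l = (x0, v0, p, q)" by (cases l)
  note T = s(2)[unfolded l]
  have lims: "(\<lambda>n. x (s n)) \<longlonglongrightarrow> x0" "(\<lambda>n. v (s n)) \<longlonglongrightarrow> v0" "(\<lambda>n. b (x (s n)) (v (s n))) \<longlonglongrightarrow> p"
    "(\<lambda>n. b (x (s n)) (v (s n) + e (s n))) \<longlonglongrightarrow> q"
    using tendsto_fst[OF T] tendsto_fst[OF tendsto_snd[OF T]] tendsto_fst[OF tendsto_snd[OF tendsto_snd[OF T]]]
      tendsto_snd[OF tendsto_snd[OF tendsto_snd[OF T]]] by simp_all
  have "e \<longlonglongrightarrow> 0" using xve(2) by (intro Lim_null_comparison[OF _ LIMSEQ_inverse_real_of_nat]) auto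
  then have "(\<lambda>n. e (s n)) \<longlonglongrightarrow> 0" using LIMSEQ_subseq_LIMSEQ[OF _ s(1)] by (auto simp: o_def)
  then have ve: "(\<lambda>n. v (s n) + e (s n)) \<longlonglongrightarrow> v0" using tendsto_add[OF lims(2)] by fastforce
  have "L x0 v0 = p \<bullet> v0 - H x0 p"
  proof (rule LIMSEQ_unique[OF L_tendsto[OF lims(1,2)]])
    show "(\<lambda>n. L (x (s n)) (v (s n))) \<longlonglongrightarrow> p \<bullet> v0 - H x0 p"
      by (subst L_b) (intro tendsto_intros lims H_tendsto)
  qed
  moreover have "L x0 v0 = q \<bullet> v0 - H x0 q"
  proof (rule LIMSEQ_unique[OF L_tendsto[OF lims(1) ve]])
    show "(\<lambda>n. L (x (s n)) (v (s n) + e (s n))) \<longlonglongrightarrow> q \<bullet> v0 - H x0 q"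
      by (subst L_b) (intro tendsto_intros lims ve H_tendsto)
  qed
  ultimately have "p = q" using b_unique by metis
  moreover have "\<epsilon> \<le> norm (q - p)"
    by (rule LIMSEQ_le_const[OF tendsto_norm[OF tendsto_diff[OF lims(4,3)]]]) (use gap in blast)
  ultimately show False using assms by simp
qed

text \<open>Along the segment from \<open>p\<close> to \<open>q\<close> the slope of H increases,
  because its derivative is the positive Hessian form; the mean value theorem then compares the
  chord with the initial slope.\<close>

lemma H_convex: "H x p + gradient (H x) p \<bullet> (q - p) \<le> H x q"
proof (cases "q = p")
  case False
  define w where "w = q - p"
  have "w \<noteq> 0" using False by (simp add: w_def)
  define \<phi> where "\<phi> s = H x (p + s *\<^sub>R w)" for s
  define \<psi> where "\<psi> s = gradient (H x) (p + s *\<^sub>R w) \<bullet> w" for s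
  have aff: "((\<lambda>s. p + s *\<^sub>R w) has_derivative (\<lambda>h. h *\<^sub>R w)) (at s)" for s
    by (auto intro!: derivative_eq_intros)
  have d\<phi>: "(\<phi> has_real_derivative \<psi> s) (at s)" for s
  proof -
    have "(\<phi> has_derivative (\<lambda>h. (h *\<^sub>R w) \<bullet> gradient (H x) (p + s *\<^sub>R w))) (at s)"
      unfolding \<phi>_def using aff by (rule has_derivative_compose) (rule H_GDERIV[unfolded gderiv_def])
    then show ?thesis by (rule has_derivative_imp_has_field_derivative) (simp add: \<psi>_def inner_commute)
  qed
  have d\<psi>: "\<exists>y. (\<psi> has_real_derivative y) (at s) \<and> y > 0" for s
  proof -
    obtain g A where g: "\<forall>y. GDERIV (H x) y :> g y" "(g has_derivative A) (at (p + s *\<^sub>R w))"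
      "\<And>w. w \<noteq> 0 \<Longrightarrow> 0 < A w \<bullet> w"
      using tonelli unfolding tonelli_def pos_def_hessian_at_def by blast
    have "g y = gradient (H x) y" for y using gradient_eqI[of "H x" y "g y"] g(1) by simp
    then have \<psi>: "\<psi> = (\<lambda>s. g (p + s *\<^sub>R w) \<bullet> w)" by (simp add: \<psi>_def fun_eq_iff)
    have "((\<lambda>s. g (p + s *\<^sub>R w)) has_derivative (\<lambda>h. A (h *\<^sub>R w))) (at s)"
      using aff g(2) by (rule has_derivative_compose)
    then have "(\<psi> has_derivative (\<lambda>h. A (h *\<^sub>R w) \<bullet> w)) (at s)" unfolding \<psi> by (rule has_derivative_inner_left)
    moreover have "A (h *\<^sub>R w) = h *\<^sub>R A w" for h
      using has_derivative_bounded_linear[OF g(2)] by (simp add: bounded_linear.linear linear_cmul)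
    ultimately have "(\<psi> has_real_derivative (A w \<bullet> w)) (at s)"
      by (intro has_derivative_imp_has_field_derivative[of _ "\<lambda>h. A (h *\<^sub>R w) \<bullet> w"]) auto
    then show ?thesis using g(3)[OF \<open>w \<noteq> 0\<close>] by blast
  qed
  obtain z where z: "0 < z" "z < 1" "\<phi> 1 - \<phi> 0 = (1 - 0) * \<psi> z" using MVT2[of 0 1 \<phi> \<psi>] d\<phi> by auto
  have "\<psi> 0 < \<psi> z" by (rule DERIV_pos_imp_increasing[OF z(1)]) (rule d\<psi>)
  then show ?thesis using z by (simp add: \<phi>_def \<psi>_def w_def)
qed simp

lemma L_H_gradient: "L x (gradient (H x) p) = p \<bullet> gradient (H x) p - H x p"
proof (rule L_eqI)
  show "q \<bullet> gradient (H x) p - H x q \<le> p \<bullet> gradient (H x) p - H x p" for q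
    using H_convex[of x p q] by (simp add: inner_commute[of "gradient (H x) p"] inner_diff_left)
qed

text \<open>By duality the equality case also makes \<open>v\<close> a subgradient of
  \<open>H x\<close> at \<open>p\<close>. This step produces the velocity field of the continuity
  equation.\<close>

lemma fenchel_eq_imp:
  assumes "L x v + H x p \<le> p \<bullet> v" shows "v = gradient (H x) p"
  using H_GDERIV
proof (rule subgradient_eq_gradient)
  show "H x p + v \<bullet> (q - p) \<le> H x q" for q
    using fenchel_young[of q v x] assms by (simp add: inner_diff_right inner_commute)
qed

end

section \<open>Discrete weak KAM theory\<close>

lemma uniform_limit_tendsto_compose:
  fixes g :: "'a::t2_space \<Rightarrow> 'b::metric_space"
  assumes "uniform_limit UNIV f g sequentially" "isCont g x" "X \<longlonglongrightarrow> x"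
  shows "(\<lambda>n. f n (X n)) \<longlonglongrightarrow> g x"
proof (rule metric_LIMSEQ_I)
  fix e :: real assume "e > 0"
  then have "\<forall>\<^sub>F n in sequentially. \<forall>y\<in>UNIV. dist (f n y) (g y) < e / 2"
    using uniform_limitD[OF assms(1), of "e / 2"] by simp
  moreover have "\<forall>\<^sub>F n in sequentially. dist (g (X n)) (g x) < e / 2"
    using tendstoD[OF isCont_tendsto_compose[OF assms(2,3)], of "e / 2"] \<open>e > 0\<close> by simp
  ultimately have "\<forall>\<^sub>F n in sequentially. dist (f n (X n)) (g x) < e"
    by eventually_elim (metis UNIV_I dist_commute dist_triangle_half_l)
  then show "\<exists>no. \<forall>n\<ge>no. dist (f n (X n)) (g x) < e" by (simp add: eventually_sequentially)
qed

lemma coercive_attains_inf: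
  fixes g :: "'a::euclidean_space \<Rightarrow> real"
  assumes "continuous_on UNIV g" "\<And>x. norm x + C \<le> g x"
  shows "\<exists>x. \<forall>y. g x \<le> g y"
proof -
  define r where "r = \<bar>g 0 - C\<bar>"
  have "continuous_on (cball 0 r) g" using assms(1) by (rule continuous_on_subset) simp
  then obtain x where x: "x \<in> cball 0 r" "\<And>y. y \<in> cball 0 r \<Longrightarrow> g x \<le> g y"
    using continuous_attains_inf[of "cball 0 r" g] by (auto simp: r_def)
  have "g x \<le> g y" for y
  proof (cases "y \<in> cball 0 r")
    case False
    then have "g 0 \<le> g y" using assms(2)[of y] unfolding r_def by (simp add: abs_if split: if_splits)
    then show ?thesis using x(2)[of 0] by (simp add: r_def)
  qed (rule x(2))
  then show ?thesis by blast
qed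

text \<open>Every L_m will satisfy these bounds with the same \<open>Cs\<close>, \<open>M\<close>
  and \<open>\<Lambda>\<close>. Quantities built from these three alone are therefore independent of
  the measure and of the time step.\<close>

locale bounded_lagrangian =
  fixes l :: "'n::finite torus \<Rightarrow> real ^ 'n \<Rightarrow> real" and Cs :: "real \<Rightarrow> real" and M :: real and \<Lambda> :: "real \<Rightarrow> real"
  assumes l_continuous: "continuous_on UNIV (\<lambda>(x, v). l x v)"
    and superlinear: "\<And>K x v. K * norm v + Cs K \<le> l x v"
    and l_le: "\<And>x v. norm v \<le> 1 \<Longrightarrow> l x v \<le> M"
    and \<Lambda>_nonneg: "\<And>r. 0 \<le> \<Lambda> r"
    and lipschitz_v: "\<And>r x v w. norm v \<le> r \<Longrightarrow> norm w \<le> r \<Longrightarrow> \<bar>l x v - l x w\<bar> \<le> \<Lambda> r * norm (v - w)"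
    and lipschitz_x: "\<And>r x y v. norm v \<le> r \<Longrightarrow> \<bar>l x v - l y v\<bar> \<le> \<Lambda> r * dist x y"
begin

text \<open>\<open>Kc\<close> bounds \<open>M - c\<close>, the excess cost per unit time of moving
  at speed at most 1, as \<open>c\<close> lies between \<open>Cs 0\<close> and \<open>M\<close>.
  \<open>Rv\<close> comes from solving
  \<open>(Kc + 1) * norm v + Cs (Kc + 1) \<le> M + Kc * norm v + Kc\<close> for the speed.
  \<open>Lp\<close> adds the Lipschitz constants of two regimes, displacements longer and shorter
  than one time step.\<close>

definition Kc :: real where "Kc = M - Cs 0"
definition Rv :: real where "Rv = Kc + M - Cs (Kc + 1)"
definition Lp :: real where "Lp = 2 * Kc + \<Lambda> (Rv + 1)"

definition subsolution :: "real \<Rightarrow> real \<Rightarrow> ('n torus \<Rightarrow> real) \<Rightarrow> bool" where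
  "subsolution \<tau> c u \<longleftrightarrow> (\<forall>x v. u (torus_shift x (\<tau> *\<^sub>R v)) + \<tau> * c \<le> u x + \<tau> * l x v)"

definition calibrated :: "real \<Rightarrow> real \<Rightarrow> ('n torus \<Rightarrow> real) \<Rightarrow> 'n torus \<Rightarrow> real ^ 'n \<Rightarrow> bool" where
  "calibrated \<tau> c u x v \<longleftrightarrow> u (torus_shift x (\<tau> *\<^sub>R v)) + \<tau> * c = u x + \<tau> * l x v"

text \<open>The Lax-Oleinik equation split into an inequality for all steps and a step attaining
  equality at each arrival point. Written with velocities on the torus it avoids lifts, and
  attainment of the infimum is part of the notion.\<close>

definition weak_kam :: "real \<Rightarrow> real \<Rightarrow> ('n torus \<Rightarrow> real) \<Rightarrow> bool" where
  "weak_kam \<tau> c u \<longleftrightarrow> continuous_on UNIV u \<and> subsolution \<tau> c u \<and>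
     (\<forall>y. \<exists>x v. torus_shift x (\<tau> *\<^sub>R v) = y \<and> calibrated \<tau> c u x v)"

lemma weak_kamD:
  assumes "weak_kam \<tau> c u"
  shows "continuous_on UNIV u" "u (torus_shift x (\<tau> *\<^sub>R v)) + \<tau> * c \<le> u x + \<tau> * l x v"
    "\<exists>x v. torus_shift x (\<tau> *\<^sub>R v) = y \<and> calibrated \<tau> c u x v"
  using assms unfolding weak_kam_def subsolution_def by auto

lemma l_continuous_compose [continuous_intros]:
  "continuous_on S f \<Longrightarrow> continuous_on S g \<Longrightarrow> continuous_on S (\<lambda>z. l (f z) (g z))"
  using continuous_on_compose2[OF l_continuous, of S "\<lambda>z. (f z, g z)"] by (simp add: continuous_on_Pair)

lemma l_tendsto: "(f \<longlongrightarrow> x) G \<Longrightarrow> (g \<longlongrightarrow> p) G \<Longrightarrow> ((\<lambda>z. l (f z) (g z)) \<longlongrightarrow> l x p) G"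
  using continuous_on_tendsto_compose[OF l_continuous tendsto_Pair] by simp

lemma l_ge: "Cs 0 \<le> l x v" using superlinear[of 0 v x] by simp

lemma Kc_nonneg: "0 \<le> Kc"
  using l_ge[of undefined 0] l_le[of 0 undefined] unfolding Kc_def by simp

lemma Rv_nonneg: "0 \<le> Rv"
  using superlinear[of "Kc + 1" 0 undefined] l_le[of 0 undefined] Kc_nonneg unfolding Rv_def by simp

lemma Lp_nonneg: "0 \<le> Lp" using Kc_nonneg \<Lambda>_nonneg unfolding Lp_def by simp

lemma weak_kam_lax_oleinik:
  assumes "\<tau> > 0" "weak_kam \<tau> c u" shows "lax_oleinik_solution \<tau> l c u"
  unfolding lax_oleinik_solution_def
proof (intro conjI allI)
  show "continuous_on UNIV u" using weak_kamD(1)[OF assms(2)] .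
  fix y :: "real ^ 'n"
  obtain x v where xv: "torus_shift x (\<tau> *\<^sub>R v) = torus_of y" "calibrated \<tau> c u x v" using weak_kamD(3)[OF assms(2)] by blast
  have x: "torus_of (y - \<tau> *\<^sub>R v) = x"
    using arg_cong[OF xv(1), of "\<lambda>z. torus_shift z (- \<tau> *\<^sub>R v)"] by (simp add: torus_shift_of)
  have sub: "u (torus_of y) + \<tau> * c \<le> u (torus_of z) + discrete_action \<tau> l z y" for z
    using weak_kamD(2)[OF assms(2), of "torus_of z" "(1 / \<tau>) *\<^sub>R (y - z)"] assms(1)
    by (simp add: torus_shift_of discrete_action_def)
  have eq: "u (torus_of y) + \<tau> * c = u (torus_of (y - \<tau> *\<^sub>R v)) + discrete_action \<tau> l (y - \<tau> *\<^sub>R v) y"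
    using xv assms(1) unfolding calibrated_def discrete_action_def x by simp
  show "u (torus_of y) + \<tau> * c = (INF x. u (torus_of x) + discrete_action \<tau> l x y)"
    by (rule cInf_eq_minimum[symmetric]) (use eq sub in auto)
qed

text \<open>The infimum over all lifts is attained because superlinear growth dominates the bounded
  function \<open>u\<close>.\<close>

lemma lax_oleinik_weak_kam:
  assumes "\<tau> > 0" "lax_oleinik_solution \<tau> l c u" shows "weak_kam \<tau> c u"
proof -
  have u: "continuous_on UNIV u" using assms(2) unfolding lax_oleinik_solution_def by blast
  then obtain B where B: "\<And>x. \<bar>u x\<bar> \<le> B" using torus_abs_bounded by blast
  have min: "\<exists>v. u (torus_of y) + \<tau> * c = u (torus_of (y - \<tau> *\<^sub>R v)) + \<tau> * l (torus_of (y - \<tau> *\<^sub>R v)) v \<and>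
      (\<forall>w. u (torus_of y) + \<tau> * c \<le> u (torus_of (y - \<tau> *\<^sub>R w)) + \<tau> * l (torus_of (y - \<tau> *\<^sub>R w)) w)" for y
  proof -
    define g where "g v = u (torus_of (y - \<tau> *\<^sub>R v)) + \<tau> * l (torus_of (y - \<tau> *\<^sub>R v)) v" for v
    have "continuous_on UNIV g" unfolding g_def
      by (intro continuous_intros continuous_on_compose2[OF u] continuous_on_compose2[OF continuous_on_torus_of[of UNIV]]) auto
    \<comment> \<open>The slope \<open>1 / \<tau>\<close> is chosen so that multiplication by \<tau>
      leaves growth exactly \<open>norm v\<close>, as \<open>coercive_attains_inf\<close>
      asks.\<close>
    moreover have "norm v + (\<tau> * Cs (1 / \<tau>) - B) \<le> g v" for v
    proof -
      have "\<tau> * (1 / \<tau> * norm v + Cs (1 / \<tau>)) \<le> \<tau> * l (torus_of (y - \<tau> *\<^sub>R v)) v"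
        using assms(1) by (intro mult_left_mono superlinear) simp
      then show ?thesis using B[of "torus_of (y - \<tau> *\<^sub>R v)"] assms(1) unfolding g_def by (simp add: distrib_left)
    qed
    ultimately obtain v where v: "\<And>w. g v \<le> g w" using coercive_attains_inf by blast
    have g: "u (torus_of z) + discrete_action \<tau> l z y = g ((1 / \<tau>) *\<^sub>R (y - z))" for z
      using assms(1) by (simp add: g_def discrete_action_def)
    have "(INF x. u (torus_of x) + discrete_action \<tau> l x y) = g v"
    proof (rule cInf_eq_minimum)
      have "g v = u (torus_of (y - \<tau> *\<^sub>R v)) + discrete_action \<tau> l (y - \<tau> *\<^sub>R v) y" unfolding g using assms(1) by simp
      then show "g v \<in> range (\<lambda>x. u (torus_of x) + discrete_action \<tau> l x y)" by blast
    qed (use v g in auto)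
    then show ?thesis using assms(2) v unfolding lax_oleinik_solution_def g_def by metis
  qed
  show ?thesis unfolding weak_kam_def subsolution_def
  proof (intro conjI allI)
    fix x :: "'n torus" and v :: "real ^ 'n"
    obtain a where a: "torus_of a = x" using torus_of_surj by blast
    show "u (torus_shift x (\<tau> *\<^sub>R v)) + \<tau> * c \<le> u x + \<tau> * l x v"
      using min[of "a + \<tau> *\<^sub>R v"] unfolding a[symmetric] torus_shift_of by (metis add_diff_cancel_right')
  next
    fix y :: "'n torus"
    obtain a where a: "torus_of a = y" using torus_of_surj by blast
    obtain v where v: "u (torus_of a) + \<tau> * c = u (torus_of (a - \<tau> *\<^sub>R v)) + \<tau> * l (torus_of (a - \<tau> *\<^sub>R v)) v" using min by blast
    have "torus_shift (torus_of (a - \<tau> *\<^sub>R v)) (\<tau> *\<^sub>R v) = y" using a by (simp add: torus_shift_of)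
    then show "\<exists>x v. torus_shift x (\<tau> *\<^sub>R v) = y \<and> calibrated \<tau> c u x v"
      using v a unfolding calibrated_def by metis
  qed (rule u)
qed

section \<open>A priori bounds for weak KAM solutions, uniform in the time step\<close>

lemma weak_kam_c_bounds:
  assumes "\<tau> > 0" "weak_kam \<tau> c u" shows "Cs 0 \<le> c" "c \<le> M"
proof -
  \<comment> \<open>At a minimum point of \<open>u\<close> the incoming calibrated step starts no
    lower than it ends, so its action is at most \<open>\<tau> * c\<close>. Standing still gives the
    upper bound on \<open>c\<close>.\<close>
  obtain y where y: "\<And>z. u y \<le> u z" using torus_bounded_below[OF weak_kamD(1)[OF assms(2)]] by blast
  obtain x v where "torus_shift x (\<tau> *\<^sub>R v) = y" "calibrated \<tau> c u x v" using weak_kamD(3)[OF assms(2)] by blast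
  then have "\<tau> * l x v \<le> \<tau> * c" using y[of x] unfolding calibrated_def by simp
  then show "Cs 0 \<le> c" using assms(1) l_ge[of x v] by simp
  have "\<tau> * c \<le> \<tau> * l x 0" using weak_kamD(2)[OF assms(2), of x 0] by simp
  then show "c \<le> M" using assms(1) l_le[of 0 x] by simp
qed

text \<open>Sum of \<open>N\<close> one-step inequalities at constant velocity \<open>w\<close>. The
  base point drifts by at most \<open>N * \<tau> * norm w\<close>, and
  \<open>\<Lambda> (norm w)\<close> converts the drift into a change of the Lagrangian.\<close>

lemma straight_chain:
  assumes "\<tau> > 0" "subsolution \<tau> c u"
  shows "u (torus_shift x ((real N * \<tau>) *\<^sub>R w)) + real N * \<tau> * c
    \<le> u x + real N * \<tau> * (l x w + \<Lambda> (norm w) * (real N * \<tau> * norm w))"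
proof -
  define D where "D = \<Lambda> (norm w) * (real N * \<tau> * norm w)"
  have "u (torus_shift x ((real n * \<tau>) *\<^sub>R w)) + real n * \<tau> * c \<le> u x + real n * \<tau> * (l x w + D)" if "n \<le> N" for n
    using that
  proof (induction n)
    case (Suc n)
    let ?y = "torus_shift x ((real n * \<tau>) *\<^sub>R w)"
    have "real n * \<tau> * norm w \<le> real N * \<tau> * norm w"
      using Suc.prems assms(1) by (intro mult_right_mono) auto
    moreover have "dist ?y x \<le> real n * \<tau> * norm w"
      using dist_torus_shift[of x "(real n * \<tau>) *\<^sub>R w"] assms(1) by (simp add: dist_commute abs_mult)
    ultimately have "dist ?y x \<le> real N * \<tau> * norm w" by simp
    then have "l ?y w \<le> l x w + D"
      using lipschitz_x[of w "norm w" ?y x] mult_left_mono[OF _ \<Lambda>_nonneg, of "dist ?y x" "real N * \<tau> * norm w" "norm w"]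
      unfolding D_def by (simp add: abs_le_iff)
    then have "\<tau> * l ?y w \<le> \<tau> * (l x w + D)" using assms(1) by simp
    moreover have "torus_shift ?y (\<tau> *\<^sub>R w) = torus_shift x ((real (Suc n) * \<tau>) *\<^sub>R w)"
      by (simp add: distrib_right scaleR_left_distrib add.commute)
    then have "u (torus_shift x ((real (Suc n) * \<tau>) *\<^sub>R w)) + \<tau> * c \<le> u ?y + \<tau> * l ?y w"
      using assms(2) unfolding subsolution_def by metis
    ultimately show ?case using Suc by (simp add: algebra_simps)
  qed simp
  from this[of N] show ?thesis unfolding D_def by simp
qed

text \<open>The displacement \<open>w\<close> is covered at speed at most 1, each unit of time
  costing at most \<open>M - c \<le> Kc\<close>. Rounding the number of steps up adds at most one
  \<tau>, so the estimate is of Lipschitz type only above the scale of one step.\<close>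

lemma coarse_lipschitz:
  assumes "\<tau> > 0" "weak_kam \<tau> c u"
  shows "u (torus_shift x w) - u x \<le> Kc * (norm w + \<tau>)"
proof (cases "w = 0")
  case True
  then show ?thesis using Kc_nonneg assms(1) by simp
next
  case False
  define N where "N = nat \<lceil>norm w / \<tau>\<rceil>"
  have pos: "norm w / \<tau> > 0" using False assms(1) by simp
  then have N: "norm w / \<tau> \<le> real N" "real N \<le> norm w / \<tau> + 1" "N > 0"
    unfolding N_def by linarith+
  define e where "e = (1 / (real N * \<tau>)) *\<^sub>R w"
  have Nt: "norm w \<le> real N * \<tau>" "real N * \<tau> \<le> norm w + \<tau>"
    using N(1,2) assms(1) by (auto simp: field_simps)
  have e: "norm e \<le> 1" using Nt(1) N(3) assms(1) by (simp add: e_def divide_le_eq abs_mult)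
  have "u (torus_shift x ((real n * \<tau>) *\<^sub>R e)) + real n * \<tau> * c \<le> u x + real n * \<tau> * M" for n
  proof (induction n)
    case (Suc n)
    let ?y = "torus_shift x ((real n * \<tau>) *\<^sub>R e)"
    have "torus_shift ?y (\<tau> *\<^sub>R e) = torus_shift x ((real (Suc n) * \<tau>) *\<^sub>R e)"
      by (simp add: distrib_right scaleR_left_distrib add.commute)
    then have "u (torus_shift x ((real (Suc n) * \<tau>) *\<^sub>R e)) + \<tau> * c \<le> u ?y + \<tau> * l ?y e"
      using weak_kamD(2)[OF assms(2)] by metis
    moreover have "\<tau> * l ?y e \<le> \<tau> * M" using l_le[OF e] assms(1) by simp
    ultimately show ?case using Suc by (simp add: algebra_simps)
  qed simp
  from this[of N] have "u (torus_shift x w) + real N * \<tau> * c \<le> u x + real N * \<tau> * M"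
    using N(3) assms(1) by (simp add: e_def)
  then have "u (torus_shift x w) - u x \<le> real N * \<tau> * (M - c)" by (simp add: algebra_simps)
  also have "\<dots> \<le> (norm w + \<tau>) * Kc"
    using Nt(2) weak_kam_c_bounds[OF assms] N(3) assms(1) unfolding Kc_def by (intro mult_mono) auto
  finally show ?thesis by (simp add: mult.commute)
qed

text \<open>The action of a calibrated step is, up to \<open>\<tau> * c\<close>, a difference of
  values of \<open>u\<close>, which \<open>coarse_lipschitz\<close> lets grow with slope at most
  \<open>Kc\<close> in the speed; superlinearity with slope \<open>Kc + 1\<close> then bounds the
  speed.\<close>

lemma calibrated_bounded:
  assumes "\<tau> > 0" "weak_kam \<tau> c u" "calibrated \<tau> c u x v"
  shows "norm v \<le> Rv"
proof -
  have "\<tau> * (l x v - c) \<le> Kc * (norm (\<tau> *\<^sub>R v) + \<tau>)"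
    using coarse_lipschitz[OF assms(1,2), of x "\<tau> *\<^sub>R v"] assms(3) unfolding calibrated_def by (simp add: algebra_simps)
  also have "\<dots> = \<tau> * (Kc * (norm v + 1))" using assms(1) by (simp add: algebra_simps)
  finally have "l x v - c \<le> Kc * (norm v + 1)" using assms(1) by (rule mult_left_le_imp_le)
  then have "l x v - c \<le> Kc * norm v + Kc" by (simp add: distrib_left)
  then show ?thesis using superlinear[of "Kc + 1" v x] weak_kam_c_bounds(2)[OF assms(1,2)]
    unfolding Rv_def by (simp add: algebra_simps)
qed

text \<open>Below the scale of one step the coarse bound is too weak, so the calibrated step
  arriving at \<open>x\<close> is bent to arrive at the displaced point. Its velocity changes by a
  vector of norm at most 1, hence \<open>\<Lambda>\<close> at radius \<open>Rv + 1\<close>.\<close>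

lemma weak_kam_lipschitz_shift:
  assumes "\<tau> > 0" "weak_kam \<tau> c u"
  shows "u (torus_shift x w) - u x \<le> Lp * norm w"
proof (cases "norm w \<le> \<tau>")
  case True
  obtain z v where zv: "torus_shift z (\<tau> *\<^sub>R v) = x" "calibrated \<tau> c u z v" using weak_kamD(3)[OF assms(2)] by blast
  define e where "e = (1 / \<tau>) *\<^sub>R w"
  have e: "norm e \<le> 1" "\<tau> *\<^sub>R e = w" using True assms(1) by (auto simp: e_def)
  have v: "norm v \<le> Rv" using calibrated_bounded[OF assms zv(2)] .
  have "u (torus_shift z (\<tau> *\<^sub>R (v + e))) + \<tau> * c \<le> u z + \<tau> * l z (v + e)" by (rule weak_kamD(2)[OF assms(2)])
  then have "u (torus_shift x w) - u x \<le> \<tau> * (l z (v + e) - l z v)"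
    using zv unfolding calibrated_def by (simp add: zv(1)[symmetric] scaleR_add_right e(2) right_diff_distrib)
  also have "\<dots> \<le> \<tau> * (\<Lambda> (Rv + 1) * norm e)"
    using lipschitz_v[of "v + e" "Rv + 1" v z] v e(1) norm_triangle_ineq[of v e] assms(1) by (intro mult_left_mono) auto
  also have "\<dots> = \<Lambda> (Rv + 1) * norm w" using assms(1) by (simp add: e_def)
  also have "\<dots> \<le> Lp * norm w" using Kc_nonneg unfolding Lp_def by (intro mult_right_mono) auto
  finally show ?thesis .
next
  case False
  have "u (torus_shift x w) - u x \<le> Kc * (norm w + \<tau>)" by (rule coarse_lipschitz[OF assms])
  also have "\<dots> \<le> Kc * (2 * norm w)" using False Kc_nonneg by (intro mult_left_mono) auto
  also have "\<dots> \<le> Lp * norm w" using \<Lambda>_nonneg unfolding Lp_def by (simp add: distrib_right)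
  finally show ?thesis .
qed

lemma weak_kam_lipschitz:
  assumes "\<tau> > 0" "weak_kam \<tau> c u"
  shows "\<bar>u x - u y\<bar> \<le> Lp * dist x y"
proof -
  have "u y - u x \<le> Lp * dist x y" for x y
    using torus_displacement[of x y] weak_kam_lipschitz_shift[OF assms] by metis
  from this[of x y] this[of y x] show ?thesis by (simp add: dist_commute abs_le_iff)
qed

text \<open>At a maximum point of \<open>u - u'\<close> a calibrated step for \<open>u'\<close> is
  compared with the one-step inequality for \<open>u\<close>.\<close>

lemma weak_kam_c_unique:
  assumes "\<tau> > 0" "weak_kam \<tau> c u" "weak_kam \<tau> c' u'"
  shows "c = c'"
proof -
  have *: "c \<le> c'" if A: "weak_kam \<tau> c u" and B: "weak_kam \<tau> c' u'" for c c' u u'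
  proof -
    have "continuous_on UNIV (\<lambda>x. u x - u' x)" using A B weak_kamD(1) by (intro continuous_intros) auto
    then obtain y where y: "\<And>z. u z - u' z \<le> u y - u' y" using torus_bounded_above by blast
    obtain x v where "torus_shift x (\<tau> *\<^sub>R v) = y" "calibrated \<tau> c' u' x v" using weak_kamD(3)[OF B] by blast
    then have "\<tau> * c \<le> \<tau> * c'" using weak_kamD(2)[OF A, of x v] y[of x] unfolding calibrated_def by auto
    then show ?thesis using assms(1) by simp
  qed
  show ?thesis using *[OF assms(2,3)] *[OF assms(3,2)] by simp
qed

lemma L_bar_eq:
  assumes "\<tau> > 0" "weak_kam \<tau> c u" shows "L_bar \<tau> l = c"
  unfolding L_bar_def
proof (rule the_equality)
  show "\<exists>u. lax_oleinik_solution \<tau> l c u" using weak_kam_lax_oleinik[OF assms] by blast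
  show "\<And>c'. \<exists>u. lax_oleinik_solution \<tau> l c' u \<Longrightarrow> c' = c"
    using lax_oleinik_weak_kam[OF assms(1)] weak_kam_c_unique[OF assms(1) _ assms(2)] by blast
qed

text \<open>The discounted Lax-Oleinik operator contracts the sup norm with factor \<beta>, so
  Banach's theorem yields a fixed point. Most of the proof shows that the operator preserves
  continuity, by bending minimizing steps whose speed is bounded.\<close>

lemma discounted_solution:
  assumes "\<tau> > 0" "0 \<le> \<beta>" "\<beta> < 1"
  obtains u where "continuous_on UNIV u"
    "\<And>x v. u (torus_shift x (\<tau> *\<^sub>R v)) \<le> \<beta> * u x + \<tau> * l x v"
    "\<And>y. \<exists>x v. torus_shift x (\<tau> *\<^sub>R v) = y \<and> u y = \<beta> * u x + \<tau> * l x v"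
proof -
  define J where "J w y v = \<beta> * w (torus_shift y (- (\<tau> *\<^sub>R v))) + \<tau> * l (torus_shift y (- (\<tau> *\<^sub>R v))) v"
    for w :: "'n torus \<Rightarrow> real" and y v
  have att: "\<exists>v. \<forall>v'. J w y v \<le> J w y v'" if w: "continuous_on UNIV w" for w y
  proof -
    obtain B where B: "\<And>x. \<bar>w x\<bar> \<le> B" using torus_abs_bounded[OF w] by blast
    have c: "continuous_on UNIV (J w y)" unfolding J_def
      by (intro continuous_intros continuous_on_compose2[OF w]) auto
    have "norm v + (\<tau> * Cs (1 / \<tau>) - \<beta> * B) \<le> J w y v" for v
    proof -
    have "\<tau> * (1 / \<tau> * norm v + Cs (1 / \<tau>)) \<le> \<tau> * l (torus_shift y (- (\<tau> *\<^sub>R v))) v"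
      using assms(1) by (intro mult_left_mono superlinear) simp
    moreover have "- (\<beta> * B) \<le> \<beta> * w (torus_shift y (- (\<tau> *\<^sub>R v)))"
      using mult_left_mono[of "- B" "w (torus_shift y (- (\<tau> *\<^sub>R v)))" \<beta>] B[of "torus_shift y (- (\<tau> *\<^sub>R v))"] assms(2) by auto
    ultimately show ?thesis
      using assms(1) unfolding J_def by (simp add: distrib_left)
    qed
    then show ?thesis by (rule coercive_attains_inf[OF c])
  qed
  define m where "m w y = (SOME v. \<forall>v'. J w y v \<le> J w y v')" for w y
  have m: "J w y (m w y) \<le> J w y v" if "continuous_on UNIV w" for w y v
    using someI_ex[OF att[OF that, of y]] unfolding m_def by blast
  define T where "T w y = J w y (m w y)" for w y
  have lip: "\<exists>K\<ge>0. \<forall>y h. norm h \<le> \<tau> \<longrightarrow> T w (torus_shift y h) \<le> T w y + K * norm h" if w: "continuous_on UNIV w" for w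
  proof -
    obtain B where B: "\<And>x. \<bar>w x\<bar> \<le> B" using torus_abs_bounded[OF w] by blast
    have "B \<ge> 0" using B[of undefined] by linarith
    \<comment> \<open>A minimizing step costs no more than standing still, and values of
      \<open>w\<close> differ by at most \<open>2 * B\<close>; slope 1 in \<open>superlinear\<close>
      turns this bound on the Lagrangian into the speed bound \<open>r\<close>.\<close>
    define r where "r = M + 2 * B / \<tau> - Cs 1"
    have "T w (torus_shift y h) \<le> T w y + \<Lambda> (r + 1) * norm h" if h: "norm h \<le> \<tau>" for y h
    proof -
      define v where "v = m w y"
      define x where "x = torus_shift y (- (\<tau> *\<^sub>R v))"
      define e where "e = (1 / \<tau>) *\<^sub>R h"
      have e: "norm e \<le> 1" "\<tau> *\<^sub>R e = h" using h assms(1) by (auto simp: e_def)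
      have Ty: "T w y = \<beta> * w x + \<tau> * l x v" by (simp add: T_def J_def v_def x_def)
      have "\<beta> * w x + \<tau> * l x v \<le> \<beta> * w y + \<tau> * l y 0"
        using m[OF w, of y 0] unfolding Ty[symmetric] T_def by (simp add: J_def)
      moreover have "\<beta> * (w y - w x) \<le> 1 * (2 * B)"
      proof -
        have "w y - w x \<le> 2 * B" using B[of x] B[of y] by (simp add: abs_le_iff)
        then have "\<beta> * (w y - w x) \<le> \<beta> * (2 * B)" using assms(2) by (rule mult_left_mono)
        also have "\<dots> \<le> 1 * (2 * B)" using assms(3) \<open>B \<ge> 0\<close> by (intro mult_right_mono) auto
        finally show ?thesis .
      qed
      moreover have "\<tau> * l y 0 \<le> \<tau> * M" using l_le[of 0 y] assms(1) by simp
      moreover have e': "\<tau> * (M + 2 * B / \<tau>) = \<tau> * M + 2 * B" using assms(1) by (simp add: distrib_left)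
      ultimately have "\<tau> * l x v \<le> \<tau> * (M + 2 * B / \<tau>)" unfolding e' right_diff_distrib by linarith
      then have "l x v \<le> M + 2 * B / \<tau>" using assms(1) by (rule mult_left_le_imp_le)
      then have v: "norm v \<le> r" using superlinear[of 1 v x] unfolding r_def by simp
      have "T w (torus_shift y h) \<le> J w (torus_shift y h) (v + e)" unfolding T_def by (rule m[OF w])
      also have "\<dots> = \<beta> * w x + \<tau> * l x (v + e)"
        by (simp add: J_def x_def scaleR_add_right e(2))
      also have "\<dots> \<le> \<beta> * w x + \<tau> * (l x v + \<Lambda> (r + 1) * norm e)"
        using lipschitz_v[of "v + e" "r + 1" v x] v e(1) norm_triangle_ineq[of v e] assms(1)
        by (intro add_left_mono mult_left_mono) auto
      also have "\<dots> = T w y + \<Lambda> (r + 1) * norm h" using assms(1) unfolding Ty e_def by (simp add: distrib_left)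
      finally show ?thesis .
    qed
    then show ?thesis using \<Lambda>_nonneg by blast
  qed
  have Tc: "continuous_on UNIV (T w)" if w: "continuous_on UNIV w" for w
    unfolding continuous_on_iff
  proof (intro ballI allI impI)
    fix x :: "'n torus" and e :: real assume "e > 0"
    obtain K where K: "K \<ge> 0" "\<And>y h. norm h \<le> \<tau> \<Longrightarrow> T w (torus_shift y h) \<le> T w y + K * norm h" using lip[OF w] by blast
    define d where "d = min \<tau> (e / (K + 1))"
    have "dist (T w y) (T w x) < e" if d: "dist y x < d" for y
    proof -
      obtain h where h: "torus_shift x h = y" "norm h = dist x y" using torus_displacement by blast
      obtain h' where h': "torus_shift y h' = x" "norm h' = dist y x" using torus_displacement by blast
      have "(K + 1) * dist y x < e" using d K(1) unfolding d_def by (simp add: pos_less_divide_eq mult.commute)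
      then have "K * dist y x < e" using zero_le_dist[of y x] unfolding distrib_right by linarith
      moreover have "dist y x \<le> \<tau>" using d unfolding d_def by simp
      ultimately show ?thesis
        using K(2)[of h x] K(2)[of h' y] h h' by (simp add: dist_real_def dist_commute)
    qed
    moreover have "d > 0" using assms(1) \<open>e > 0\<close> K(1) unfolding d_def by simp
    ultimately show "\<exists>d>0. \<forall>x'\<in>UNIV. dist x' x < d \<longrightarrow> dist (T w x') (T w x) < e" by blast
  qed
  have bc: "continuous_on UNIV (apply_bcontfun f)" for f :: "'n torus \<Rightarrow>\<^sub>C real" using continuous_on_apply_bcontfun by blast
  define \<Phi> where "\<Phi> f = Bcontfun (T (apply_bcontfun f))" for f :: "'n torus \<Rightarrow>\<^sub>C real"
  have \<Phi>: "apply_bcontfun (\<Phi> f) = T (apply_bcontfun f)" for f :: "'n torus \<Rightarrow>\<^sub>C real"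
  proof -
    obtain B where B: "\<And>x. \<bar>T (apply_bcontfun f) x\<bar> \<le> B" using torus_abs_bounded[OF Tc[OF bc]] by blast
    have "T (apply_bcontfun f) \<in> bcontfun"
      unfolding bcontfun_def using Tc[OF bc] B by (auto simp: bounded_iff)
    then show ?thesis unfolding \<Phi>_def by (rule Bcontfun_inverse)
  qed
  have contr: "dist (\<Phi> f) (\<Phi> g) \<le> \<beta> * dist f g" for f g :: "'n torus \<Rightarrow>\<^sub>C real"
  proof (rule dist_bound)
    fix y
    have *: "T (apply_bcontfun f) y \<le> T (apply_bcontfun g) y + \<beta> * dist f g" for f g :: "'n torus \<Rightarrow>\<^sub>C real"
    proof -
      let ?v = "m (apply_bcontfun g) y"
      let ?x = "torus_shift y (- (\<tau> *\<^sub>R ?v))"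
      have "T (apply_bcontfun f) y \<le> J (apply_bcontfun f) y ?v" unfolding T_def by (rule m[OF bc])
      also have "\<dots> = J (apply_bcontfun g) y ?v + \<beta> * (apply_bcontfun f ?x - apply_bcontfun g ?x)"
        by (simp add: J_def right_diff_distrib)
      also have "\<dots> \<le> T (apply_bcontfun g) y + \<beta> * dist f g"
        using dist_bounded[of f ?x g] assms(2) unfolding T_def by (intro add_mono mult_left_mono) (auto simp: dist_real_def)
      finally show ?thesis .
    qed
    from *[of f g] *[of g f] show "dist (apply_bcontfun (\<Phi> f) y) (apply_bcontfun (\<Phi> g) y) \<le> \<beta> * dist f g"
      unfolding \<Phi> by (simp add: dist_real_def dist_commute abs_le_iff)
  qed
  obtain f where "\<Phi> f = f" using banach_fix_type[OF assms(2,3)] contr by blast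
  define u where "u = apply_bcontfun f"
  have uc: "continuous_on UNIV u" unfolding u_def by (rule bc)
  have uT: "u = T u" unfolding u_def using \<Phi>[of f] \<open>\<Phi> f = f\<close> by simp
  show ?thesis
  proof (rule that[OF uc])
    show "u (torus_shift x (\<tau> *\<^sub>R v)) \<le> \<beta> * u x + \<tau> * l x v" for x v
      using m[OF uc, of "torus_shift x (\<tau> *\<^sub>R v)" v] fun_cong[OF uT, of "torus_shift x (\<tau> *\<^sub>R v)"]
      unfolding T_def by (simp add: J_def)
    show "\<exists>x v. torus_shift x (\<tau> *\<^sub>R v) = y \<and> u y = \<beta> * u x + \<tau> * l x v" for y
    proof (intro exI conjI)
      show "torus_shift (torus_shift y (- (\<tau> *\<^sub>R m u y))) (\<tau> *\<^sub>R m u y) = y" by simp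
      show "u y = \<beta> * u (torus_shift y (- (\<tau> *\<^sub>R m u y))) + \<tau> * l (torus_shift y (- (\<tau> *\<^sub>R m u y))) (m u y)"
        using fun_cong[OF uT, of y] unfolding T_def J_def .
    qed
  qed
qed

text \<open>A weak KAM solution is a limit of discounted solutions as the discount factor tends to \<open>1\<close>.\<close>

lemma weak_kam_exists:
  assumes "\<tau> > 0"
  obtains c u where "weak_kam \<tau> c u"
proof -
  define \<beta> where "\<beta> n = 1 - 1 / real (n + 2)" for n
  have \<beta>: "0 \<le> \<beta> n" "\<beta> n < 1" for n unfolding \<beta>_def by (auto simp: field_simps)
  have "\<exists>u. continuous_on UNIV u \<and> (\<forall>x v. u (torus_shift x (\<tau> *\<^sub>R v)) \<le> \<beta> n * u x + \<tau> * l x v) \<and>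
    (\<forall>y. \<exists>x v. torus_shift x (\<tau> *\<^sub>R v) = y \<and> u y = \<beta> n * u x + \<tau> * l x v)" for n
    using discounted_solution[OF assms \<beta>] by metis
  then obtain u where u: "\<And>n. continuous_on UNIV (u n)"
    "\<And>n x v. u n (torus_shift x (\<tau> *\<^sub>R v)) \<le> \<beta> n * u n x + \<tau> * l x v"
    "\<And>n y. \<exists>x v. torus_shift x (\<tau> *\<^sub>R v) = y \<and> u n y = \<beta> n * u n x + \<tau> * l x v" by metis
  obtain D where D: "0 \<le> D" "\<And>x y :: 'n torus. dist x y \<le> D" using torus_dist_bounded by blast
  \<comment> \<open>One step of speed at most \<open>D / \<tau>\<close> connects any two points of
    the torus, and \<open>M'\<close> bounds its Lagrangian. This leads to the oscillation bound
    \<open>Q\<close>, uniform in the discount factor.\<close>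
  define M' where "M' = M + \<Lambda> (D / \<tau>) * (D / \<tau>)"
  have low: "\<tau> * Cs 0 \<le> (1 - \<beta> n) * u n z" for n z
  proof -
    obtain y where y: "\<And>z. u n y \<le> u n z" using torus_bounded_below[OF u(1)] by blast
    obtain x v where "u n y = \<beta> n * u n x + \<tau> * l x v" using u(3) by blast
    moreover have "\<beta> n * u n y \<le> \<beta> n * u n x" using y \<beta>(1) by (intro mult_left_mono) auto
    moreover have "\<tau> * Cs 0 \<le> \<tau> * l x v" using l_ge assms by (intro mult_left_mono) auto
    ultimately have "\<tau> * Cs 0 \<le> (1 - \<beta> n) * u n y" by (simp add: left_diff_distrib)
    also have "\<dots> \<le> (1 - \<beta> n) * u n z" using y \<beta>(2)[of n] by (intro mult_left_mono) auto
    finally show ?thesis .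
  qed
  have up: "(1 - \<beta> n) * u n z \<le> \<tau> * M" for n z
  proof -
    have "\<tau> * l z 0 \<le> \<tau> * M" using l_le[of 0 z] assms by simp
    then show ?thesis using u(2)[of n z 0] by (simp add: left_diff_distrib)
  qed
  define Q where "Q = \<tau> * (M' - Cs 0)"
  have osc: "u n y - u n x \<le> Q" for n x y
  proof -
    obtain w where w: "torus_shift x w = y" "norm w = dist x y" using torus_displacement by blast
    define v where "v = (1 / \<tau>) *\<^sub>R w"
    have v: "norm v \<le> D / \<tau>" using w(2) D(2)[of x y] assms by (simp add: v_def divide_right_mono)
    have "l x v \<le> l x 0 + \<Lambda> (D / \<tau>) * norm v"
      using lipschitz_v[of v "D / \<tau>" 0 x] v D(1) assms by (simp add: abs_le_iff)
    also have "\<dots> \<le> M'" unfolding M'_def using l_le[of 0 x] v \<Lambda>_nonneg by (intro add_mono mult_left_mono) auto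
    finally have "\<tau> * l x v \<le> \<tau> * M'" using assms by simp
    moreover have "u n y \<le> \<beta> n * u n x + \<tau> * l x v" using u(2)[of n x v] w(1) assms by (simp add: v_def)
    ultimately show ?thesis using low[of n x] unfolding Q_def by (simp add: algebra_simps)
  qed
  have Q0: "Q \<ge> 0" using osc[of 0 undefined undefined] by simp
  define r where "r = M + Q / \<tau> - Cs 1"
  have vb: "norm v \<le> r" if eq: "u n (torus_shift x (\<tau> *\<^sub>R v)) = \<beta> n * u n x + \<tau> * l x v" for n x v
  proof -
    define y where "y = torus_shift x (\<tau> *\<^sub>R v)"
    have "\<beta> n * u n x + \<tau> * l x v \<le> \<beta> n * u n y + \<tau> * l y 0" using u(2)[of n y 0] eq y_def by simp
    moreover have "\<beta> n * (u n y - u n x) \<le> 1 * Q"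
      using osc[of n y x] \<beta>[of n] Q0 mult_left_mono[OF osc[of n y x] \<beta>(1)[of n]] mult_right_mono[of "\<beta> n" 1 Q] by linarith
    moreover have "\<tau> * l y 0 \<le> \<tau> * M" using l_le[of 0 y] assms by simp
    moreover have e: "\<tau> * (M + Q / \<tau>) = \<tau> * M + Q" using assms by (simp add: distrib_left)
    ultimately have "\<tau> * l x v \<le> \<tau> * (M + Q / \<tau>)" unfolding e right_diff_distrib by linarith
    then have "l x v \<le> M + Q / \<tau>" using assms by (rule mult_left_le_imp_le)
    then show ?thesis using superlinear[of 1 v x] unfolding r_def by simp
  qed
  define K where "K = \<Lambda> (r + 1) + Q / \<tau>"
  have lip1: "u n (torus_shift y h) - u n y \<le> K * norm h" for n y h
  proof (cases "norm h \<le> \<tau>")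
    case True
    obtain x v where xv: "torus_shift x (\<tau> *\<^sub>R v) = y" "u n y = \<beta> n * u n x + \<tau> * l x v" using u(3) by blast
    define e where "e = (1 / \<tau>) *\<^sub>R h"
    have e: "norm e \<le> 1" "\<tau> *\<^sub>R e = h" using True assms by (auto simp: e_def)
    have v: "norm v \<le> r" using vb[of n x v] xv by simp
    have "u n (torus_shift y h) \<le> \<beta> n * u n x + \<tau> * l x (v + e)"
      using u(2)[of n x "v + e"] by (simp add: scaleR_add_right e(2) flip: xv(1))
    then have "u n (torus_shift y h) - u n y \<le> \<tau> * (l x (v + e) - l x v)" using xv(2) by (simp add: right_diff_distrib)
    also have "\<dots> \<le> \<tau> * (\<Lambda> (r + 1) * norm e)"
      using lipschitz_v[of "v + e" "r + 1" v x] v e(1) norm_triangle_ineq[of v e] assms by (intro mult_left_mono) auto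
    also have "\<dots> = \<Lambda> (r + 1) * norm h" using assms by (simp add: e_def)
    also have "\<dots> \<le> K * norm h" unfolding K_def using Q0 assms by (intro mult_right_mono) auto
    finally show ?thesis .
  next
    case False
    have "u n (torus_shift y h) - u n y \<le> Q" by (rule osc)
    also have "Q \<le> Q / \<tau> * norm h" using False assms Q0 by (simp add: field_simps mult_left_mono)
    also have "\<dots> \<le> K * norm h" unfolding K_def using \<Lambda>_nonneg by (intro mult_right_mono) auto
    finally show ?thesis .
  qed
  have lip: "\<bar>u n x - u n y\<bar> \<le> K * dist x y" for n x y
  proof -
    have "u n y - u n x \<le> K * dist x y" for x y
      using torus_displacement[of x y] lip1[of n x] by metis
    from this[of x y] this[of y x] show ?thesis by (simp add: dist_commute abs_le_iff)
  qed
  define z0 where "z0 = torus_of (0 :: real ^ 'n)"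
  \<comment> \<open>The values of \<open>u n\<close> may diverge as the discount factor tends to 1.
    Normalised at \<open>z0\<close> they stay bounded, and \<open>(1 - \<beta> n) * u n z0\<close>
    converges along a subsequence to \<tau> times the additive constant, hence
    \<open>kk / \<tau>\<close> at the end.\<close>
  define w where "w n x = u n x - u n z0" for n x
  define k where "k n = (1 - \<beta> n) * u n z0" for n
  obtain g s where s: "strict_mono s" and gc: "continuous_on UNIV g" and ul: "uniform_limit UNIV (\<lambda>i. w (s i)) g sequentially"
  proof (rule torus_Arzela_Ascoli[of w Q K])
    show "\<bar>w i x\<bar> \<le> Q" for i x using osc[of i x z0] osc[of i z0 x] unfolding w_def by (simp add: abs_le_iff)
    show "\<bar>w i x - w i y\<bar> \<le> K * dist x y" for i x y using lip[of i x y] unfolding w_def by simp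
  qed blast
  obtain kk t where t: "strict_mono t" "(\<lambda>n. k (s (t n))) \<longlonglongrightarrow> kk"
    by (rule compact_subsequence[of "{\<tau> * Cs 0..\<tau> * M}" "\<lambda>n. k (s n)"]) (use low up in \<open>auto simp: k_def\<close>)
  define q where "q n = s (t n)" for n
  have q: "strict_mono q" using s t(1) unfolding q_def strict_mono_def by simp
  have ul2: "uniform_limit UNIV (\<lambda>i. w (q i)) g sequentially"
    using filterlim_compose[OF ul filterlim_subseq[OF t(1)]] by (simp add: q_def)
  have "(\<lambda>n. 1 - inverse (real (Suc n))) \<longlonglongrightarrow> 1 - 0" by (intro tendsto_intros LIMSEQ_inverse_real_of_nat)
  then have "(\<lambda>n. 1 - inverse (real (Suc (Suc n)))) \<longlonglongrightarrow> 1" by (simp only: LIMSEQ_Suc[of "\<lambda>n. 1 - inverse (real (Suc n))"] diff_0_right)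
  then have "\<beta> \<longlonglongrightarrow> 1" unfolding \<beta>_def by (simp add: inverse_eq_divide add.commute)
  then have \<beta>lim: "(\<lambda>n. \<beta> (q n)) \<longlonglongrightarrow> 1" using LIMSEQ_subseq_LIMSEQ[OF _ q] by (simp add: o_def)
  have klim: "(\<lambda>n. k (q n)) \<longlonglongrightarrow> kk" using t(2) unfolding q_def .
  have gat: "isCont g x" for x using gc by (simp add: continuous_on_eq_continuous_at)
  have wl: "(\<lambda>n. w (q n) (X n)) \<longlonglongrightarrow> g x" if "X \<longlonglongrightarrow> x" for X x
    by (rule uniform_limit_tendsto_compose[OF ul2 gat that])
  have sub: "g (torus_shift x (\<tau> *\<^sub>R v)) + kk \<le> g x + \<tau> * l x v" for x v
  proof (rule LIMSEQ_le)
    show "(\<lambda>n. w (q n) (torus_shift x (\<tau> *\<^sub>R v)) + k (q n)) \<longlonglongrightarrow> g (torus_shift x (\<tau> *\<^sub>R v)) + kk"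
      by (intro tendsto_intros wl klim)
    have "(\<lambda>n. \<beta> (q n) * w (q n) x + \<tau> * l x v) \<longlonglongrightarrow> 1 * g x + \<tau> * l x v"
      by (intro tendsto_intros wl \<beta>lim)
    then show "(\<lambda>n. \<beta> (q n) * w (q n) x + \<tau> * l x v) \<longlonglongrightarrow> g x + \<tau> * l x v" by simp
    show "\<exists>N. \<forall>n\<ge>N. w (q n) (torus_shift x (\<tau> *\<^sub>R v)) + k (q n) \<le> \<beta> (q n) * w (q n) x + \<tau> * l x v"
      using u(2)[where x = x and v = v] unfolding w_def k_def by (simp add: algebra_simps)
  qed
  \<comment> \<open>The minimizing velocities stay in \<open>cball 0 r\<close>, so for the given
    \<open>y\<close> a further subsequence of them converges and equality survives the
    limit.\<close>
  have cal: "\<exists>x v. torus_shift x (\<tau> *\<^sub>R v) = y \<and> g y + kk = g x + \<tau> * l x v" for y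
  proof -
    obtain X V where XV: "\<And>n. torus_shift (X n) (\<tau> *\<^sub>R V n) = y" "\<And>n. u n y = \<beta> n * u n (X n) + \<tau> * l (X n) (V n)"
      using u(3) by metis
    have "V (q n) \<in> cball 0 r" for n using vb[of "q n" "X (q n)" "V (q n)"] XV by simp
    then obtain v p where p: "strict_mono p" "(\<lambda>n. V (q (p n))) \<longlonglongrightarrow> v"
      using compact_subsequence[OF compact_cball, of "\<lambda>n. V (q n)" 0 r] by metis
    have X: "X n = torus_shift y (- (\<tau> *\<^sub>R V n))" for n using arg_cong[OF XV(1)[of n], of "\<lambda>z. torus_shift z (- (\<tau> *\<^sub>R V n))"] by simp
    define x where "x = torus_shift y (- (\<tau> *\<^sub>R v))"
    have Xl: "(\<lambda>n. X (q (p n))) \<longlonglongrightarrow> x" unfolding X x_def by (intro tendsto_intros p(2))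
    have ul3: "uniform_limit UNIV (\<lambda>i. w (q (p i))) g sequentially"
      using filterlim_compose[OF ul2 filterlim_subseq[OF p(1)]] by simp
    note wl3 = uniform_limit_tendsto_compose[OF ul3 gat]
    have "(\<lambda>n. w (q (p n)) y + k (q (p n))) \<longlonglongrightarrow> g y + kk"
      using LIMSEQ_subseq_LIMSEQ[OF klim p(1)] by (intro tendsto_intros wl3) (simp_all add: o_def)
    moreover have "(\<lambda>n. w (q (p n)) y + k (q (p n)))
      = (\<lambda>n. \<beta> (q (p n)) * w (q (p n)) (X (q (p n))) + \<tau> * l (X (q (p n))) (V (q (p n))))"
      using XV(2) unfolding w_def k_def by (simp add: algebra_simps fun_eq_iff)
    moreover have "(\<lambda>n. \<beta> (q (p n)) * w (q (p n)) (X (q (p n))) + \<tau> * l (X (q (p n))) (V (q (p n)))) \<longlonglongrightarrow> 1 * g x + \<tau> * l x v"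
      using LIMSEQ_subseq_LIMSEQ[OF \<beta>lim p(1)] by (intro tendsto_intros wl3 l_tendsto Xl p(2)) (simp_all add: o_def)
    ultimately have "g y + kk = g x + \<tau> * l x v" using LIMSEQ_unique by fastforce
    moreover have "torus_shift x (\<tau> *\<^sub>R v) = y" by (simp add: x_def)
    ultimately show ?thesis by blast
  qed
  have "weak_kam \<tau> (kk / \<tau>) g"
    unfolding weak_kam_def subsolution_def calibrated_def using gc sub cal assms by simp (metis)
  then show ?thesis by (rule that)
qed

lemma L_bar_weak_kam:
  assumes "\<tau> > 0" obtains u where "weak_kam \<tau> (L_bar \<tau> l) u"
  using weak_kam_exists[OF assms] L_bar_eq[OF assms] by metis

end

section \<open>Weak convergence of measures\<close>

lemma borel_probD:
  assumes "m \<in> borel_prob"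
  shows "prob_space m" "sets m = sets borel" "space m = UNIV"
  using assms sets_eq_imp_space_eq[of m borel] unfolding borel_prob_def by auto

lemma borel_prob_integrable:
  fixes f :: "'a::topological_space \<Rightarrow> real"
  assumes "m \<in> borel_prob" "f \<in> borel_measurable borel" "AE x in m. \<bar>f x\<bar> \<le> B"
  shows "integrable m f"
proof -
  interpret prob_space m by (rule borel_probD(1)[OF assms(1)])
  have "f \<in> borel_measurable m" using assms(2) borel_probD(2)[OF assms(1)] by (simp cong: measurable_cong_sets)
  then show ?thesis using assms(3) by (intro integrable_const_bound[of _ B]) auto
qed

lemma abs_min_1_infdist: "\<bar>min 1 (infdist x A)\<bar> \<le> 1"
  using infdist_nonneg[of x A] by simp

text \<open>Almost sure membership in a closed set becomes the vanishing of an integral of a bounded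
  continuous function, a condition that passes to weak limits and that holonomy can
  transport.\<close>

lemma borel_prob_integral_0_AE_in_closed:
  fixes A :: "'a::metric_space set"
  assumes m: "m \<in> borel_prob" and "closed A" "A \<noteq> {}" and f: "f \<in> borel_measurable borel"
  shows "(\<integral>x. min 1 (infdist (f x) A) \<partial>m) = 0 \<longleftrightarrow> (AE x in m. f x \<in> A)"
proof -
  have c: "continuous_on UNIV (\<lambda>y. min 1 (infdist y A))" by (intro continuous_intros)
  have "(\<lambda>x. min 1 (infdist (f x) A)) \<in> borel_measurable borel"
    using measurable_compose[OF f borel_measurable_continuous_onI[OF c]] .
  then have "integrable m (\<lambda>x. min 1 (infdist (f x) A))"
    by (intro borel_prob_integrable[OF m, of _ 1]) (auto intro!: AE_I2 abs_min_1_infdist)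
  then have "(\<integral>x. min 1 (infdist (f x) A) \<partial>m) = 0 \<longleftrightarrow> (AE x in m. min 1 (infdist (f x) A) = 0)"
    by (intro integral_nonneg_eq_0_iff_AE) (auto simp: infdist_nonneg)
  also have "\<dots> \<longleftrightarrow> (AE x in m. f x \<in> A)"
    using in_closed_iff_infdist_zero[OF assms(2,3)] infdist_nonneg[of _ A] by (intro AE_cong) (auto simp: min_def)
  finally show ?thesis .
qed

text \<open>At the first digit where the codes differ the difference is \<open>(1 / 3) ^ j0\<close>,
  while all later digits together contribute at most half of that. Digits 0 and 1 in base 3 leave
  this gap; in base 2 the tail could cancel the leading term.\<close>

lemma triadic_coding_gap:
  fixes B :: "nat \<Rightarrow> 'a set"
  defines "c \<equiv> \<lambda>x j. (if x \<in> B j then 1 else 0) * (1 / 3) ^ j :: real"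
  assumes "\<bar>(\<Sum>j. c x j) - (\<Sum>j. c y j)\<bar> < (1 / 3) ^ J / 2" "j < J"
  shows "x \<in> B j \<longleftrightarrow> y \<in> B j"
proof (rule ccontr)
  assume "\<not> (x \<in> B j \<longleftrightarrow> y \<in> B j)"
  define j0 where "j0 = (LEAST j. \<not> (x \<in> B j \<longleftrightarrow> y \<in> B j))"
  have j0: "\<not> (x \<in> B j0 \<longleftrightarrow> y \<in> B j0)" "j0 \<le> j"
    unfolding j0_def using \<open>\<not> (x \<in> B j \<longleftrightarrow> y \<in> B j)\<close> by (rule LeastI, rule Least_le)
  have below: "x \<in> B i \<longleftrightarrow> y \<in> B i" if "i < j0" for i using not_less_Least[of i] that unfolding j0_def by blast
  have geo: "summable (\<lambda>j. (1 / 3 :: real) ^ j)" by (rule summable_geometric) simp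
  have sc: "summable (c x)" for x
    by (rule summable_comparison_test'[OF geo, of 0]) (auto simp: c_def)
  define d where "d i = c x i - c y i" for i
  have d: "summable d" unfolding d_def by (intro summable_diff sc)
  have dle: "\<bar>d i\<bar> \<le> (1 / 3) ^ i" for i by (auto simp: d_def c_def)
  have "(\<Sum>j. c x j) - (\<Sum>j. c y j) = suminf d" unfolding d_def by (rule suminf_diff[OF sc sc])
  also have "\<dots> = (\<Sum>i. d (i + Suc j0)) + (\<Sum>i<Suc j0. d i)" by (rule suminf_split_initial_segment[OF d])
  also have "(\<Sum>i<Suc j0. d i) = d j0" using below by (simp add: d_def c_def)
  finally have eq: "(\<Sum>j. c x j) - (\<Sum>j. c y j) = (\<Sum>i. d (i + Suc j0)) + d j0" .
  have "\<bar>\<Sum>i. d (i + Suc j0)\<bar> \<le> (\<Sum>i. (1 / 3) ^ (i + Suc j0))"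
    unfolding real_norm_def[symmetric]
  proof (rule norm_suminf_le)
    show "norm (d (i + Suc j0)) \<le> (1 / 3) ^ (i + Suc j0)" for i
      using dle[of "i + Suc j0"] unfolding real_norm_def .
  qed (rule summable_ignore_initial_segment[OF geo])
  also have "\<dots> = (1 / 3) ^ Suc j0 * (3 / 2)"
    unfolding power_add using suminf_mult2[OF geo, of "(1 / 3) ^ Suc j0"] suminf_geometric[of "1 / 3 :: real"] by simp
  also have "\<dots> = (1 / 3) ^ j0 / 2" by simp
  finally have "\<bar>\<Sum>i. d (i + Suc j0)\<bar> \<le> (1 / 3) ^ j0 / 2" .
  moreover have "\<bar>d j0\<bar> = (1 / 3) ^ j0" using j0(1) by (auto simp: d_def c_def)
  ultimately have "(1 / 3) ^ j0 / 2 \<le> \<bar>(\<Sum>j. c x j) - (\<Sum>j. c y j)\<bar>" unfolding eq by linarith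
  moreover have "(1 / 3 :: real) ^ J \<le> (1 / 3) ^ j0" using j0(2) assms(3) by (intro power_decreasing) auto
  ultimately show False using assms(2) by simp
qed

text \<open>Reading off membership in a sequence of small balls as ternary digits embeds a compact set
  measurably into the line with a uniformly continuous inverse, which reduces weak compactness of
  measures to Helly's selection theorem.\<close>

lemma compact_real_coding:
  fixes S :: "'a::{second_countable_topology, complete_space} set"
  assumes "compact S" "S \<noteq> {}"
  obtains s :: "'a \<Rightarrow> real" and g :: "real \<Rightarrow> 'a" where "s \<in> borel_measurable borel" "\<And>x. s x \<in> {0..3/2}"
    "continuous_on (closure (s ` S)) g" "\<And>x. x \<in> S \<Longrightarrow> g (s x) = x" "g ` closure (s ` S) \<subseteq> S"
proof -
  have "\<exists>A. finite A \<and> A \<subseteq> S \<and> S \<subseteq> (\<Union>a\<in>A. ball a (inverse (real (Suc k))))" for k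
    using assms(1) by (rule compactE_image[of S S "\<lambda>a. ball a (inverse (real (Suc k)))"]) auto
  then obtain A where A: "\<And>k. finite (A k)" "\<And>k. A k \<subseteq> S" "\<And>k. S \<subseteq> (\<Union>a\<in>A k. ball a (inverse (real (Suc k))))"
    by metis
  define \<B> where "\<B> = (\<Union>k. (\<lambda>a. ball a (inverse (real (Suc k)))) ` A k)"
  have "countable \<B>" unfolding \<B>_def by (intro countable_UN countable_image) (auto intro: countable_finite A(1))
  have "A 0 \<noteq> {}" using A(3)[of 0] assms(2) by auto
  then have "\<B> \<noteq> {}" unfolding \<B>_def by blast
  define B where "B = from_nat_into \<B>"
  have Bin: "B j \<in> \<B>" for j unfolding B_def using from_nat_into[OF \<open>\<B> \<noteq> {}\<close>] .
  \<comment> \<open>All balls of level \<open>k\<close> occur among the first \<open>J k\<close>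
    sets, so agreement of that many digits puts both points into a common ball of radius
    \<open>1 / (k + 1)\<close>.\<close>
  define J where "J k = Suc (Max (to_nat_on \<B> ` (\<lambda>a. ball a (inverse (real (Suc k)))) ` A k))" for k
  have close: "dist x y < 2 * inverse (real (Suc k))" if "x \<in> S" "\<And>j. j < J k \<Longrightarrow> x \<in> B j \<longleftrightarrow> y \<in> B j" for x y k
  proof -
    obtain a where a: "a \<in> A k" "x \<in> ball a (inverse (real (Suc k)))" using A(3)[of k] \<open>x \<in> S\<close> by blast
    define U where "U = ball a (inverse (real (Suc k)))"
    have U: "U \<in> \<B>" unfolding U_def \<B>_def using a(1) by blast
    have "to_nat_on \<B> U \<le> Max (to_nat_on \<B> ` (\<lambda>a. ball a (inverse (real (Suc k)))) ` A k)"
      unfolding U_def using A(1) a(1) by (intro Max_ge) auto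
    then have "to_nat_on \<B> U < J k" unfolding J_def by simp
    moreover have "B (to_nat_on \<B> U) = U" unfolding B_def using \<open>countable \<B>\<close> U by simp
    ultimately have "y \<in> U" using that(2) a(2) U_def by metis
    then have "dist a x < inverse (real (Suc k))" "dist a y < inverse (real (Suc k))" using a(2) unfolding U_def by auto
    then show ?thesis using dist_triangle3[of x y a] by linarith
  qed
  define c where "c = (\<lambda>x j. (if x \<in> B j then 1 else 0) * (1 / 3) ^ j :: real)"
  define s where "s x = (\<Sum>j. c x j)" for x
  have geo: "summable (\<lambda>j. (1 / 3 :: real) ^ j)" by (rule summable_geometric) simp
  have sc: "summable (c x)" for x
    by (rule summable_comparison_test'[OF geo, of 0]) (auto simp: c_def)
  have "open (B j)" for j using Bin[of j] unfolding \<B>_def by auto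
  then have [measurable]: "B j \<in> sets borel" for j by simp
  have s_meas: "s \<in> borel_measurable borel" unfolding s_def c_def by measurable
  have s_range: "s x \<in> {0..3/2}" for x
  proof -
    have "s x \<le> (\<Sum>j. (1 / 3) ^ j)" unfolding s_def by (intro suminf_le sc geo) (auto simp: c_def)
    then have "s x \<le> 3 / 2" using suminf_geometric[of "1 / 3 :: real"] by simp
    moreover have "0 \<le> s x" unfolding s_def by (intro suminf_nonneg sc) (auto simp: c_def)
    ultimately show ?thesis by simp
  qed
  have gap: "dist x y < 2 * inverse (real (Suc k))" if "x \<in> S" "dist (s x) (s y) < (1 / 3) ^ J k / 2" for x y k
    using close[OF \<open>x \<in> S\<close>] triadic_coding_gap[of x B y "J k"] that(2) unfolding s_def c_def dist_real_def by blast
  have small: "\<exists>k. 2 * inverse (real (Suc k)) < e" if "e > 0" for e :: real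
  proof -
    obtain n where "inverse (real (Suc n)) < e / 2" using reals_Archimedean[of "e / 2"] \<open>e > 0\<close> by auto
    then have "2 * inverse (real (Suc n)) < e" by linarith
    then show ?thesis ..
  qed
  have inj: "inj_on s S"
  proof (rule inj_onI)
    fix x y assume "x \<in> S" "y \<in> S" "s x = s y"
    then have "dist x y < 2 * inverse (real (Suc k))" for k using gap[of x y k] by simp
    then have "\<not> dist x y > 0" using small[of "dist x y"] by (metis less_asym)
    then show "x = y" by simp
  qed
  have uc: "uniformly_continuous_on (s ` S) (inv_into S s)"
    unfolding uniformly_continuous_on_def
  proof (intro allI impI)
    fix e :: real assume "e > 0"
    then obtain k where k: "2 * inverse (real (Suc k)) < e" using small by blast
    show "\<exists>d>0. \<forall>x\<in>s ` S. \<forall>x'\<in>s ` S. dist x' x < d \<longrightarrow> dist (inv_into S s x') (inv_into S s x) < e"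
    proof (intro exI[of _ "(1 / 3) ^ J k / 2"] conjI ballI impI)
      fix t t' assume "t \<in> s ` S" "t' \<in> s ` S" "dist t' t < (1 / 3) ^ J k / 2"
      then obtain x x' where "x \<in> S" "x' \<in> S" "t = s x" "t' = s x'" by blast
      then show "dist (inv_into S s t') (inv_into S s t) < e"
        using gap[of x' x k] \<open>dist t' t < _\<close> k inj by simp
    qed simp
  qed
  \<comment> \<open>A weak limit on the line is carried only by the closure of the image of
    \<open>S\<close>, so the inverse has to be extended there. This is why uniform continuity was
    established, and not just continuity.\<close>
  obtain g where g: "uniformly_continuous_on (closure (s ` S)) g" "\<And>t. t \<in> s ` S \<Longrightarrow> inv_into S s t = g t"
    using uniformly_continuous_on_extension_on_closure[OF uc] by metis
  have gc: "continuous_on (closure (s ` S)) g" using g(1) by (rule uniformly_continuous_imp_continuous)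
  have gs: "g (s x) = x" if "x \<in> S" for x using g(2)[of "s x"] that inj by simp
  have "g ` closure (s ` S) \<subseteq> S"
    by (rule image_closure_subset[OF gc compact_imp_closed[OF assms(1)]]) (use gs in auto)
  then show ?thesis using that[OF s_meas s_range gc gs] by blast
qed

text \<open>The code \<open>s\<close> is only measurable, but its inverse \<open>g\<close> is
  continuous. Measures are pushed to the line by \<open>s\<close>, a subsequence converges there,
  and the limit is carried back by \<open>g\<close>; a test function \<open>f\<close> appears on the
  line as the continuous function \<open>f (g t)\<close>.\<close>

theorem borel_prob_seq_compact:
  fixes \<mu> :: "nat \<Rightarrow> 'a::{second_countable_topology, complete_space} measure"
  assumes S: "compact S" and \<mu>: "\<And>n. \<mu> n \<in> borel_prob" "\<And>n. AE x in \<mu> n. x \<in> S"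
  obtains r \<nu> where "strict_mono (r :: nat \<Rightarrow> nat)" "\<nu> \<in> borel_prob" "AE x in \<nu>. x \<in> S"
    "\<And>f :: 'a \<Rightarrow> real. continuous_on UNIV f \<Longrightarrow> (\<lambda>n. \<integral>x. f x \<partial>\<mu> (r n)) \<longlonglongrightarrow> (\<integral>x. f x \<partial>\<nu>)"
proof -
  have "S \<noteq> {}"
  proof
    assume "S = {}"
    then have "AE x in \<mu> 0. False" using \<mu>(2)[of 0] by simp
    then show False using prob_space.AE_False[OF borel_probD(1)[OF \<mu>(1)]] by blast
  qed
  obtain s :: "'a \<Rightarrow> real" and g :: "real \<Rightarrow> 'a" where s: "s \<in> borel_measurable borel" "\<And>x. s x \<in> {0..3/2}"
    and g: "continuous_on (closure (s ` S)) g" "\<And>x. x \<in> S \<Longrightarrow> g (s x) = x" "g ` closure (s ` S) \<subseteq> S"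
    by (rule compact_real_coding[OF S \<open>S \<noteq> {}\<close>]) blast
  define C where "C = closure (s ` S)"
  have C: "closed C" "C \<noteq> {}" unfolding C_def using \<open>S \<noteq> {}\<close> by auto
  have sm [measurable]: "s \<in> borel_measurable (\<mu> n)" for n
    using s(1) borel_probD(2)[OF \<mu>(1)] by (simp cong: measurable_cong_sets)
  define \<rho> where "\<rho> n = distr (\<mu> n) borel s" for n
  have rd: "real_distribution (\<rho> n)" for n
    unfolding \<rho>_def using prob_space.real_distribution_distr[OF borel_probD(1)[OF \<mu>(1)]] sm by blast
  have "tight \<rho>" unfolding tight_def
  proof (intro conjI allI impI rd)
    fix e :: real assume "e > 0"
    have "measure (\<rho> n) {-1<..2} = 1" for n
    proof -
      interpret real_distribution "\<rho> n" by (rule rd)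
      have "s x \<in> {-1<..2}" for x using s(2)[of x] by simp
      then have "AE t in \<rho> n. t \<in> {-1<..2}" unfolding \<rho>_def by (subst AE_distr_iff) auto
      then show ?thesis by (subst prob_eq_1) auto
    qed
    then show "\<exists>a b. a < b \<and> (\<forall>n. 1 - e < measure (\<rho> n) {a<..b})" using \<open>e > 0\<close> by (intro exI[of _ "-1"] exI[of _ 2]) auto
  qed
  then obtain r N where r: "strict_mono (r :: nat \<Rightarrow> nat)" "real_distribution N" "weak_conv_m (\<rho> \<circ> id \<circ> r) N"
    using tight_imp_convergent_subsubsequence[of \<rho> id] by (auto simp: strict_mono_def)
  interpret N: real_distribution N by (rule r(2))
  have Nb: "N \<in> borel_prob" unfolding borel_prob_def using N.prob_space_axioms N.events_eq_borel by simp
  have conv: "(\<lambda>n. \<integral>x. \<phi> (s x) \<partial>\<mu> (r n)) \<longlonglongrightarrow> (\<integral>t. \<phi> t \<partial>N)"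
    if \<phi>: "continuous_on UNIV \<phi>" "\<And>t. \<bar>\<phi> t\<bar> \<le> B" for \<phi> :: "real \<Rightarrow> real" and B
  proof -
    have "(\<lambda>n. integral\<^sup>L ((\<rho> \<circ> id \<circ> r) n) \<phi>) \<longlonglongrightarrow> integral\<^sup>L N \<phi>"
      using \<phi> by (intro weak_conv_imp_integral_bdd_continuous_conv[of _ _ _ B] r(2,3))
        (auto simp: rd continuous_on_eq_continuous_at)
    moreover have "integral\<^sup>L ((\<rho> \<circ> id \<circ> r) n) \<phi> = (\<integral>x. \<phi> (s x) \<partial>\<mu> (r n))" for n
      unfolding \<rho>_def o_def id_def using borel_measurable_continuous_onI[OF \<phi>(1)] by (intro integral_distr) auto
    ultimately show ?thesis by simp
  qed
  \<comment> \<open>Each \<open>\<rho> n\<close> is carried by \<open>C\<close>, and the truncated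
    distance to \<open>C\<close> is a bounded continuous test function, so the limit
    \<open>N\<close> is carried by \<open>C\<close> as well.\<close>
  have "AE t in N. t \<in> C"
  proof -
    have "(\<integral>x. min 1 (infdist (s x) C) \<partial>\<mu> (r n)) = 0" for n
      unfolding borel_prob_integral_0_AE_in_closed[OF \<mu>(1) C s(1)]
      using \<mu>(2)[of "r n"] by eventually_elim (use closure_subset[of "s ` S"] in \<open>auto simp: C_def\<close>)
    moreover have "(\<lambda>n. \<integral>x. min 1 (infdist (s x) C) \<partial>\<mu> (r n)) \<longlonglongrightarrow> (\<integral>t. min 1 (infdist t C) \<partial>N)"
      by (intro conv[of _ 1] continuous_intros abs_min_1_infdist)
    ultimately have "(\<integral>t. min 1 (infdist t C) \<partial>N) = 0" by (simp add: LIMSEQ_const_iff)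
    then show ?thesis using borel_prob_integral_0_AE_in_closed[OF Nb C, of "\<lambda>t. t"] by simp
  qed
  obtain x0 where "x0 \<in> S" using \<open>S \<noteq> {}\<close> by blast
  define h where "h t = (if t \<in> C then g t else x0)" for t
  have hS: "h t \<in> S" for t using g(3) \<open>x0 \<in> S\<close> unfolding h_def C_def by auto
  have hm: "h \<in> borel_measurable borel"
    unfolding h_def using C(1) borel_measurable_continuous_on_restrict[OF g(1)[folded C_def]]
    by (subst measurable_If_restrict_space_iff) auto
  then have hm' [measurable]: "h \<in> borel_measurable N" by simp
  define \<nu> where "\<nu> = distr N borel h"
  have S_borel: "S \<in> sets borel" using compact_imp_closed[OF S] by simp
  show ?thesis
  proof (rule that[OF r(1)])
    show "\<nu> \<in> borel_prob" unfolding borel_prob_def \<nu>_def using N.prob_space_distr[OF hm'] by simp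
    show "AE x in \<nu>. x \<in> S" unfolding \<nu>_def using hS S_borel by (subst AE_distr_iff) auto
    fix f :: "'a \<Rightarrow> real" assume f: "continuous_on UNIV f"
    obtain B where B: "\<And>x. x \<in> S \<Longrightarrow> \<bar>f x\<bar> \<le> B"
      using compact_continuous_bound[OF S continuous_on_subset[OF f]] by auto
    have "B \<ge> 0" using B[OF \<open>x0 \<in> S\<close>] by linarith
    \<comment> \<open>\<open>g\<close> is continuous on \<open>C\<close> only, while weak
      convergence wants a bounded continuous function on the whole line; Tietze's theorem provides
      one.\<close>
    have "continuous_on C (\<lambda>t. f (g t))" using continuous_on_compose2[OF f g(1)] by (simp add: C_def)
    then obtain \<phi> where \<phi>: "continuous_on UNIV \<phi>" "\<And>t. t \<in> C \<Longrightarrow> \<phi> t = f (g t)" "\<And>t. t \<in> UNIV \<Longrightarrow> norm (\<phi> t) \<le> B"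
    proof (rule Tietze[of C "\<lambda>t. f (g t)" UNIV B])
      show "norm (f (g t)) \<le> B" if "t \<in> C" for t
        using B g(3) that unfolding C_def by (simp add: image_subset_iff)
    qed (use C(1) \<open>B \<ge> 0\<close> in auto)
    have fm: "f \<in> borel_measurable borel" using f by (rule borel_measurable_continuous_onI)
    have "(\<integral>x. \<phi> (s x) \<partial>\<mu> (r n)) = (\<integral>x. f x \<partial>\<mu> (r n))" for n
    proof (rule integral_cong_AE)
      show "AE x in \<mu> (r n). \<phi> (s x) = f x"
        using \<mu>(2)[of "r n"] by eventually_elim (use \<phi>(2) g(2) closure_subset[of "s ` S"] in \<open>force simp: C_def\<close>)
      show "(\<lambda>x. \<phi> (s x)) \<in> borel_measurable (\<mu> (r n))"
        using measurable_compose[OF sm borel_measurable_continuous_onI[OF \<phi>(1)]] .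
      show "f \<in> borel_measurable (\<mu> (r n))" using fm borel_probD(2)[OF \<mu>(1)] by (simp cong: measurable_cong_sets)
    qed
    moreover have "(\<integral>t. \<phi> t \<partial>N) = (\<integral>x. f x \<partial>\<nu>)"
    proof -
      have "(\<integral>x. f x \<partial>\<nu>) = (\<integral>t. f (h t) \<partial>N)" unfolding \<nu>_def by (rule integral_distr[OF hm' fm])
      also have "\<dots> = (\<integral>t. \<phi> t \<partial>N)"
      proof (rule integral_cong_AE)
        show "AE t in N. f (h t) = \<phi> t" using \<open>AE t in N. t \<in> C\<close> by eventually_elim (simp add: h_def \<phi>(2))
        show "(\<lambda>t. f (h t)) \<in> borel_measurable N" using measurable_compose[OF hm' fm] .
        show "\<phi> \<in> borel_measurable N" using borel_measurable_continuous_onI[OF \<phi>(1)] by simp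
      qed
      finally show ?thesis by simp
    qed
    ultimately show "(\<lambda>n. \<integral>x. f x \<partial>\<mu> (r n)) \<longlonglongrightarrow> (\<integral>x. f x \<partial>\<nu>)"
      using conv[OF \<phi>(1), of B] \<phi>(3) by simp
  qed
qed

text \<open>A basic open set missed by infinitely many \<open>A n\<close> is null for \<nu>: the
  truncated distance to its complement has integral 0 for infinitely many \<open>\<mu> n\<close>,
  hence in the limit. Outside the countable union of such sets every basic neighbourhood eventually
  meets \<open>A n\<close>.\<close>

lemma AE_limit_of_full_sets:
  fixes \<mu> :: "nat \<Rightarrow> 'a::{second_countable_topology, metric_space} measure"
  assumes \<mu>: "\<And>n. \<mu> n \<in> borel_prob" and \<nu>: "\<nu> \<in> borel_prob" and A: "\<And>n. AE x in \<mu> n. x \<in> A n"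
    and conv: "\<And>f :: 'a \<Rightarrow> real. continuous_on UNIV f \<Longrightarrow> (\<And>x. \<bar>f x\<bar> \<le> 1) \<Longrightarrow> (\<lambda>n. \<integral>x. f x \<partial>\<mu> n) \<longlonglongrightarrow> (\<integral>x. f x \<partial>\<nu>)"
  shows "AE z in \<nu>. \<forall>e>0. \<forall>\<^sub>F n in sequentially. \<exists>z'\<in>A n. dist z z' < e"
proof -
  obtain \<B> :: "'a set set" where \<B>: "countable \<B>" "topological_basis \<B>" using ex_countable_basis by blast
  have "AE z in \<nu>. z \<notin> U" if U: "U \<in> \<B>" "\<not> (\<forall>\<^sub>F n in sequentially. A n \<inter> U \<noteq> {})" for U
  proof (cases "U = UNIV")
    \<comment> \<open>The distance to an empty complement carries no information; here the sets
      \<open>A n\<close> are nonempty because each carries a probability measure.\<close>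
    case True
    have "A n \<noteq> {}" for n
    proof
      assume "A n = {}"
      then have "AE x in \<mu> n. False" using A[of n] by simp
      then show False using prob_space.AE_False[OF borel_probD(1)[OF \<mu>]] by blast
    qed
    then show ?thesis using U(2) True by simp
  next
    case False
    have oU: "closed (- U)" "- U \<noteq> {}" using topological_basis_open[OF \<B>(2) U(1)] False by auto
    define f where "f x = min 1 (infdist x (- U))" for x
    have "(\<lambda>n. \<integral>x. f x \<partial>\<mu> n) \<longlonglongrightarrow> (\<integral>x. f x \<partial>\<nu>)"
      unfolding f_def by (intro conv continuous_intros abs_min_1_infdist)
    moreover have "\<exists>\<^sub>F n in sequentially. (\<integral>x. f x \<partial>\<mu> n) = 0"
    proof -
      have "\<exists>\<^sub>F n in sequentially. A n \<inter> U = {}" using U(2) by (simp add: frequently_def)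
      then show ?thesis
      proof (rule frequently_mono[rotated], intro allI impI)
        fix n assume "A n \<inter> U = {}"
        then show "(\<integral>x. f x \<partial>\<mu> n) = 0" unfolding f_def
          using borel_prob_integral_0_AE_in_closed[OF \<mu> oU, of "\<lambda>x. x"] A[of n] by auto
      qed
    qed
    ultimately have "(\<integral>x. f x \<partial>\<nu>) = 0"
      using tendsto_imp_eventually_ne[of "\<lambda>n. \<integral>x. f x \<partial>\<mu> n" "\<integral>x. f x \<partial>\<nu>" sequentially 0] unfolding frequently_def by blast
    then show ?thesis using borel_prob_integral_0_AE_in_closed[OF \<nu> oU, of "\<lambda>x. x"] unfolding f_def by simp
  qed
  then have "AE z in \<nu>. \<forall>U\<in>\<B>. \<not> (\<forall>\<^sub>F n in sequentially. A n \<inter> U \<noteq> {}) \<longrightarrow> z \<notin> U"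
    using \<B>(1) by (simp add: AE_ball_countable)
  then show ?thesis
  proof eventually_elim
    case (elim z)
    show ?case
    proof (intro allI impI)
      fix e :: real assume "e > 0"
      then obtain U where U: "U \<in> \<B>" "z \<in> U" "U \<subseteq> ball z e" using topological_basisE[OF \<B>(2), of "ball z e" z] by auto
      then have "\<forall>\<^sub>F n in sequentially. A n \<inter> U \<noteq> {}" using elim by blast
      then show "\<forall>\<^sub>F n in sequentially. \<exists>z'\<in>A n. dist z z' < e"
        by eventually_elim (use U(3) in force)
    qed
  qed
qed

lemma limitin_weak_star:
  fixes m :: "nat \<Rightarrow> 'n::finite torus measure"
  assumes "\<And>n. m n \<in> borel_prob" "m0 \<in> borel_prob"
    and conv: "\<And>\<phi> :: 'n torus \<Rightarrow> real. continuous_on UNIV \<phi> \<Longrightarrow> (\<lambda>n. \<integral>x. \<phi> x \<partial>m n) \<longlonglongrightarrow> (\<integral>x. \<phi> x \<partial>m0)"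
  shows "limitin weak_star m m0 sequentially"
  unfolding limitin_def topspace_weak_star
proof (intro conjI allI impI assms(2))
  fix U assume "openin weak_star U \<and> m0 \<in> U"
  then have "generate_topology_on {{m \<in> borel_prob. (\<integral>x. \<phi> x \<partial>m) \<in> U} | \<phi> U. continuous_on UNIV \<phi> \<and> open (U :: real set)} U" "m0 \<in> U"
    unfolding weak_star_def openin_topology_generated_by_iff by auto
  then show "\<forall>\<^sub>F n in sequentially. m n \<in> U"
  proof (induction rule: generate_topology_on.induct)
    case (Int a b)
    then show ?case by (simp add: eventually_conj_iff)
  next
    case (UN K)
    then obtain k where "k \<in> K" "m0 \<in> k" by blast
    then have "\<forall>\<^sub>F n in sequentially. m n \<in> k" using UN by blast
    then show ?case by eventually_elim (use \<open>k \<in> K\<close> in blast)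
  next
    case (Basis s)
    obtain \<phi> and V :: "real set" where s: "s = {m \<in> borel_prob. (\<integral>x. \<phi> x \<partial>m) \<in> V}" "continuous_on UNIV \<phi>" "open V"
      using Basis(1) by (elim CollectE exE conjE) (rule that)
    have "(\<integral>x. \<phi> x \<partial>m0) \<in> V" using Basis(2) unfolding s(1) by simp
    then have "\<forall>\<^sub>F n in sequentially. (\<integral>x. \<phi> x \<partial>m n) \<in> V"
      by (rule topological_tendstoD[OF conv[OF s(2)] s(3)])
    then show ?case by eventually_elim (use assms(1) s(1) in auto)
  qed simp
qed

text \<open>The convex combination of the measures \<open>\<mu> i\<close>, \<open>i < n\<close>,
  with weights \<open>t i\<close>, obtained by drawing an index first. It has this meaning when the
  weights are nonnegative with sum 1.\<close>

definition mixture :: "nat \<Rightarrow> (nat \<Rightarrow> real) \<Rightarrow> (nat \<Rightarrow> 'a measure) \<Rightarrow> 'a measure" where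
  "mixture n t \<mu> = measure_pmf (embed_pmf (\<lambda>i. if i < n then t i else 0)) \<bind> \<mu>"

context
  fixes n :: nat and t :: "nat \<Rightarrow> real" and \<mu> :: "nat \<Rightarrow> 'a::topological_space measure"
  assumes t: "\<And>i. i < n \<Longrightarrow> 0 \<le> t i" "(\<Sum>i<n. t i) = 1" and \<mu>: "\<And>i. \<mu> i \<in> borel_prob"
begin

lemma pmf_mixture: "pmf (embed_pmf (\<lambda>i. if i < n then t i else 0)) i = (if i < n then t i else 0)"
proof (rule pmf_embed_pmf)
  have "(\<integral>\<^sup>+ i. ennreal (if i < n then t i else 0) \<partial>count_space UNIV) = (\<integral>\<^sup>+ i. ennreal (t i) \<partial>count_space {..<n})"
    by (subst nn_integral_count_space_indicator) (auto intro!: nn_integral_cong split: split_indicator)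
  also have "\<dots> = ennreal (\<Sum>i<n. t i)" using t(1)
    by (subst nn_integral_count_space_finite, simp, subst sum_ennreal) auto
  finally show "(\<integral>\<^sup>+ i. ennreal (if i < n then t i else 0) \<partial>count_space UNIV) = 1" using t(2) by simp
qed (use t(1) in auto)

lemma mixture_kernel: "\<mu> \<in> measurable (measure_pmf p) (subprob_algebra borel)"
  using borel_probD[OF \<mu>] by (auto simp: measurable_def space_subprob_algebra intro!: prob_space_imp_subprob_space)

lemma mixture_borel_prob: "mixture n t \<mu> \<in> borel_prob"
proof -
  have "prob_space (mixture n t \<mu>)" unfolding mixture_def
    using borel_probD(1)[OF \<mu>] by (intro prob_space.prob_space_bind[OF measure_pmf.prob_space_axioms _ mixture_kernel]) auto
  moreover have "sets (mixture n t \<mu>) = sets borel" unfolding mixture_def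
    by (rule sets_bind) (use borel_probD(2)[OF \<mu>] in auto)
  ultimately show ?thesis unfolding borel_prob_def by simp
qed

lemma integral_mixture:
  assumes "f \<in> borel_measurable borel" "\<And>x. \<bar>f x\<bar> \<le> B"
  shows "(\<integral>x. f x \<partial>mixture n t \<mu>) = (\<Sum>i<n. t i * (\<integral>x. f x \<partial>\<mu> i))"
proof -
  have "(\<integral>x. f x \<partial>mixture n t \<mu>) = (\<integral>i. (\<integral>x. f x \<partial>\<mu> i) \<partial>measure_pmf (embed_pmf (\<lambda>i. if i < n then t i else 0)))"
    unfolding mixture_def
  proof (rule integral_bind[OF assms(1) _ mixture_kernel, of B _ 1])
    show "AE i in measure_pmf (embed_pmf (\<lambda>i. if i < n then t i else 0)). emeasure (\<mu> i) (space (\<mu> i)) \<le> ennreal 1"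
      using prob_space.emeasure_space_1[OF borel_probD(1)[OF \<mu>]] by simp
  qed (use assms(2) measure_pmf.finite_measure_axioms in auto)
  also have "\<dots> = (\<Sum>i<n. (\<integral>x. f x \<partial>\<mu> i) * pmf (embed_pmf (\<lambda>i. if i < n then t i else 0)) i)"
    by (rule integral_measure_pmf_real) (auto simp: set_pmf_eq pmf_mixture split: if_splits)
  finally show ?thesis by (simp add: pmf_mixture mult.commute)
qed

lemma AE_mixture:
  assumes "A \<in> sets borel" "\<And>i. AE x in \<mu> i. x \<in> A"
  shows "AE x in mixture n t \<mu>. x \<in> A"
  unfolding mixture_def using assms by (subst AE_bind[OF mixture_kernel]) (auto simp: pred_def)

end

section \<open>Brouwer's theorem on cubes and simplices of variable dimension\<close>

text \<open>[0,1]^n inside the sequences vanishing from index \<open>n\<close> on. The dimension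
  will be the size of a net that depends on the accuracy, so it has to be a number and not a
  type.\<close>

definition unit_cube :: "nat \<Rightarrow> (nat \<Rightarrow> real) set" where
  "unit_cube n = {x. (\<forall>i<n. 0 \<le> x i \<and> x i \<le> 1) \<and> (\<forall>i\<ge>n. x i = 0)}"

lemma unit_cube_seq_compact:
  assumes "\<And>k. X k \<in> unit_cube n"
  obtains r x where "strict_mono (r :: nat \<Rightarrow> nat)" "x \<in> unit_cube n" "\<And>i. (\<lambda>k. X (r k) i) \<longlonglongrightarrow> x i"
proof -
  have "\<exists>r. strict_mono (r :: nat \<Rightarrow> nat) \<and> (\<forall>i<j. convergent (\<lambda>k. X (r k) i))" if "j \<le> n" for j
    using that
  proof (induction j)
    case 0
    show ?case using strict_mono_id by blast
  next
    case (Suc j)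
    then obtain r where r: "strict_mono r" "\<And>i. i < j \<Longrightarrow> convergent (\<lambda>k. X (r k) i)" by auto
    have "X (r k) j \<in> {0..1}" for k using assms[of "r k"] Suc.prems unfolding unit_cube_def by auto
    then obtain l s where s: "strict_mono s" "(\<lambda>k. X (r (s k)) j) \<longlonglongrightarrow> l"
      using compact_subsequence[OF compact_Icc, of "\<lambda>k. X (r k) j" 0 1] by metis
    have "convergent (\<lambda>k. X (r (s k)) i)" if "i < Suc j" for i
    proof (cases "i = j")
      case True
      then show ?thesis using s(2) convergentI by blast
    next
      case False
      then show ?thesis using convergent_subseq_convergent[OF r(2)[of i] s(1)] that by (simp add: o_def)
    qed
    moreover have "strict_mono (r \<circ> s)" using strict_mono_o[OF r(1) s(1)] .
    ultimately show ?case unfolding o_def by blast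
  qed
  from this[of n] obtain r where r: "strict_mono r" "\<And>i. i < n \<Longrightarrow> convergent (\<lambda>k. X (r k) i)" by auto
  define x where "x i = (if i < n then lim (\<lambda>k. X (r k) i) else 0)" for i
  have lim: "(\<lambda>k. X (r k) i) \<longlonglongrightarrow> x i" for i
  proof (cases "i < n")
    case True
    then show ?thesis using r(2)[OF True] by (simp add: x_def convergent_LIMSEQ_iff)
  next
    case False
    then show ?thesis using assms unfolding unit_cube_def by (simp add: x_def)
  qed
  have "x \<in> unit_cube n"
  proof -
    have "0 \<le> x i \<and> x i \<le> 1" if "i < n" for i
      using LIMSEQ_le_const[OF lim[of i], of 0] LIMSEQ_le_const2[OF lim[of i], of 1] assms that unfolding unit_cube_def by auto
    then show ?thesis unfolding unit_cube_def by (auto simp: x_def)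
  qed
  then show ?thesis using that r(1) lim by blast
qed

text \<open>On a grid of mesh \<open>1 / (p + 1)\<close> Kuhn's combinatorial lemma gives, for each
  coordinate, two vertices of one cell where \<open>f\<close> moves that coordinate up and down
  respectively. In the limit the vertices merge and the two inequalities become an equality.
  Continuity is stated along coordinatewise convergent sequences, as the cube lives in a function
  space.\<close>

lemma brouwer_unit_cube:
  fixes f :: "(nat \<Rightarrow> real) \<Rightarrow> nat \<Rightarrow> real"
  assumes range: "\<And>x i. x \<in> unit_cube n \<Longrightarrow> i < n \<Longrightarrow> 0 \<le> f x i \<and> f x i \<le> 1"
    and cont: "\<And>X x i. (\<And>k. X k \<in> unit_cube n) \<Longrightarrow> x \<in> unit_cube n \<Longrightarrow> (\<And>j. (\<lambda>k. X k j) \<longlonglongrightarrow> x j) \<Longrightarrow> i < n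
      \<Longrightarrow> (\<lambda>k. f (X k) i) \<longlonglongrightarrow> f x i"
  obtains x where "x \<in> unit_cube n" "\<And>i. i < n \<Longrightarrow> f x i = x i"
proof -
  define pt where "pt p q = (\<lambda>i. if i < n then min 1 (real (q i) / real (Suc p)) else 0)" for p and q :: "nat \<Rightarrow> nat"
  have pt: "pt p q \<in> unit_cube n" for p q unfolding pt_def unit_cube_def by auto
  \<comment> \<open>The labels on the faces are forced, as Kuhn's lemma demands; they agree with the
    sign rule because \<open>f\<close> maps into the cube.\<close>
  define label where "label p q i = (if q i = 0 then 0 else if q i = Suc p then 1 else if pt p q i \<le> f (pt p q) i then 0 else (1 :: nat))"
    for p and q :: "nat \<Rightarrow> nat" and i
  have label0: "pt p q i \<le> f (pt p q) i" if "label p q i = 0" "i < n" for p q i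
    using that range[OF pt[of p q], of i] unfolding label_def by (auto simp: pt_def split: if_splits)
  have label1: "f (pt p q) i \<le> pt p q i" if "label p q i = 1" "i < n" for p q i
    using that range[OF pt[of p q], of i] unfolding label_def by (auto simp: pt_def split: if_splits)
  have "\<exists>q a b. (\<forall>i<n. pt p (a i) i \<le> f (pt p (a i)) i \<and> f (pt p (b i)) i \<le> pt p (b i) i) \<and>
    (\<forall>i<n. \<forall>j. \<bar>pt p (a i) j - pt p q j\<bar> \<le> inverse (real (Suc p)) \<and> \<bar>pt p (b i) j - pt p q j\<bar> \<le> inverse (real (Suc p)))" for p
  proof -
    obtain q where q: "\<forall>i<n. q i < Suc p" "\<forall>i<n. \<exists>r s. (\<forall>j<n. q j \<le> r j \<and> r j \<le> q j + 1) \<and> (\<forall>j<n. q j \<le> s j \<and> s j \<le> q j + 1) \<and> label p r i \<noteq> label p s i"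
      by (rule kuhn_lemma[of "Suc p" n "label p"]) (auto simp: label_def)
    have near: "\<bar>pt p r j - pt p q j\<bar> \<le> inverse (real (Suc p))" if "\<forall>j<n. q j \<le> r j \<and> r j \<le> q j + 1" for r j
    proof (cases "j < n")
      case True
      then have "q j < Suc p" "r j = q j \<or> r j = q j + 1" using q(1) that by (auto simp: le_Suc_eq)
      then have "r j = q j \<or> r j = q j + 1" "real (r j) / real (Suc p) \<le> 1" "real (q j) / real (Suc p) \<le> 1"
        by (auto simp: divide_le_eq_1)
      then have "\<bar>pt p r j - pt p q j\<bar> = \<bar>real (r j) / real (Suc p) - real (q j) / real (Suc p)\<bar>" "real (r j) - real (q j) \<in> {0, 1}"
        using True by (auto simp: pt_def)
      then show ?thesis by (auto simp: diff_divide_distrib[symmetric] inverse_eq_divide)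
    qed (simp add: pt_def)
    have "\<exists>a b. (pt p a i \<le> f (pt p a) i \<and> f (pt p b) i \<le> pt p b i) \<and>
      (\<forall>j. \<bar>pt p a j - pt p q j\<bar> \<le> inverse (real (Suc p)) \<and> \<bar>pt p b j - pt p q j\<bar> \<le> inverse (real (Suc p)))" if "i < n" for i
    proof -
      obtain r s where rs: "\<forall>j<n. q j \<le> r j \<and> r j \<le> q j + 1" "\<forall>j<n. q j \<le> s j \<and> s j \<le> q j + 1" "label p r i \<noteq> label p s i"
        using q(2) \<open>i < n\<close> by blast
      have "label p r i = 0 \<and> label p s i = 1 \<or> label p r i = 1 \<and> label p s i = 0"
        using rs(3) unfolding label_def by (auto split: if_splits)
      then show ?thesis using near[OF rs(1)] near[OF rs(2)] label0 label1 \<open>i < n\<close> by metis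
    qed
    then show ?thesis by metis
  qed
  then obtain q a b where qab: "\<And>p i. i < n \<Longrightarrow> pt p (a p i) i \<le> f (pt p (a p i)) i" "\<And>p i. i < n \<Longrightarrow> f (pt p (b p i)) i \<le> pt p (b p i) i"
    "\<And>p i j. i < n \<Longrightarrow> \<bar>pt p (a p i) j - pt p (q p) j\<bar> \<le> inverse (real (Suc p))"
    "\<And>p i j. i < n \<Longrightarrow> \<bar>pt p (b p i) j - pt p (q p) j\<bar> \<le> inverse (real (Suc p))" by metis
  obtain r x where r: "strict_mono r" "x \<in> unit_cube n" "\<And>i. (\<lambda>k. pt (r k) (q (r k)) i) \<longlonglongrightarrow> x i"
    by (rule unit_cube_seq_compact[of "\<lambda>p. pt p (q p)"]) (use pt in blast)+
  have inv: "(\<lambda>k. inverse (real (Suc (r k)))) \<longlonglongrightarrow> 0"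
    using LIMSEQ_subseq_LIMSEQ[OF LIMSEQ_inverse_real_of_nat r(1)] by (simp add: o_def)
  have lims: "(\<lambda>k. pt (r k) (c k) j) \<longlonglongrightarrow> x j" if c: "\<And>k. \<bar>pt (r k) (c k) j - pt (r k) (q (r k)) j\<bar> \<le> inverse (real (Suc (r k)))" for c j
  proof -
    have "(\<lambda>k. pt (r k) (c k) j - pt (r k) (q (r k)) j) \<longlonglongrightarrow> 0"
      using c by (intro Lim_null_comparison[OF _ inv]) auto
    from tendsto_add[OF this r(3)[of j]] show ?thesis by simp
  qed
  show ?thesis
  proof (rule that[OF r(2)])
    fix i assume i: "i < n"
    have la: "(\<lambda>k. pt (r k) (a (r k) i) j) \<longlonglongrightarrow> x j" for j by (rule lims) (rule qab(3)[OF i])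
    have lb: "(\<lambda>k. pt (r k) (b (r k) i) j) \<longlonglongrightarrow> x j" for j by (rule lims) (rule qab(4)[OF i])
    have "x i \<le> f x i"
      by (rule LIMSEQ_le[OF la[of i] cont[OF pt r(2) la i]]) (use qab(1)[OF i] in blast)
    moreover have "f x i \<le> x i"
      by (rule LIMSEQ_le[OF cont[OF pt r(2) lb i] lb[of i]]) (use qab(2)[OF i] in blast)
    ultimately show "f x i = x i" by simp
  qed
qed

text \<open>Brouwer's theorem is applied to \<open>g\<close> after a retraction of the cube onto the
  simplex. A fixed point lies in the simplex because \<open>g\<close> takes values there, and on the
  simplex the retraction is the identity.\<close>

lemma brouwer_simplex:
  fixes g :: "(nat \<Rightarrow> real) \<Rightarrow> nat \<Rightarrow> real" and n :: nat
  defines "\<Delta> \<equiv> {t \<in> unit_cube n. (\<Sum>i<n. t i) = 1}"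
  assumes n: "n > 0" and range: "\<And>t i. t \<in> \<Delta> \<Longrightarrow> i < n \<Longrightarrow> 0 \<le> g t i" "\<And>t. t \<in> \<Delta> \<Longrightarrow> (\<Sum>i<n. g t i) = 1"
    and cont: "\<And>T t i. (\<And>k. T k \<in> \<Delta>) \<Longrightarrow> t \<in> \<Delta> \<Longrightarrow> (\<And>j. (\<lambda>k. T k j) \<longlonglongrightarrow> t j) \<Longrightarrow> i < n
      \<Longrightarrow> (\<lambda>k. g (T k) i) \<longlonglongrightarrow> g t i"
  obtains t where "t \<in> \<Delta>" "\<And>i. i < n \<Longrightarrow> g t i = t i"
proof -
  \<comment> \<open>A total above 1 is divided out, a deficit below 1 is spread equally over the
    coordinates. Both corrections are trivial for total 1, and the denominator is at least
    1.\<close>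
  define \<rho> where "\<rho> x = (\<lambda>i. if i < n then (x i + max 0 (1 - (\<Sum>j<n. x j)) / real n) / max 1 (\<Sum>j<n. x j) else 0)" for x :: "nat \<Rightarrow> real"
  have \<rho>: "\<rho> x \<in> \<Delta>" if x: "x \<in> unit_cube n" for x
  proof -
    have xi: "0 \<le> x i" if "i < n" for i using x that unfolding unit_cube_def by blast
    have nn: "0 \<le> \<rho> x i" for i using xi by (auto simp: \<rho>_def)
    have "(\<Sum>i<n. \<rho> x i) = (\<Sum>i<n. (x i + max 0 (1 - (\<Sum>j<n. x j)) / real n)) / max 1 (\<Sum>j<n. x j)"
      unfolding sum_divide_distrib \<rho>_def by simp
    also have "(\<Sum>i<n. (x i + max 0 (1 - (\<Sum>j<n. x j)) / real n)) = max 1 (\<Sum>j<n. x j)"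
      using n by (simp add: sum.distrib max_def)
    finally have sum1: "(\<Sum>i<n. \<rho> x i) = 1" by simp
    moreover have "\<rho> x i \<le> 1" if "i < n" for i
      using member_le_sum[of i "{..<n}" "\<rho> x"] that nn sum1 by auto
    moreover have "\<rho> x i = 0" if "i \<ge> n" for i using that by (simp add: \<rho>_def)
    ultimately show ?thesis unfolding \<Delta>_def unit_cube_def using nn by auto
  qed
  have gle: "g t i \<le> 1" if "t \<in> \<Delta>" "i < n" for t i
    using member_le_sum[of i "{..<n}" "g t"] that range by auto
  obtain x where x: "x \<in> unit_cube n" "\<And>i. i < n \<Longrightarrow> g (\<rho> x) i = x i"
  proof (rule brouwer_unit_cube[of n "\<lambda>x. g (\<rho> x)"])
    show "0 \<le> g (\<rho> x) i \<and> g (\<rho> x) i \<le> 1" if "x \<in> unit_cube n" "i < n" for x i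
      using range(1)[OF \<rho>] gle[OF \<rho>] that by blast
    fix X x i assume X: "\<And>k. X k \<in> unit_cube n" "x \<in> unit_cube n" "\<And>j. (\<lambda>k. X k j) \<longlonglongrightarrow> x j" "i < n"
    have "(\<lambda>k. \<rho> (X k) j) \<longlonglongrightarrow> \<rho> x j" for j
    proof (cases "j < n")
      case True
      then show ?thesis unfolding \<rho>_def by (auto intro!: tendsto_intros X(3))
    qed (simp add: \<rho>_def)
    then show "(\<lambda>k. g (\<rho> (X k)) i) \<longlonglongrightarrow> g (\<rho> x) i" by (intro cont \<rho> X)
  qed blast
  have "(\<Sum>i<n. x i) = 1" using range(2)[OF \<rho>[OF x(1)]] x(2) by simp
  then have "x \<in> \<Delta>" using x(1) unfolding \<Delta>_def by simp
  moreover have "\<rho> x = x" using \<open>(\<Sum>i<n. x i) = 1\<close> x(1) unfolding \<rho>_def unit_cube_def by (auto simp: fun_eq_iff)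
  ultimately show ?thesis using that x(2) by metis
qed

section \<open>Discrete equilibria\<close>

text \<open>The integrand may be unbounded, but all measures are carried by \<open>S\<close>; a
  bounded continuous extension from \<open>S\<close> reduces the claim to
  \<open>integral_mixture\<close>.\<close>

lemma integral_mixture_compact:
  fixes \<mu> :: "nat \<Rightarrow> 'a::{metric_space, second_countable_topology} measure" and f :: "'a \<Rightarrow> real"
  assumes t: "\<And>i. i < n \<Longrightarrow> 0 \<le> t i" "(\<Sum>i<n. t i) = 1" and \<mu>: "\<And>i. \<mu> i \<in> borel_prob"
    and S: "compact S" "\<And>i. AE x in \<mu> i. x \<in> S" and f: "continuous_on UNIV f"
  shows "(\<integral>x. f x \<partial>mixture n t \<mu>) = (\<Sum>i<n. t i * (\<integral>x. f x \<partial>\<mu> i))"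
proof -
  obtain B where B: "\<And>x. x \<in> S \<Longrightarrow> \<bar>f x\<bar> \<le> B"
    using compact_continuous_bound[OF S(1) continuous_on_subset[OF f]] by auto
  obtain \<phi> where \<phi>: "continuous_on UNIV \<phi>" "\<And>x. x \<in> S \<Longrightarrow> \<phi> x = f x" "\<And>x. x \<in> UNIV \<Longrightarrow> norm (\<phi> x) \<le> \<bar>B\<bar>"
  proof (rule Tietze[of S f UNIV "\<bar>B\<bar>"])
    show "norm (f x) \<le> \<bar>B\<bar>" if "x \<in> S" for x using B[OF that] by simp
  qed (use compact_imp_closed[OF S(1)] continuous_on_subset[OF f] in auto)
  have eq: "(\<integral>x. f x \<partial>m) = (\<integral>x. \<phi> x \<partial>m)" if m: "m \<in> borel_prob" "AE x in m. x \<in> S" for m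
  proof (rule integral_cong_AE)
    show "f \<in> borel_measurable m" "\<phi> \<in> borel_measurable m"
      using borel_measurable_continuous_onI[OF f] borel_measurable_continuous_onI[OF \<phi>(1)] borel_probD(2)[OF m(1)]
      by (simp_all cong: measurable_cong_sets)
    show "AE x in m. f x = \<phi> x" using m(2) by eventually_elim (simp add: \<phi>(2))
  qed
  have "(\<integral>x. f x \<partial>mixture n t \<mu>) = (\<integral>x. \<phi> x \<partial>mixture n t \<mu>)"
    using compact_imp_closed[OF S(1)] S(2) by (intro eq mixture_borel_prob AE_mixture t \<mu>) auto
  also have "\<dots> = (\<Sum>i<n. t i * (\<integral>x. \<phi> x \<partial>\<mu> i))"
    using \<phi>(3) by (intro integral_mixture[of _ _ _ _ "\<bar>B\<bar>"] t \<mu> borel_measurable_continuous_onI \<phi>(1)) auto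
  also have "\<dots> = (\<Sum>i<n. t i * (\<integral>x. f x \<partial>\<mu> i))" using eq[OF \<mu> S(2)] by simp
  finally show ?thesis .
qed

lemma borel_prob_integrable_compact:
  fixes f :: "'a::metric_space \<Rightarrow> real"
  assumes "m \<in> borel_prob" "compact S" "AE x in m. x \<in> S" "continuous_on UNIV f"
  shows "integrable m f"
proof -
  obtain B where B: "\<And>x. x \<in> S \<Longrightarrow> \<bar>f x\<bar> \<le> B"
    using compact_continuous_bound[OF assms(2) continuous_on_subset[OF assms(4)]] by auto
  have "AE x in m. \<bar>f x\<bar> \<le> B" using assms(3) by eventually_elim (rule B)
  then show ?thesis by (intro borel_prob_integrable[OF assms(1)] borel_measurable_continuous_onI assms(4))
qed

lemma return_borel_prob: "return borel x \<in> borel_prob"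
  unfolding borel_prob_def by (simp add: prob_space_return)

lemma continuous_on_fst_snd_comp:
  assumes "continuous_on UNIV (\<phi> :: 'a::topological_space \<Rightarrow> 'c::topological_space)"
  shows "continuous_on UNIV (\<lambda>z :: 'a \<times> 'b::topological_space. \<phi> (fst z))"
  by (rule continuous_on_compose2[OF assms]) (auto intro: continuous_intros)

lemma distr_fst_borel_prob:
  fixes \<eta> :: "('a::second_countable_topology \<times> 'b::second_countable_topology) measure" and \<phi> :: "'a \<Rightarrow> real"
  assumes "\<eta> \<in> borel_prob"
  shows "distr \<eta> borel fst \<in> borel_prob"
    "\<phi> \<in> borel_measurable borel \<Longrightarrow> (\<integral>x. \<phi> x \<partial>distr \<eta> borel fst) = (\<integral>z. \<phi> (fst z) \<partial>\<eta>)"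
proof -
  have fst_meas [measurable]: "fst \<in> measurable \<eta> borel"
    using borel_probD(2)[OF assms] measurable_fst[of borel borel] by (simp add: borel_prod[symmetric] cong: measurable_cong_sets)
  show "distr \<eta> borel fst \<in> borel_prob"
    unfolding borel_prob_def using prob_space.prob_space_distr[OF borel_probD(1)[OF assms] fst_meas] by simp
  show "\<phi> \<in> borel_measurable borel \<Longrightarrow> (\<integral>x. \<phi> x \<partial>distr \<eta> borel fst) = (\<integral>z. \<phi> (fst z) \<partial>\<eta>)"
    by (rule integral_distr) auto
qed

section \<open>The Lagrangians L_m and bounds uniform in the measure\<close>

locale mfg = tonelli_hamiltonian H for H :: "'n::finite torus \<Rightarrow> real ^ 'n \<Rightarrow> real" +
  fixes F :: "'n torus \<Rightarrow> 'n torus measure \<Rightarrow> real"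
  assumes F1: "F1 F" and F2: "F2 F"
begin

abbreviation lm :: "'n torus measure \<Rightarrow> 'n torus \<Rightarrow> real ^ 'n \<Rightarrow> real" where "lm \<equiv> mfg_lagrangian H F"

lemma F_bounds: "\<exists>B\<ge>0. \<forall>m\<in>borel_prob. \<forall>x y. \<bar>F x m\<bar> \<le> B \<and> \<bar>F x m - F y m\<bar> \<le> B * dist x y"
proof -
  obtain B where B: "B > 0" "\<And>m x. m \<in> borel_prob \<Longrightarrow> \<bar>F x m\<bar> \<le> B \<and> norm (torus_gradient (\<lambda>y. F y m) x) \<le> B"
    using F1 unfolding F1_def by blast
  have "\<bar>F x m - F y m\<bar> \<le> B * dist x y" if m: "m \<in> borel_prob" for m x y
  proof -
    obtain v where v: "torus_shift y v = x" "norm v = dist y x" using torus_displacement by blast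
    have "torus_C_k (Suc 1) (\<lambda>x. F x m)" using F1 m unfolding F1_def by (simp add: numeral_2_eq_2)
    then obtain s where "F x m - F y m = torus_gradient (\<lambda>x. F x m) (torus_shift y (s *\<^sub>R v)) \<bullet> v"
      using torus_C_k_mvt[of 1 "\<lambda>x. F x m" y v] v(1) by auto
    then have "\<bar>F x m - F y m\<bar> \<le> norm (torus_gradient (\<lambda>x. F x m) (torus_shift y (s *\<^sub>R v))) * norm v"
      using Cauchy_Schwarz_ineq2 by simp
    also have "\<dots> \<le> B * norm v" using B(2)[OF m] by (intro mult_right_mono) auto
    finally show ?thesis using v(2) by (simp add: dist_commute)
  qed
  then show ?thesis using B by (intro exI[of _ B]) auto
qed

definition FB :: real where "FB = (SOME B. B \<ge> 0 \<and> (\<forall>m\<in>borel_prob. \<forall>x y. \<bar>F x m\<bar> \<le> B \<and> \<bar>F x m - F y m\<bar> \<le> B * dist x y))"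

lemma FB: "FB \<ge> 0" "m \<in> borel_prob \<Longrightarrow> \<bar>F x m\<bar> \<le> FB" "m \<in> borel_prob \<Longrightarrow> \<bar>F x m - F y m\<bar> \<le> FB * dist x y"
proof -
  have "FB \<ge> 0 \<and> (\<forall>m\<in>borel_prob. \<forall>x y. \<bar>F x m\<bar> \<le> FB \<and> \<bar>F x m - F y m\<bar> \<le> FB * dist x y)"
    unfolding FB_def by (rule someI_ex) (use F_bounds in blast)
  then show "FB \<ge> 0" "m \<in> borel_prob \<Longrightarrow> \<bar>F x m\<bar> \<le> FB" "m \<in> borel_prob \<Longrightarrow> \<bar>F x m - F y m\<bar> \<le> FB * dist x y" by auto
qed

lemma F_continuous: "m \<in> borel_prob \<Longrightarrow> continuous_on UNIV (\<lambda>x. F x m)"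
  by (rule lipschitz_on_continuous_on[of FB]) (auto intro!: lipschitz_onI FB simp: dist_real_def)

text \<open>If uniformity failed along a subsequence, the offending points would accumulate on the
  compact torus and contradict the joint continuity (F2) at the limiting pair.\<close>

lemma F_uniform_limit:
  assumes m: "\<And>n. m n \<in> borel_prob" "m0 \<in> borel_prob"
    and conv: "\<And>\<phi> :: 'n torus \<Rightarrow> real. continuous_on UNIV \<phi> \<Longrightarrow> (\<lambda>n. \<integral>x. \<phi> x \<partial>m n) \<longlonglongrightarrow> (\<integral>x. \<phi> x \<partial>m0)"
  shows "uniform_limit UNIV (\<lambda>n x. F x (m n)) (\<lambda>x. F x m0) sequentially"
proof (rule ccontr)
  assume "\<not> ?thesis"
  then obtain e where e: "e > 0" "\<exists>\<^sub>F n in sequentially. \<exists>x. \<not> dist (F x (m n)) (F x m0) < e"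
    unfolding uniform_limit_iff frequently_def by auto
  then obtain r where r: "strict_mono (r :: nat \<Rightarrow> nat)" "\<And>n. \<exists>x. \<not> dist (F x (m (r n))) (F x m0) < e"
    using infinite_enumerate[of "{n. \<exists>x. \<not> dist (F x (m n)) (F x m0) < e}"] unfolding cofinite_eq_sequentially[symmetric] frequently_cofinite by auto
  then obtain x where x: "\<And>n. \<not> dist (F (x n) (m (r n))) (F (x n) m0) < e" by metis
  obtain x0 s where s: "strict_mono s" "(x \<circ> s) \<longlonglongrightarrow> x0" using torus_seq_compact by blast
  have "limitin weak_star (\<lambda>n. m (r (s n))) m0 sequentially"
  proof (rule limitin_weak_star)
    show "(\<lambda>n. \<integral>x. \<phi> x \<partial>m (r (s n))) \<longlonglongrightarrow> (\<integral>x. \<phi> x \<partial>m0)" if "continuous_on UNIV \<phi>" for \<phi> :: "'n torus \<Rightarrow> real"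
      using LIMSEQ_subseq_LIMSEQ[OF conv[OF that] strict_mono_o[OF r(1) s(1)]] by (simp add: o_def)
  qed (use m in auto)
  then have "limitin (prod_topology euclidean weak_star) (\<lambda>n. (x (s n), m (r (s n)))) (x0, m0) sequentially"
    using s(2) by (simp add: limitin_pairwise o_def)
  then have "limitin euclidean ((\<lambda>(x, m). F x m) \<circ> (\<lambda>n. (x (s n), m (r (s n))))) ((\<lambda>(x, m). F x m) (x0, m0)) sequentially"
    using F2 unfolding F2_def by (intro continuous_map_limit) auto
  then have 1: "(\<lambda>n. F (x (s n)) (m (r (s n)))) \<longlonglongrightarrow> F x0 m0" by (simp add: o_def)
  have 2: "(\<lambda>n. F (x (s n)) m0) \<longlonglongrightarrow> F x0 m0"
    using continuous_on_tendsto_compose[OF F_continuous[OF m(2)] s(2)] by (simp add: o_def)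
  have "(\<lambda>n. dist (F (x (s n)) (m (r (s n)))) (F (x (s n)) m0)) \<longlonglongrightarrow> 0"
    using tendsto_dist[OF 1 2] by simp
  then have "\<forall>\<^sub>F n in sequentially. dist (F (x (s n)) (m (r (s n)))) (F (x (s n)) m0) < e"
    using e(1) by (rule order_tendstoD(2))
  then show False using x by (auto simp: eventually_sequentially)
qed

text \<open>Constants for L, corrected by the sup bound \<open>FB\<close> of F so that they serve
  every L_m at once. \<open>SOME\<close> fixes them before any measure is mentioned.\<close>

definition Cs :: "real \<Rightarrow> real" where "Cs K = (SOME C. \<forall>x v. L x v \<ge> K * norm v + C) - FB"
definition \<Lambda>L :: "real \<Rightarrow> real" where "\<Lambda>L r = (SOME C. C \<ge> 0 \<and>
  (\<forall>x v w. norm v \<le> r \<longrightarrow> norm w \<le> r \<longrightarrow> \<bar>L x v - L x w\<bar> \<le> C * norm (v - w)) \<and>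
  (\<forall>x y v. norm v \<le> r \<longrightarrow> \<bar>L x v - L y v\<bar> \<le> C * dist x y) \<and> (\<forall>x v. norm v \<le> r \<longrightarrow> norm (b x v) \<le> C))"
definition \<Lambda> :: "real \<Rightarrow> real" where "\<Lambda> r = \<Lambda>L r + FB"
definition M :: real where "M = (SOME M. \<forall>x v. norm v \<le> 1 \<longrightarrow> L x v \<le> M) + FB"

lemma \<Lambda>L: "\<Lambda>L r \<ge> 0" "norm v \<le> r \<Longrightarrow> norm w \<le> r \<Longrightarrow> \<bar>L x v - L x w\<bar> \<le> \<Lambda>L r * norm (v - w)"
  "norm v \<le> r \<Longrightarrow> \<bar>L x v - L y v\<bar> \<le> \<Lambda>L r * dist x y" "norm v \<le> r \<Longrightarrow> norm (b x v) \<le> \<Lambda>L r"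
proof -
  have "\<Lambda>L r \<ge> 0 \<and> (\<forall>x v w. norm v \<le> r \<longrightarrow> norm w \<le> r \<longrightarrow> \<bar>L x v - L x w\<bar> \<le> \<Lambda>L r * norm (v - w)) \<and>
    (\<forall>x y v. norm v \<le> r \<longrightarrow> \<bar>L x v - L y v\<bar> \<le> \<Lambda>L r * dist x y) \<and> (\<forall>x v. norm v \<le> r \<longrightarrow> norm (b x v) \<le> \<Lambda>L r)"
    unfolding \<Lambda>L_def by (rule someI_ex, rule L_lipschitz[of r]) blast
  then show "\<Lambda>L r \<ge> 0" "norm v \<le> r \<Longrightarrow> norm w \<le> r \<Longrightarrow> \<bar>L x v - L x w\<bar> \<le> \<Lambda>L r * norm (v - w)"
    "norm v \<le> r \<Longrightarrow> \<bar>L x v - L y v\<bar> \<le> \<Lambda>L r * dist x y" "norm v \<le> r \<Longrightarrow> norm (b x v) \<le> \<Lambda>L r" by auto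
qed

lemma lm_eq: "lm m x v = L x v + F x m" by (simp add: mfg_lagrangian_def)

lemma bounded_lagrangian_lm:
  assumes m: "m \<in> borel_prob"
  shows "bounded_lagrangian (lm m) Cs M \<Lambda>"
proof
  show "continuous_on UNIV (\<lambda>(x, v). lm m x v)"
    unfolding lm_eq case_prod_unfold
    by (intro continuous_intros continuous_on_fst_snd_comp F_continuous[OF m])
  fix K r :: real and x y :: "'n torus" and v w :: "real ^ 'n"
  have "\<forall>x v. L x v \<ge> K * norm v + (Cs K + FB)"
    unfolding Cs_def using someI_ex[OF L_superlinear[of K]] by simp
  then have "K * norm v + (Cs K + FB) \<le> L x v" by blast
  then show "K * norm v + Cs K \<le> lm m x v" unfolding lm_eq using FB(2)[OF m, of x] by (simp add: abs_le_iff)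
  show "0 \<le> \<Lambda> r" unfolding \<Lambda>_def using \<Lambda>L(1) FB(1) by simp
  have "\<exists>M. \<forall>x v. norm v \<le> 1 \<longrightarrow> L x v \<le> M"
  proof -
    have "compact (UNIV \<times> cball 0 1 :: ('n torus \<times> (real ^ 'n)) set)" by (intro compact_Times compact_torus compact_cball)
    from compact_continuous_bound[OF this continuous_on_subset[OF L_continuous subset_UNIV]]
    obtain B where B: "\<forall>z\<in>UNIV \<times> cball 0 1. \<bar>case z of (x, v) \<Rightarrow> L x v\<bar> \<le> B" ..
    have "L x v \<le> B" if "norm v \<le> 1" for x v using bspec[OF B, of "(x, v)"] that by simp
    then show ?thesis by blast
  qed
  from someI_ex[OF this] have "norm v \<le> 1 \<Longrightarrow> L x v \<le> M - FB" unfolding M_def by (simp only: add_diff_cancel_right')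
  then show "norm v \<le> 1 \<Longrightarrow> lm m x v \<le> M" unfolding lm_eq using FB(2)[OF m, of x] by (simp add: abs_le_iff)
  show "\<bar>lm m x v - lm m x w\<bar> \<le> \<Lambda> r * norm (v - w)" if "norm v \<le> r" "norm w \<le> r"
    using \<Lambda>L(2)[OF that, of x] mult_nonneg_nonneg[OF FB(1) norm_ge_zero[of "v - w"]] unfolding lm_eq \<Lambda>_def by (simp add: distrib_right)
  show "\<bar>lm m x v - lm m y v\<bar> \<le> \<Lambda> r * dist x y" if "norm v \<le> r"
    using \<Lambda>L(3)[OF that, of x y] FB(3)[OF m, of x y] unfolding lm_eq \<Lambda>_def by (simp add: distrib_right)
qed

text \<open>Outside their locale \<open>Rv\<close> and \<open>Lp\<close> take only
  \<open>Cs\<close>, \<open>M\<close> and \<open>\<Lambda>\<close> as arguments, which makes visible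
  that the speed bound and the Lipschitz constant do not depend on the measure.\<close>

definition R :: real where "R = bounded_lagrangian.Rv Cs M"
definition Lip :: real where "Lip = bounded_lagrangian.Lp Cs M \<Lambda>"
definition cc :: "real \<Rightarrow> 'n torus measure \<Rightarrow> real" where "cc \<tau> m = L_bar \<tau> (lm m)"
definition X :: "('n torus \<times> (real ^ 'n)) set" where "X = UNIV \<times> cball 0 R"

lemma compact_X: "compact X" unfolding X_def by (intro compact_Times compact_torus compact_cball)

lemma R_nonneg: "0 \<le> R"
proof -
  \<comment> \<open>A Dirac measure supplies one instance of the uniform bounds; the resulting
    inequality mentions no measure.\<close>
  obtain z :: "'n torus" where True by simp
  interpret bounded_lagrangian "lm (return borel z)" Cs M \<Lambda> by (rule bounded_lagrangian_lm[OF return_borel_prob])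
  show ?thesis unfolding R_def by (rule Rv_nonneg)
qed

text \<open>The class in which minimizers are found, compact because velocities stay in a ball.
  Competitors in the minimization still range over all of \<open>holonomic\<close>.\<close>

definition KR :: "real \<Rightarrow> ('n torus \<times> (real ^ 'n)) measure set" where
  "KR \<tau> = {\<eta> \<in> holonomic \<tau>. AE z in \<eta>. z \<in> X}"

definition shift_diff :: "real \<Rightarrow> ('n torus \<Rightarrow> real) \<Rightarrow> 'n torus \<times> (real ^ 'n) \<Rightarrow> real" where
  "shift_diff \<tau> \<phi> z = \<phi> (torus_shift (fst z) (\<tau> *\<^sub>R snd z)) - \<phi> (fst z)"

lemma continuous_shift_diff:
  assumes "continuous_on UNIV \<phi>" shows "continuous_on UNIV (shift_diff \<tau> \<phi>)"
  unfolding shift_diff_def by (intro continuous_intros continuous_on_compose2[OF assms]) auto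

lemma holonomic_iff:
  "\<eta> \<in> holonomic \<tau> \<longleftrightarrow> \<eta> \<in> borel_prob \<and> (\<forall>\<phi>. continuous_on UNIV \<phi> \<longrightarrow> (\<integral>z. shift_diff \<tau> \<phi> z \<partial>\<eta>) = 0)"
proof -
  have "(\<integral>(x, v). \<phi> (torus_shift x (\<tau> *\<^sub>R v)) \<partial>\<eta>) - (\<integral>(x, v). \<phi> x \<partial>\<eta>) = (\<integral>z. shift_diff \<tau> \<phi> z \<partial>\<eta>)"
    if \<eta>: "\<eta> \<in> borel_prob" and \<phi>: "continuous_on UNIV \<phi>" for \<phi>
  proof -
    obtain B where B: "\<And>x. \<bar>\<phi> x\<bar> \<le> B" using torus_abs_bounded[OF \<phi>] by blast
    have "integrable \<eta> (\<lambda>z. \<phi> (torus_shift (fst z) (\<tau> *\<^sub>R snd z)))"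
      using B by (intro borel_prob_integrable[OF \<eta>, of _ B] borel_measurable_continuous_onI continuous_on_compose2[OF \<phi>] continuous_intros) auto
    moreover have "integrable \<eta> (\<lambda>z. \<phi> (fst z))"
      using B by (intro borel_prob_integrable[OF \<eta>, of _ B] borel_measurable_continuous_onI continuous_on_compose2[OF \<phi>] continuous_intros) auto
    ultimately show ?thesis unfolding shift_diff_def case_prod_unfold by simp
  qed
  then show ?thesis unfolding holonomic_def by (auto simp: algebra_simps)
qed

lemma KR_D:
  assumes "\<eta> \<in> KR \<tau>"
  shows "\<eta> \<in> borel_prob" "\<And>\<phi>. continuous_on UNIV \<phi> \<Longrightarrow> (\<integral>z. shift_diff \<tau> \<phi> z \<partial>\<eta>) = 0" "AE z in \<eta>. z \<in> X"
    "\<And>f :: _ \<Rightarrow> real. continuous_on UNIV f \<Longrightarrow> integrable \<eta> f"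
  using assms borel_prob_integrable_compact[OF _ compact_X] unfolding KR_def holonomic_iff by auto

lemma KR_I:
  assumes "\<eta> \<in> borel_prob" "AE z in \<eta>. z \<in> X" "\<And>\<phi>. continuous_on UNIV \<phi> \<Longrightarrow> (\<integral>z. shift_diff \<tau> \<phi> z \<partial>\<eta>) = 0"
  shows "\<eta> \<in> KR \<tau>"
  using assms unfolding KR_def holonomic_iff by simp

lemma KR_seq_compact:
  assumes "\<And>n. \<mu> n \<in> KR \<tau>"
  obtains r \<nu> where "strict_mono (r :: nat \<Rightarrow> nat)" "\<nu> \<in> KR \<tau>"
    "\<And>f :: _ \<Rightarrow> real. continuous_on UNIV f \<Longrightarrow> (\<lambda>n. \<integral>x. f x \<partial>\<mu> (r n)) \<longlonglongrightarrow> (\<integral>x. f x \<partial>\<nu>)"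
proof -
  obtain r \<nu> where r: "strict_mono (r :: nat \<Rightarrow> nat)" "\<nu> \<in> borel_prob" "AE x in \<nu>. x \<in> X"
    "\<And>f :: _ \<Rightarrow> real. continuous_on UNIV f \<Longrightarrow> (\<lambda>n. \<integral>x. f x \<partial>\<mu> (r n)) \<longlonglongrightarrow> (\<integral>x. f x \<partial>\<nu>)"
  proof (rule borel_prob_seq_compact[of X \<mu>, OF compact_X])
    show "\<mu> n \<in> borel_prob" "AE z in \<mu> n. z \<in> X" for n using KR_D(1,3)[OF assms] by blast+
  qed blast
  have "\<nu> \<in> KR \<tau>"
  proof (rule KR_I[OF r(2,3)])
    fix \<phi> :: "'n torus \<Rightarrow> real" assume \<phi>: "continuous_on UNIV \<phi>"
    have "(\<lambda>n. 0) \<longlonglongrightarrow> (\<integral>z. shift_diff \<tau> \<phi> z \<partial>\<nu>)"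
      using r(4)[OF continuous_shift_diff[OF \<phi>, of \<tau>]] KR_D(2)[OF assms \<phi>] by simp
    then show "(\<integral>z. shift_diff \<tau> \<phi> z \<partial>\<nu>) = 0" by (simp add: LIMSEQ_const_iff)
  qed
  then show ?thesis using that r by blast
qed

lemma lm_continuous: "m \<in> borel_prob \<Longrightarrow> continuous_on UNIV (\<lambda>z. lm m (fst z) (snd z))"
  using bounded_lagrangian.l_continuous[OF bounded_lagrangian_lm] by (simp add: case_prod_unfold)

lemma cc_weak_kam:
  assumes "\<tau> > 0" "m \<in> borel_prob"
  obtains u where "bounded_lagrangian.weak_kam (lm m) \<tau> (cc \<tau> m) u"
  using bounded_lagrangian.L_bar_weak_kam[OF bounded_lagrangian_lm[OF assms(2)] assms(1)] unfolding cc_def by blast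

text \<open>The subsolution inequality of a weak KAM solution is integrated: its two terms in
  \<open>u\<close> cancel by holonomy, leaving a bound valid for every competitor.\<close>

lemma cc_le_holonomic:
  assumes "\<tau> > 0" "m \<in> borel_prob" "\<mu> \<in> holonomic \<tau>" "integrable \<mu> (\<lambda>z. lm m (fst z) (snd z))"
  shows "cc \<tau> m \<le> (\<integral>z. lm m (fst z) (snd z) \<partial>\<mu>)"
proof -
  interpret bounded_lagrangian "lm m" Cs M \<Lambda> by (rule bounded_lagrangian_lm[OF assms(2)])
  obtain u where u: "weak_kam \<tau> (cc \<tau> m) u" using cc_weak_kam[OF assms(1,2)] .
  have \<mu>: "\<mu> \<in> borel_prob" "(\<integral>z. shift_diff \<tau> u z \<partial>\<mu>) = 0"
    using assms(3) weak_kamD(1)[OF u] unfolding holonomic_iff by auto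
  interpret prob_space \<mu> by (rule borel_probD(1)[OF \<mu>(1)])
  obtain B where B: "\<And>x. \<bar>u x\<bar> \<le> B" using torus_abs_bounded[OF weak_kamD(1)[OF u]] by blast
  have "\<bar>shift_diff \<tau> u z\<bar> \<le> 2 * B" for z
    using B[of "torus_shift (fst z) (\<tau> *\<^sub>R snd z)"] B[of "fst z"] unfolding shift_diff_def by (simp add: abs_le_iff)
  then have i: "integrable \<mu> (shift_diff \<tau> u)"
    by (intro borel_prob_integrable[OF \<mu>(1), of _ "2 * B"] borel_measurable_continuous_onI continuous_shift_diff weak_kamD(1)[OF u]) auto
  have "(\<integral>z. shift_diff \<tau> u z + \<tau> * cc \<tau> m \<partial>\<mu>) \<le> (\<integral>z. \<tau> * lm m (fst z) (snd z) \<partial>\<mu>)"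
  proof (rule integral_mono)
    show "integrable \<mu> (\<lambda>z. shift_diff \<tau> u z + \<tau> * cc \<tau> m)" by (intro Bochner_Integration.integrable_add i integrable_const)
    show "integrable \<mu> (\<lambda>z. \<tau> * lm m (fst z) (snd z))" by (intro integrable_mult_right assms(4))
    show "shift_diff \<tau> u z + \<tau> * cc \<tau> m \<le> \<tau> * lm m (fst z) (snd z)" for z
      using weak_kamD(2)[OF u, of "fst z" "snd z"] unfolding shift_diff_def by simp
  qed
  then have "\<tau> * cc \<tau> m \<le> \<tau> * (\<integral>z. lm m (fst z) (snd z) \<partial>\<mu>)" using i \<mu>(2) prob_space by simp
  then show ?thesis using assms(1) by simp
qed

text \<open>Minimizing measures arise as limits of the empirical measures of a backward calibrated orbit.\<close>

lemma minimizing_exists: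
  assumes "\<tau> > 0" "m \<in> borel_prob"
  obtains \<mu> where "\<mu> \<in> KR \<tau>" "(\<integral>z. lm m (fst z) (snd z) \<partial>\<mu>) = cc \<tau> m"
proof -
  interpret bounded_lagrangian "lm m" Cs M \<Lambda> by (rule bounded_lagrangian_lm[OF assms(2)])
  obtain u where u: "weak_kam \<tau> (cc \<tau> m) u" using cc_weak_kam[OF assms] .
  have "\<exists>z. torus_shift (fst z) (\<tau> *\<^sub>R snd z) = y \<and> calibrated \<tau> (cc \<tau> m) u (fst z) (snd z)" for y
    using weak_kamD(3)[OF u, of y] by auto
  then obtain P where P: "\<And>y. torus_shift (fst (P y)) (\<tau> *\<^sub>R snd (P y)) = y" "\<And>y. calibrated \<tau> (cc \<tau> m) u (fst (P y)) (snd (P y))"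
    by metis
  define y where "y k = ((\<lambda>y. fst (P y)) ^^ k) undefined" for k :: nat
  have ySuc: "fst (P (y k)) = y (Suc k)" for k by (simp add: y_def)
  have PX: "P y \<in> X" for y
    using calibrated_bounded[OF assms(1) u P(2)] unfolding X_def R_def mem_Times_iff by simp
  define t where "t N = (\<lambda>i :: nat. 1 / real (Suc N))" for N
  define \<mu> where "\<mu> N = mixture (Suc N) (t N) (\<lambda>i. return borel (P (y i)))" for N
  have t: "\<And>i. i < Suc N \<Longrightarrow> 0 \<le> t N i" "(\<Sum>i<Suc N. t N i) = 1" for N unfolding t_def by auto
  have Xb: "X \<in> sets borel" using compact_imp_closed[OF compact_X] by simp
  have AEr: "AE z in return borel (P (y i)). z \<in> X" for i using PX Xb by (subst AE_return) auto
  have \<mu>: "\<mu> N \<in> borel_prob" "AE z in \<mu> N. z \<in> X" for N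
    unfolding \<mu>_def by (intro mixture_borel_prob AE_mixture return_borel_prob t Xb AEr; assumption)+
  have int: "(\<integral>z. f z \<partial>\<mu> N) = (\<Sum>i<Suc N. f (P (y i))) / real (Suc N)" if f: "continuous_on UNIV f" for f :: "_ \<Rightarrow> real" and N
  proof -
    have "(\<integral>z. f z \<partial>\<mu> N) = (\<Sum>i<Suc N. t N i * (\<integral>z. f z \<partial>return borel (P (y i))))"
      unfolding \<mu>_def by (rule integral_mixture_compact[OF t return_borel_prob compact_X AEr f])
    then show ?thesis using borel_measurable_continuous_onI[OF f]
      by (simp add: t_def integral_return sum_divide_distrib del: sum.lessThan_Suc)
  qed
  obtain r \<nu> where r: "strict_mono (r :: nat \<Rightarrow> nat)" "\<nu> \<in> borel_prob" "AE x in \<nu>. x \<in> X"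
    "\<And>f :: _ \<Rightarrow> real. continuous_on UNIV f \<Longrightarrow> (\<lambda>n. \<integral>x. f x \<partial>\<mu> (r n)) \<longlonglongrightarrow> (\<integral>x. f x \<partial>\<nu>)"
  proof (rule borel_prob_seq_compact[of X \<mu>, OF compact_X])
    show "\<mu> n \<in> borel_prob" "AE z in \<mu> n. z \<in> X" for n using \<mu> by blast+
  qed blast
  have \<nu>: "\<nu> \<in> KR \<tau>"
  proof (rule KR_I[OF r(2,3)])
    fix \<phi> :: "'n torus \<Rightarrow> real" assume \<phi>: "continuous_on UNIV \<phi>"
    obtain B where B: "\<And>x. \<bar>\<phi> x\<bar> \<le> B" using torus_abs_bounded[OF \<phi>] by blast
    \<comment> \<open>The orbit runs backward, so \<open>y (Suc i)\<close> steps to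
      \<open>y i\<close>. The sum telescopes to two boundary terms, negligible after division by the
      number of steps.\<close>
    have "shift_diff \<tau> \<phi> (P (y i)) = \<phi> (y i) - \<phi> (y (Suc i))" for i
      unfolding shift_diff_def P(1) unfolding ySuc ..
    then have "(\<Sum>i<Suc N. shift_diff \<tau> \<phi> (P (y i))) = \<phi> (y 0) - \<phi> (y (Suc N))" for N
      by (induction N) simp_all
    then have "(\<integral>z. shift_diff \<tau> \<phi> z \<partial>\<mu> N) = (\<phi> (y 0) - \<phi> (y (Suc N))) / real (Suc N)" for N
      using int[OF continuous_shift_diff[OF \<phi>]] by simp
    moreover have "(\<lambda>N. (\<phi> (y 0) - \<phi> (y (Suc N))) / real (Suc N)) \<longlonglongrightarrow> 0"
    proof (rule Lim_null_comparison)
      show "\<forall>\<^sub>F N in sequentially. norm ((\<phi> (y 0) - \<phi> (y (Suc N))) / real (Suc N)) \<le> 2 * B * inverse (real (Suc N))"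
      proof (intro always_eventually allI)
        fix N
        have "\<bar>\<phi> (y 0) - \<phi> (y (Suc N))\<bar> \<le> 2 * B" using B[of "y 0"] B[of "y (Suc N)"] by (simp add: abs_le_iff)
        then show "norm ((\<phi> (y 0) - \<phi> (y (Suc N))) / real (Suc N)) \<le> 2 * B * inverse (real (Suc N))"
          by (simp add: divide_inverse abs_mult mult_right_mono)
      qed
      show "(\<lambda>N. 2 * B * inverse (real (Suc N))) \<longlonglongrightarrow> 0"
        using tendsto_mult_left[OF LIMSEQ_inverse_real_of_nat, of "2 * B"] by simp
    qed
    ultimately have "(\<lambda>N. \<integral>z. shift_diff \<tau> \<phi> z \<partial>\<mu> N) \<longlonglongrightarrow> 0" by simp
    from LIMSEQ_subseq_LIMSEQ[OF this r(1)] show "(\<integral>z. shift_diff \<tau> \<phi> z \<partial>\<nu>) = 0"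
      using LIMSEQ_unique[OF r(4)[OF continuous_shift_diff[OF \<phi>, of \<tau>]]] by (simp add: o_def)
  qed
  \<comment> \<open>The defect in the subsolution inequality. It vanishes at every orbit point, so
    its integral is 0 for the empirical measures and for their limit.\<close>
  define f where "f z = \<tau> * lm m (fst z) (snd z) - \<tau> * cc \<tau> m - shift_diff \<tau> u z" for z
  have fc: "continuous_on UNIV f" unfolding f_def
    by (intro continuous_intros lm_continuous[OF assms(2)] continuous_shift_diff weak_kamD(1)[OF u])
  have "f (P y) = 0" for y using P(2)[of y] unfolding f_def calibrated_def shift_diff_def by simp
  then have "(\<integral>z. f z \<partial>\<mu> N) = 0" for N using int[OF fc, of N] by simp
  then have "(\<integral>z. f z \<partial>\<nu>) = 0" using r(4)[OF fc] by (simp add: LIMSEQ_const_iff)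
  moreover have "(\<integral>z. f z \<partial>\<nu>) = \<tau> * (\<integral>z. lm m (fst z) (snd z) \<partial>\<nu>) - \<tau> * cc \<tau> m"
  proof -
    interpret prob_space \<nu> by (rule borel_probD(1)[OF r(2)])
    show ?thesis unfolding f_def
      using KR_D(4)[OF \<nu> lm_continuous[OF assms(2)]] KR_D(4)[OF \<nu> continuous_shift_diff[OF weak_kamD(1)[OF u]]] KR_D(2)[OF \<nu> weak_kamD(1)[OF u]]
      by (simp add: prob_space)
  qed
  ultimately show ?thesis using that[OF \<nu>] assms(1) by simp
qed

text \<open>A minimizer for one measure competes for the other, and the two Lagrangians differ by at
  most \<open>e\<close> pointwise.\<close>

lemma cc_diff_le:
  assumes "\<tau> > 0" "m \<in> borel_prob" "m' \<in> borel_prob" "\<And>x. \<bar>F x m - F x m'\<bar> \<le> e"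
  shows "\<bar>cc \<tau> m - cc \<tau> m'\<bar> \<le> e"
proof -
  have *: "cc \<tau> m \<le> cc \<tau> m' + e" if m: "m \<in> borel_prob" "m' \<in> borel_prob" and e: "\<And>x. \<bar>F x m - F x m'\<bar> \<le> e" for m m'
  proof -
    obtain \<mu> where \<mu>: "\<mu> \<in> KR \<tau>" "(\<integral>z. lm m' (fst z) (snd z) \<partial>\<mu>) = cc \<tau> m'" using minimizing_exists[OF assms(1) m(2)] .
    interpret prob_space \<mu> by (rule borel_probD(1)[OF KR_D(1)[OF \<mu>(1)]])
    note i = KR_D(4)[OF \<mu>(1) lm_continuous]
    have "cc \<tau> m \<le> (\<integral>z. lm m (fst z) (snd z) \<partial>\<mu>)" using \<mu>(1) i[OF m(1)] unfolding KR_def by (intro cc_le_holonomic assms(1) m) auto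
    also have "\<dots> \<le> (\<integral>z. lm m' (fst z) (snd z) + e \<partial>\<mu>)"
    proof (rule integral_mono[OF i[OF m(1)]])
      show "integrable \<mu> (\<lambda>z. lm m' (fst z) (snd z) + e)" by (intro Bochner_Integration.integrable_add i m integrable_const)
      show "lm m (fst z) (snd z) \<le> lm m' (fst z) (snd z) + e" for z
        using e[of "fst z"] by (simp add: lm_eq abs_le_iff)
    qed
    also have "\<dots> = cc \<tau> m' + e" using i[OF m(2)] \<mu>(2) by (simp add: prob_space)
    finally show ?thesis .
  qed
  have "\<bar>F x m' - F x m\<bar> \<le> e" for x using assms(4)[of x] by (simp add: abs_minus_commute)
  then show ?thesis using *[OF assms(2,3,4)] *[OF assms(3,2)] by (simp add: abs_le_iff)
qed

section \<open>Finite nets of measures and approximate equilibria\<close>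

lemma F_dist_seq_compact:
  assumes "\<And>n. m n \<in> borel_prob"
  obtains r m0 where "strict_mono (r :: nat \<Rightarrow> nat)" "m0 \<in> borel_prob"
    "uniform_limit UNIV (\<lambda>n x. F x (m (r n))) (\<lambda>x. F x m0) sequentially"
proof -
  obtain r m0 where r: "strict_mono (r :: nat \<Rightarrow> nat)" "m0 \<in> borel_prob"
    "\<And>f :: 'n torus \<Rightarrow> real. continuous_on UNIV f \<Longrightarrow> (\<lambda>n. \<integral>x. f x \<partial>m (r n)) \<longlonglongrightarrow> (\<integral>x. f x \<partial>m0)"
  proof (rule borel_prob_seq_compact[of "UNIV :: 'n torus set" m, OF compact_torus])
    show "m n \<in> borel_prob" "AE z in m n. z \<in> UNIV" for n using assms by auto
  qed blast
  show ?thesis by (rule that[OF r(1,2) F_uniform_limit[OF assms r(2,3)]])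
qed

text \<open>Total boundedness of the functions F(x,m) in the sup norm. Otherwise a greedy choice
  yields measures whose functions are pairwise more than \<open>e\<close> apart, contradicting
  \<open>F_dist_seq_compact\<close>.\<close>

lemma F_finite_net:
  assumes "e > 0"
  shows "\<exists>N ms. (\<forall>i. ms i \<in> borel_prob) \<and> (\<forall>m\<in>borel_prob. \<exists>i<(N :: nat). \<forall>x. \<bar>F x m - F x (ms i)\<bar> \<le> e)"
proof (rule ccontr)
  assume neg: "\<not> (\<exists>N ms. (\<forall>i. ms i \<in> borel_prob) \<and> (\<forall>m\<in>borel_prob. \<exists>i<(N :: nat). \<forall>x. \<bar>F x m - F x (ms i)\<bar> \<le> e))"
  have no: "\<exists>m\<in>borel_prob. \<forall>i<N. \<exists>x. \<bar>F x m - F x (ms i)\<bar> > e" if "\<And>i. ms i \<in> borel_prob" for N :: nat and ms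
  proof (rule ccontr)
    assume n: "\<not> (\<exists>m\<in>borel_prob. \<forall>i<N. \<exists>x. \<bar>F x m - F x (ms i)\<bar> > e)"
    have "\<exists>i<N. \<forall>x. \<bar>F x m - F x (ms i)\<bar> \<le> e" if "m \<in> borel_prob" for m
      using n that by (meson not_le)
    then have "\<forall>m\<in>borel_prob. \<exists>i<N. \<forall>x. \<bar>F x m - F x (ms i)\<bar> \<le> e" ..
    moreover have "\<forall>i. ms i \<in> borel_prob" using that ..
    ultimately show False using neg by (elim notE) (intro exI conjI)
  qed
  define P where "P f n m \<longleftrightarrow> m \<in> borel_prob \<and> (\<forall>i<n. \<exists>x. \<bar>F x m - F x (f i)\<bar> > e)" for f and n :: nat and m
  have "\<exists>f. \<forall>n. P f n (f n)"
  proof (rule dependent_wellorder_choice)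
    show "P f n m = P g n m" if "\<And>i. i < n \<Longrightarrow> f i = g i" for m f g n using that unfolding P_def by simp
    show "\<exists>m. P f n m" if "\<And>i. i < n \<Longrightarrow> P f i (f i)" for n f
    proof -
      \<comment> \<open>\<open>no\<close> takes an infinite family of measures, so the first
        \<open>n\<close> choices are padded by a Dirac measure.\<close>
      define ms where "ms i = (if i < n then f i else return borel undefined)" for i
      have "ms i \<in> borel_prob" for i using that[of i] return_borel_prob unfolding ms_def P_def by (cases "i < n") simp_all
      from no[OF this, of n] obtain m where "m \<in> borel_prob" "\<forall>i<n. \<exists>x. \<bar>F x m - F x (ms i)\<bar> > e" ..
      then have "P f n m" unfolding P_def ms_def by simp
      then show ?thesis ..
    qed
  qed
  then obtain f where f': "\<forall>n. P f n (f n)" ..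
  have f: "\<And>n. f n \<in> borel_prob" "\<And>n i. i < n \<Longrightarrow> \<exists>x. \<bar>F x (f n) - F x (f i)\<bar> > e"
    using f' unfolding P_def by simp_all
  obtain r m0 where r: "strict_mono (r :: nat \<Rightarrow> nat)" "m0 \<in> borel_prob"
    "uniform_limit UNIV (\<lambda>n x. F x (f (r n))) (\<lambda>x. F x m0) sequentially" using F_dist_seq_compact[of f] f(1) by blast
  obtain K where K: "\<And>n x. n \<ge> K \<Longrightarrow> dist (F x (f (r n))) (F x m0) < e / 2"
    using uniform_limitD[OF r(3), of "e / 2"] assms unfolding eventually_sequentially by auto
  obtain x where "\<bar>F x (f (r (Suc K))) - F x (f (r K))\<bar> > e" using f(2)[of "r K" "r (Suc K)"] r(1) by (auto simp: strict_mono_def)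
  then show False using K[of "Suc K" x] K[of K x] unfolding dist_real_def by linarith
qed

text \<open>A pseudodistance measuring how far two measures differ in their effect on the
  Lagrangian; distinct measures may be at distance 0.\<close>

definition Fd :: "'n torus measure \<Rightarrow> 'n torus measure \<Rightarrow> real" where "Fd m m' = (SUP x. \<bar>F x m - F x m'\<bar>)"

lemma Fd:
  assumes "m \<in> borel_prob" "m' \<in> borel_prob"
  shows "\<bar>F x m - F x m'\<bar> \<le> Fd m m'" "(\<And>x. \<bar>F x m - F x m'\<bar> \<le> e) \<Longrightarrow> Fd m m' \<le> e"
proof -
  have "bdd_above (range (\<lambda>x. \<bar>F x m - F x m'\<bar>))"
  proof (rule bdd_aboveI2)
    show "\<bar>F x m - F x m'\<bar> \<le> 2 * FB" for x using FB(2)[OF assms(1), of x] FB(2)[OF assms(2), of x] by (simp add: abs_le_iff)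
  qed
  then show "\<bar>F x m - F x m'\<bar> \<le> Fd m m'" unfolding Fd_def by (rule cSUP_upper[OF UNIV_I])
  show "(\<And>x. \<bar>F x m - F x m'\<bar> \<le> e) \<Longrightarrow> Fd m m' \<le> e" unfolding Fd_def by (intro cSUP_least) auto
qed

lemma Fd_tendsto:
  assumes "\<And>n. m n \<in> borel_prob" "m0 \<in> borel_prob" "m' \<in> borel_prob"
    and ul: "uniform_limit UNIV (\<lambda>n x. F x (m n)) (\<lambda>x. F x m0) sequentially"
  shows "(\<lambda>n. Fd (m n) m') \<longlonglongrightarrow> Fd m0 m'"
proof (rule tendstoI)
  fix e :: real assume "e > 0"
  have "\<forall>\<^sub>F n in sequentially. \<forall>x\<in>UNIV. dist (F x (m n)) (F x m0) < e / 2" using uniform_limitD[OF ul, of "e / 2"] \<open>e > 0\<close> by simp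
  then show "\<forall>\<^sub>F n in sequentially. dist (Fd (m n) m') (Fd m0 m') < e"
  proof eventually_elim
    case (elim n)
    then have d: "\<bar>F x (m n) - F x m0\<bar> < e / 2" for x by (simp add: dist_real_def)
    have "Fd (m n) m' \<le> Fd m0 m' + e / 2"
    proof (rule Fd(2)[OF assms(1,3)])
      show "\<bar>F x (m n) - F x m'\<bar> \<le> Fd m0 m' + e / 2" for x using Fd(1)[OF assms(2,3), of x] d[of x] by linarith
    qed
    moreover have "Fd m0 m' \<le> Fd (m n) m' + e / 2"
    proof (rule Fd(2)[OF assms(2,3)])
      show "\<bar>F x m0 - F x m'\<bar> \<le> Fd (m n) m' + e / 2" for x using Fd(1)[OF assms(1,3), of x n] d[of x] by linarith
    qed
    ultimately show ?case using \<open>e > 0\<close> unfolding dist_real_def by linarith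
  qed
qed

text \<open>Kakutani's argument with Brouwer's theorem: blend minimizers \<open>\<mu> i\<close> for the points of a finite
  net by weights supported where the net point is close to the current marginal.\<close>

lemma approximate_equilibrium:
  assumes "\<tau> > 0" "e > 0"
  obtains \<eta> where "\<eta> \<in> KR \<tau>" "(\<integral>z. lm (distr \<eta> borel fst) (fst z) (snd z) \<partial>\<eta>) \<le> cc \<tau> (distr \<eta> borel fst) + 4 * e"
proof -
  obtain N ms where ms': "(\<forall>i. ms i \<in> borel_prob) \<and> (\<forall>m\<in>borel_prob. \<exists>i<(N :: nat). \<forall>x. \<bar>F x m - F x (ms i)\<bar> \<le> e)"
    using F_finite_net[OF assms(2)] by (elim exE)
  have ms: "\<And>i. ms i \<in> borel_prob" "\<And>m. m \<in> borel_prob \<Longrightarrow> \<exists>i<N. \<forall>x. \<bar>F x m - F x (ms i)\<bar> \<le> e"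
    using ms' by auto
  have "N > 0" using ms(2)[OF ms(1)[of 0]] by auto
  obtain \<mu> where \<mu>: "\<And>i. \<mu> i \<in> KR \<tau>" "\<And>i. (\<integral>z. lm (ms i) (fst z) (snd z) \<partial>\<mu> i) = cc \<tau> (ms i)"
  proof -
    have "\<exists>\<mu>. \<mu> \<in> KR \<tau> \<and> (\<integral>z. lm (ms i) (fst z) (snd z) \<partial>\<mu>) = cc \<tau> (ms i)" for i
      using minimizing_exists[OF assms(1) ms(1)] by blast
    then show ?thesis using that by metis
  qed
  define \<Delta> where "\<Delta> = {t \<in> unit_cube N. (\<Sum>i<N. t i) = 1}"
  define \<eta> where "\<eta> t = mixture N t \<mu>" for t
  define mm where "mm t = distr (\<eta> t) borel fst" for t
  \<comment> \<open>Hat functions of radius \<open>2 * e\<close> around the net points. A net point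
    within \<open>e\<close> contributes at least \<open>e\<close>, so the total weight is positive,
    while a nonzero weight forces the net point to be within \<open>2 * e\<close>.\<close>
  define \<beta> where "\<beta> m i = max 0 (2 * e - Fd m (ms i))" for m i
  have \<Delta>: "\<And>i. i < N \<Longrightarrow> 0 \<le> t i" "(\<Sum>i<N. t i) = 1" if "t \<in> \<Delta>" for t using that unfolding \<Delta>_def unit_cube_def by auto
  have Xb: "X \<in> sets borel" using compact_imp_closed[OF compact_X] by simp
  have \<eta>b: "\<eta> t \<in> borel_prob" if "t \<in> \<Delta>" for t
    unfolding \<eta>_def using \<Delta>[OF that] KR_D(1)[OF \<mu>(1)] by (intro mixture_borel_prob) auto
  have \<eta>X: "AE z in \<eta> t. z \<in> X" if "t \<in> \<Delta>" for t
    unfolding \<eta>_def using \<Delta>[OF that] KR_D(1,3)[OF \<mu>(1)] Xb by (intro AE_mixture) auto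
  have int: "(\<integral>z. f z \<partial>\<eta> t) = (\<Sum>i<N. t i * (\<integral>z. f z \<partial>\<mu> i))" if "t \<in> \<Delta>" "continuous_on UNIV f" for t f
    unfolding \<eta>_def using \<Delta>[OF that(1)] KR_D(1,3)[OF \<mu>(1)]
    by (intro integral_mixture_compact[OF _ _ _ compact_X _ that(2)]) auto
  have \<eta>K: "\<eta> t \<in> KR \<tau>" if "t \<in> \<Delta>" for t
    using int[OF that continuous_shift_diff] KR_D(2)[OF \<mu>(1)] by (intro KR_I \<eta>b \<eta>X that) auto
  have mmb: "mm t \<in> borel_prob" if "t \<in> \<Delta>" for t unfolding mm_def by (rule distr_fst_borel_prob(1)[OF \<eta>b[OF that]])
  have mmint: "(\<integral>x. \<phi> x \<partial>mm t) = (\<Sum>i<N. t i * (\<integral>z. \<phi> (fst z) \<partial>\<mu> i))" if "t \<in> \<Delta>" "continuous_on UNIV \<phi>" for t \<phi>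
    unfolding mm_def distr_fst_borel_prob(2)[OF \<eta>b[OF that(1)] borel_measurable_continuous_onI[OF that(2)]]
    by (rule int[OF that(1) continuous_on_fst_snd_comp[OF that(2)]])
  have \<beta>pos: "(\<Sum>i<N. \<beta> m i) > 0" if m: "m \<in> borel_prob" for m
  proof -
    obtain i where i: "i < N" "\<And>x. \<bar>F x m - F x (ms i)\<bar> \<le> e" using ms(2)[OF m] by blast
    then have "Fd m (ms i) \<le> e" by (intro Fd(2) m ms(1)) auto
    then have "0 < \<beta> m i" unfolding \<beta>_def using assms(2) by simp
    also have "\<beta> m i \<le> (\<Sum>i<N. \<beta> m i)" using i(1) by (intro member_le_sum) (auto simp: \<beta>_def)
    finally show ?thesis .
  qed
  define g where "g t i = \<beta> (mm t) i / (\<Sum>j<N. \<beta> (mm t) j)" for t i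
  \<comment> \<open>At the fixed point the mixing weights are the normalised hat weights of the
    marginal of the mixture itself, so only minimizers for measures close to that marginal are
    mixed.\<close>
  obtain t where t: "t \<in> \<Delta>" "\<And>i. i < N \<Longrightarrow> g t i = t i"
  proof (rule brouwer_simplex[OF \<open>N > 0\<close>, of g, folded \<Delta>_def])
    show "0 \<le> g t i" if "t \<in> \<Delta>" for t i
      unfolding g_def using \<beta>pos[OF mmb[OF that]] by (intro divide_nonneg_pos) (auto simp: \<beta>_def)
    show "(\<Sum>i<N. g t i) = 1" if "t \<in> \<Delta>" for t
      unfolding g_def sum_divide_distrib[symmetric] using \<beta>pos[OF mmb[OF that]] by simp
    fix T t i assume T: "\<And>k. T k \<in> \<Delta>" "t \<in> \<Delta>" "\<And>j. (\<lambda>k. T k j) \<longlonglongrightarrow> t j" "i < N"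
    have "uniform_limit UNIV (\<lambda>k x. F x (mm (T k))) (\<lambda>x. F x (mm t)) sequentially"
    proof (rule F_uniform_limit)
      show "(\<lambda>k. \<integral>x. \<phi> x \<partial>mm (T k)) \<longlonglongrightarrow> (\<integral>x. \<phi> x \<partial>mm t)" if "continuous_on UNIV \<phi>" for \<phi> :: "'n torus \<Rightarrow> real"
        unfolding mmint[OF T(1) that] mmint[OF T(2) that] by (intro tendsto_intros T(3))
    qed (use mmb T in auto)
    then have "(\<lambda>k. \<beta> (mm (T k)) i) \<longlonglongrightarrow> \<beta> (mm t) i" for i
      unfolding \<beta>_def using mmb T by (intro tendsto_intros Fd_tendsto ms(1)) auto
    then show "(\<lambda>k. g (T k) i) \<longlonglongrightarrow> g t i"
      unfolding g_def using \<beta>pos[OF mmb[OF T(2)]] by (intro tendsto_intros) auto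
  qed blast
  let ?m = "mm t"
  note m = mmb[OF t(1)]
  \<comment> \<open>Two errors of size \<open>2 * e\<close>: one for exchanging F inside the
    integral, one for exchanging the minimal values by \<open>cc_diff_le\<close>.\<close>
  have key: "t i * (\<integral>z. lm ?m (fst z) (snd z) \<partial>\<mu> i) \<le> t i * (cc \<tau> ?m + 4 * e)" if "i < N" for i
  proof (cases "t i = 0")
    case False
    then have "\<beta> ?m i \<noteq> 0" using t(2)[OF that] unfolding g_def by auto
    then have "Fd ?m (ms i) < 2 * e" unfolding \<beta>_def by simp
    then have d: "\<bar>F x ?m - F x (ms i)\<bar> \<le> 2 * e" for x using Fd(1)[OF m ms(1), of x i] by linarith
    interpret prob_space "\<mu> i" by (rule borel_probD(1)[OF KR_D(1)[OF \<mu>(1)]])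
    have "(\<integral>z. lm ?m (fst z) (snd z) \<partial>\<mu> i) \<le> (\<integral>z. lm (ms i) (fst z) (snd z) + 2 * e \<partial>\<mu> i)"
    proof (rule integral_mono[OF KR_D(4)[OF \<mu>(1) lm_continuous[OF m]]])
      show "integrable (\<mu> i) (\<lambda>z. lm (ms i) (fst z) (snd z) + 2 * e)"
        by (intro Bochner_Integration.integrable_add integrable_const KR_D(4)[OF \<mu>(1)] lm_continuous ms(1))
      show "lm ?m (fst z) (snd z) \<le> lm (ms i) (fst z) (snd z) + 2 * e" for z
        using d[of "fst z"] by (simp add: lm_eq abs_le_iff)
    qed
    also have "\<dots> = cc \<tau> (ms i) + 2 * e" using KR_D(4)[OF \<mu>(1) lm_continuous[OF ms(1)]] \<mu>(2) by (simp add: prob_space)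
    also have "\<dots> \<le> cc \<tau> ?m + 4 * e" using cc_diff_le[OF assms(1) m ms(1) d] by (simp add: abs_le_iff)
    finally show ?thesis using \<Delta>(1)[OF t(1) that] by (rule mult_left_mono)
  qed simp
  have "(\<integral>z. lm ?m (fst z) (snd z) \<partial>\<eta> t) \<le> (\<Sum>i<N. t i * (cc \<tau> ?m + 4 * e))"
    unfolding int[OF t(1) lm_continuous[OF m]] using key by (intro sum_mono) auto
  also have "\<dots> = cc \<tau> ?m + 4 * e" unfolding sum_distrib_right[symmetric] \<Delta>(2)[OF t(1)] by simp
  finally show ?thesis using that[OF \<eta>K[OF t(1)]] unfolding mm_def by simp
qed

text \<open>Approximate equilibria with accuracy tending to 0 subconverge in \<open>KR\<close>. The
  measure occurs both as integrator and, through its marginal, inside the Lagrangian; uniform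
  convergence of F separates the two effects.\<close>

theorem equilibrium_exists:
  assumes "\<tau> > 0"
  obtains \<eta> where "\<eta> \<in> KR \<tau>" "(\<integral>z. lm (distr \<eta> borel fst) (fst z) (snd z) \<partial>\<eta>) = cc \<tau> (distr \<eta> borel fst)"
proof -
  have "\<exists>\<eta>. \<eta> \<in> KR \<tau> \<and> (\<integral>z. lm (distr \<eta> borel fst) (fst z) (snd z) \<partial>\<eta>) \<le> cc \<tau> (distr \<eta> borel fst) + 4 * inverse (real (Suc k))" for k
    by (rule approximate_equilibrium[OF assms, of "inverse (real (Suc k))"]) (simp, blast)
  then have "\<exists>\<eta>. \<forall>k. \<eta> k \<in> KR \<tau> \<and>
      (\<integral>z. lm (distr (\<eta> k) borel fst) (fst z) (snd z) \<partial>\<eta> k) \<le> cc \<tau> (distr (\<eta> k) borel fst) + 4 * inverse (real (Suc k))"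
    by (rule choice[OF allI])
  then obtain \<eta> where \<eta>: "\<And>k. \<eta> k \<in> KR \<tau>"
    "\<And>k. (\<integral>z. lm (distr (\<eta> k) borel fst) (fst z) (snd z) \<partial>\<eta> k) \<le> cc \<tau> (distr (\<eta> k) borel fst) + 4 * inverse (real (Suc k))"
    by blast
  obtain r \<nu> where r: "strict_mono (r :: nat \<Rightarrow> nat)" "\<nu> \<in> KR \<tau>"
    "\<And>f :: _ \<Rightarrow> real. continuous_on UNIV f \<Longrightarrow> (\<lambda>n. \<integral>x. f x \<partial>\<eta> (r n)) \<longlonglongrightarrow> (\<integral>x. f x \<partial>\<nu>)"
    using KR_seq_compact[of \<eta>] \<eta>(1) by blast
  define m where "m k = distr (\<eta> (r k)) borel fst" for k
  define m0 where "m0 = distr \<nu> borel fst"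
  have m: "m k \<in> borel_prob" for k unfolding m_def by (rule distr_fst_borel_prob(1)[OF KR_D(1)[OF \<eta>(1)]])
  have m0: "m0 \<in> borel_prob" unfolding m0_def by (rule distr_fst_borel_prob(1)[OF KR_D(1)[OF r(2)]])
  have ul: "uniform_limit UNIV (\<lambda>n x. F x (m n)) (\<lambda>x. F x m0) sequentially"
  proof (rule F_uniform_limit[OF m m0])
    fix \<phi> :: "'n torus \<Rightarrow> real" assume \<phi>: "continuous_on UNIV \<phi>"
    show "(\<lambda>n. \<integral>x. \<phi> x \<partial>m n) \<longlonglongrightarrow> (\<integral>x. \<phi> x \<partial>m0)"
      unfolding m_def m0_def distr_fst_borel_prob(2)[OF KR_D(1)[OF \<eta>(1)] borel_measurable_continuous_onI[OF \<phi>]]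
        distr_fst_borel_prob(2)[OF KR_D(1)[OF r(2)] borel_measurable_continuous_onI[OF \<phi>]]
      by (rule r(3)[OF continuous_on_fst_snd_comp[OF \<phi>]])
  qed
  \<comment> \<open>Three errors of size \<open>e / 3\<close>: replacing \<open>m n\<close> by
    \<open>m0\<close> inside the integral, the accuracy of the approximate equilibrium, and
    replacing \<open>m n\<close> by \<open>m0\<close> in \<open>cc\<close>.\<close>
  have "(\<integral>z. lm m0 (fst z) (snd z) \<partial>\<nu>) \<le> cc \<tau> m0 + e" if "e > 0" for e
  proof -
    have "\<forall>\<^sub>F n in sequentially. \<forall>x\<in>UNIV. dist (F x (m n)) (F x m0) < e / 3" using uniform_limitD[OF ul, of "e / 3"] \<open>e > 0\<close> by simp
    moreover have "(\<lambda>n. 4 * inverse (real (Suc n))) \<longlonglongrightarrow> 0"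
      using tendsto_mult_left[OF LIMSEQ_inverse_real_of_nat, of 4] by simp
    then have "(\<lambda>n. 4 * inverse (real (Suc (r n)))) \<longlonglongrightarrow> 0" using LIMSEQ_subseq_LIMSEQ[OF _ r(1)] by (simp add: o_def)
    then have "\<forall>\<^sub>F n in sequentially. 4 * inverse (real (Suc (r n))) < e / 3" by (rule order_tendstoD(2)) (use that in simp)
    ultimately have "\<forall>\<^sub>F n in sequentially. (\<integral>z. lm m0 (fst z) (snd z) \<partial>\<eta> (r n)) \<le> cc \<tau> m0 + e"
    proof eventually_elim
      case (elim n)
      then have d: "\<bar>F x (m n) - F x m0\<bar> \<le> e / 3" for x by (simp add: dist_real_def less_imp_le)
      interpret prob_space "\<eta> (r n)" by (rule borel_probD(1)[OF KR_D(1)[OF \<eta>(1)]])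
      note i = KR_D(4)[OF \<eta>(1) lm_continuous]
      have "(\<integral>z. lm m0 (fst z) (snd z) \<partial>\<eta> (r n)) \<le> (\<integral>z. lm (m n) (fst z) (snd z) + e / 3 \<partial>\<eta> (r n))"
      proof (rule integral_mono[OF i[OF m0]])
        show "integrable (\<eta> (r n)) (\<lambda>z. lm (m n) (fst z) (snd z) + e / 3)" by (intro Bochner_Integration.integrable_add integrable_const i m)
        show "lm m0 (fst z) (snd z) \<le> lm (m n) (fst z) (snd z) + e / 3" for z using d[of "fst z"] unfolding lm_eq by linarith
      qed
      also have "\<dots> = (\<integral>z. lm (m n) (fst z) (snd z) \<partial>\<eta> (r n)) + e / 3" using i[OF m] by (simp add: prob_space)
      also have "\<dots> \<le> cc \<tau> (m n) + e / 3 + e / 3" using \<eta>(2)[of "r n"] elim(2) unfolding m_def by linarith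
      also have "\<dots> \<le> cc \<tau> m0 + e" using cc_diff_le[OF assms m m0 d] by linarith
      finally show ?case .
    qed
    then show ?thesis by (rule tendsto_upperbound[OF r(3)[OF lm_continuous[OF m0]]]) simp
  qed
  then have "(\<integral>z. lm m0 (fst z) (snd z) \<partial>\<nu>) \<le> cc \<tau> m0" by (rule field_le_epsilon)
  moreover have "cc \<tau> m0 \<le> (\<integral>z. lm m0 (fst z) (snd z) \<partial>\<nu>)"
    using r(2) KR_D(4)[OF r(2) lm_continuous[OF m0]] unfolding KR_def by (intro cc_le_holonomic assms m0) auto
  ultimately show ?thesis using that[OF r(2)] unfolding m0_def by simp
qed

lemma equilibrium_discrete_equilibrium:
  assumes "\<tau> > 0" "\<eta> \<in> KR \<tau>"
    "(\<integral>z. lm (distr \<eta> borel fst) (fst z) (snd z) \<partial>\<eta>) = cc \<tau> (distr \<eta> borel fst)"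
  shows "discrete_equilibrium H F \<tau> (distr \<eta> borel fst)"
  unfolding discrete_equilibrium_def minimizing_holonomic_def case_prod_unfold
proof (intro conjI exI[of _ \<eta>] ballI impI refl)
  show m: "distr \<eta> borel fst \<in> borel_prob" by (rule distr_fst_borel_prob(1)[OF KR_D(1)[OF assms(2)]])
  show "\<eta> \<in> holonomic \<tau>" using assms(2) unfolding KR_def by simp
  show "integrable \<eta> (\<lambda>z. lm (distr \<eta> borel fst) (fst z) (snd z))" by (rule KR_D(4)[OF assms(2) lm_continuous[OF m]])
  show "(\<integral>z. lm (distr \<eta> borel fst) (fst z) (snd z) \<partial>\<eta>) \<le> (\<integral>z. lm (distr \<eta> borel fst) (fst z) (snd z) \<partial>\<mu>)"
    if "\<mu> \<in> holonomic \<tau>" "integrable \<mu> (\<lambda>z. lm (distr \<eta> borel fst) (fst z) (snd z))" for \<mu>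
    unfolding assms(3) by (rule cc_le_holonomic[OF assms(1) m that])
qed

end

section \<open>Orbits and first-order bounds\<close>

text \<open>The slopes \<open>p\<close> and \<open>p'\<close> need not agree, but testing both
  bounds in the direction \<open>p' - p\<close> shows that they differ by at most
  \<open>2 * \<epsilon>\<close>. A limit of the bounded slopes is then the gradient. The inequality
  with \<open>a\<close> and \<open>v\<close> is carried along so that the gradient satisfies it
  too.\<close>

lemma GDERIV_two_sided_limit:
  fixes f :: "'a::euclidean_space \<Rightarrow> real"
  assumes "\<And>\<epsilon>. \<epsilon> > 0 \<Longrightarrow> \<exists>\<rho>>0. \<exists>p p'. norm p \<le> P \<and> (\<forall>h. norm h \<le> \<rho> \<longrightarrow> f h - f 0 \<le> p \<bullet> h + \<epsilon> * norm h) \<and>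
    (\<forall>h. norm h \<le> \<rho> \<longrightarrow> p' \<bullet> h - \<epsilon> * norm h \<le> f h - f 0) \<and> a \<le> p \<bullet> v + \<epsilon> * norm v"
  obtains q where "GDERIV f 0 :> q" "a \<le> q \<bullet> v"
proof -
  have "\<forall>k. \<exists>\<rho> p p'. \<rho> > 0 \<and> norm p \<le> P \<and> (\<forall>h. norm h \<le> \<rho> \<longrightarrow> f h - f 0 \<le> p \<bullet> h + inverse (real (Suc k)) * norm h) \<and>
    (\<forall>h. norm h \<le> \<rho> \<longrightarrow> p' \<bullet> h - inverse (real (Suc k)) * norm h \<le> f h - f 0) \<and> a \<le> p \<bullet> v + inverse (real (Suc k)) * norm v"
  proof
    fix k
    show "\<exists>\<rho> p p'. \<rho> > 0 \<and> norm p \<le> P \<and> (\<forall>h. norm h \<le> \<rho> \<longrightarrow> f h - f 0 \<le> p \<bullet> h + inverse (real (Suc k)) * norm h) \<and>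
    (\<forall>h. norm h \<le> \<rho> \<longrightarrow> p' \<bullet> h - inverse (real (Suc k)) * norm h \<le> f h - f 0) \<and> a \<le> p \<bullet> v + inverse (real (Suc k)) * norm v"
      using assms[of "inverse (real (Suc k))"] by auto
  qed
  then obtain \<rho> p p' where *: "\<And>k. \<rho> k > 0" "\<And>k. norm (p k) \<le> P"
    "\<And>k h. norm h \<le> \<rho> k \<Longrightarrow> f h - f 0 \<le> p k \<bullet> h + inverse (real (Suc k)) * norm h"
    "\<And>k h. norm h \<le> \<rho> k \<Longrightarrow> p' k \<bullet> h - inverse (real (Suc k)) * norm h \<le> f h - f 0"
    "\<And>k. a \<le> p k \<bullet> v + inverse (real (Suc k)) * norm v" by metis
  have pp': "norm (p' k - p k) \<le> 2 * inverse (real (Suc k))" for k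
  proof (cases "p' k = p k")
    case False
    define h where "h = (\<rho> k / norm (p' k - p k)) *\<^sub>R (p' k - p k)"
    have h: "norm h = \<rho> k" using False *(1)[of k] by (simp add: h_def)
    have "(p' k - p k) \<bullet> h = norm (p' k - p k) * \<rho> k"
      using False by (simp add: h_def dot_square_norm power2_eq_square)
    moreover have "(p' k - p k) \<bullet> h \<le> 2 * inverse (real (Suc k)) * \<rho> k"
      using *(3)[of h k] *(4)[of h k] unfolding h inner_diff_left by linarith
    ultimately show ?thesis using *(1)[of k] by simp
  qed simp
  have "p k \<in> cball 0 P" for k using *(2) by simp
  then obtain q r where r: "strict_mono r" "(\<lambda>n. p (r n)) \<longlonglongrightarrow> q"
    using compact_subsequence[OF compact_cball, of p 0 P] by metis
  have inv: "(\<lambda>k. inverse (real (Suc (r k)))) \<longlonglongrightarrow> 0"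
    using LIMSEQ_subseq_LIMSEQ[OF LIMSEQ_inverse_real_of_nat r(1)] by (simp add: o_def)
  have "(\<lambda>k. p (r k) \<bullet> v + inverse (real (Suc (r k))) * norm v) \<longlonglongrightarrow> q \<bullet> v + 0 * norm v"
    by (intro tendsto_intros r inv)
  then have av: "a \<le> q \<bullet> v" using *(5) by (intro LIMSEQ_le_const[of _ _ a]) auto
  have "GDERIV f 0 :> q" unfolding GDERIV_iff_eps
  proof (intro allI impI)
    fix e :: real assume "e > 0"
    have "(\<lambda>k. norm (p (r k) - q) + 3 * inverse (real (Suc (r k)))) \<longlonglongrightarrow> norm (q - q) + 3 * 0"
      by (intro tendsto_intros r inv)
    then have "\<forall>\<^sub>F k in sequentially. norm (p (r k) - q) + 3 * inverse (real (Suc (r k))) < e"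
      by (rule order_tendstoD(2)) (use \<open>e > 0\<close> in simp)
    then obtain j where j: "norm (p (r j) - q) + 3 * inverse (real (Suc (r j))) < e" by (auto simp: eventually_sequentially)
    define k where "k = r j"
    have "\<bar>f h - f 0 - h \<bullet> q\<bar> \<le> e * norm h" if h: "norm h < \<rho> k" for h
    proof -
      have 1: "(p k - q) \<bullet> h \<le> norm (p k - q) * norm h" by (rule norm_cauchy_schwarz)
      have 2: "(q - p' k) \<bullet> h \<le> norm (q - p' k) * norm h" by (rule norm_cauchy_schwarz)
      have "norm (q - p' k) \<le> norm (p k - q) + 2 * inverse (real (Suc k))"
        using pp'[of k] norm_triangle_ineq[of "q - p k" "p k - p' k"] by (simp add: norm_minus_commute)
      then have 3: "norm (q - p' k) * norm h \<le> (norm (p k - q) + 2 * inverse (real (Suc k))) * norm h" by (intro mult_right_mono) auto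
      have 4: "(norm (p k - q) + 3 * inverse (real (Suc k))) * norm h \<le> e * norm h"
        using j unfolding k_def by (intro mult_right_mono) auto
      have 5: "0 \<le> inverse (real (Suc k)) * norm h" by simp
      show ?thesis
        using *(3)[of h k] *(4)[of h k] h 1 2 3 4 5 unfolding inner_diff_left inner_commute[of h q] distrib_right abs_le_iff by linarith
    qed
    then show "\<exists>\<rho>>0. \<forall>h. norm h < \<rho> \<longrightarrow> \<bar>f (0 + h) - f 0 - h \<bullet> q\<bar> \<le> e * norm h"
      using *(1)[of k] by (intro exI[of _ "\<rho> k"]) auto
  qed
  then show ?thesis using that av by blast
qed

text \<open>Differentiability is expressed by countably many conditions: accuracies and radii
  \<open>1 / (k + 1)\<close>, slopes from a countable dense set. Each condition is closed by
  continuity of \<open>u\<close>. Conversely, the slopes for different accuracies are combined by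
  \<open>GDERIV_two_sided_limit\<close>, which wants them bounded.\<close>

lemma torus_differentiable_borel:
  assumes u: "continuous_on UNIV u"
  shows "{x. torus_differentiable u x} \<in> sets borel"
proof -
  obtain Q :: "(real ^ 'a) set" where Q: "countable Q" "\<And>X. open X \<Longrightarrow> X \<noteq> {} \<Longrightarrow> \<exists>d\<in>Q. d \<in> X"
    using countable_dense_setE by blast
  define S where "S \<epsilon> \<rho> q = {x. \<forall>h. norm h < \<rho> \<longrightarrow> \<bar>u (torus_shift x h) - u x - h \<bullet> q\<bar> \<le> \<epsilon> * norm h}" for \<epsilon> \<rho> and q :: "real ^ 'a"
  have "closed (S \<epsilon> \<rho> q)" for \<epsilon> \<rho> q
  proof -
    have "S \<epsilon> \<rho> q = (\<Inter>h\<in>{h. norm h < \<rho>}. {x. \<bar>u (torus_shift x h) - u x - h \<bullet> q\<bar> \<le> \<epsilon> * norm h})" unfolding S_def by blast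
    also have "closed \<dots>"
      by (intro closed_INT ballI closed_Collect_le continuous_intros continuous_on_compose2[OF u] u) auto
    finally show ?thesis .
  qed
  then have Sb: "S \<epsilon> \<rho> q \<in> sets borel" for \<epsilon> \<rho> q by simp
  let ?i = "\<lambda>k :: nat. inverse (real (Suc k))"
  have "{x. torus_differentiable u x} = (\<Inter>k. \<Union>j. \<Union>q\<in>Q. S (?i k) (?i j) q)"
  proof (intro equalityI subsetI INT_I)
    fix x k assume "x \<in> {x. torus_differentiable u x}"
    then have d: "torus_differentiable u x" by simp
    obtain \<rho> where \<rho>: "\<rho> > 0" "\<And>h. norm h < \<rho> \<Longrightarrow> \<bar>u (torus_shift x h) - u x - torus_gradient u x \<bullet> h\<bar> \<le> ?i k / 2 * norm h"
      using torus_differentiable_eps[OF d, of "?i k / 2"] by auto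
    obtain j where j: "?i j < \<rho>" using reals_Archimedean[OF \<rho>(1)] by blast
    obtain q where q: "q \<in> Q" "q \<in> ball (torus_gradient u x) (?i k / 2)"
      using Q(2)[of "ball (torus_gradient u x) (?i k / 2)"] by (metis ball_eq_empty half_gt_zero inverse_positive_iff_positive not_le of_nat_0_less_iff open_ball zero_less_Suc)
    have "x \<in> S (?i k) (?i j) q" unfolding S_def
    proof (intro CollectI allI impI)
      fix h :: "real ^ 'a" assume h: "norm h < ?i j"
      have "\<bar>(torus_gradient u x - q) \<bullet> h\<bar> \<le> norm (torus_gradient u x - q) * norm h" by (rule Cauchy_Schwarz_ineq2)
      also have "\<dots> \<le> ?i k / 2 * norm h" using q(2) by (intro mult_right_mono) (auto simp: dist_norm)
      finally show "\<bar>u (torus_shift x h) - u x - h \<bullet> q\<bar> \<le> ?i k * norm h"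
        using \<rho>(2)[OF less_trans[OF h j]] unfolding inner_diff_left inner_commute[of h q] by linarith
    qed
    then show "x \<in> (\<Union>j. \<Union>q\<in>Q. S (?i k) (?i j) q)" using q(1) by blast
  next
    fix x assume x: "x \<in> (\<Inter>k. \<Union>j. \<Union>q\<in>Q. S (?i k) (?i j) q)"
    have main: "\<exists>\<rho>>0. \<exists>q. \<forall>h. norm h \<le> \<rho> \<longrightarrow> \<bar>u (torus_shift x h) - u x - h \<bullet> q\<bar> \<le> \<epsilon> * norm h" if "\<epsilon> > 0" for \<epsilon>
    proof -
      obtain k where k: "?i k < \<epsilon>" using reals_Archimedean[OF \<open>\<epsilon> > 0\<close>] by blast
      obtain j q where jq: "x \<in> S (?i k) (?i j) q" using x by blast
      show ?thesis
      proof (intro exI[of _ "?i j / 2"] exI[of _ q] conjI allI impI)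
        fix h :: "real ^ 'a" assume "norm h \<le> ?i j / 2"
        moreover have "?i j > 0" by simp
        ultimately have "norm h < ?i j" by linarith
        then have "\<bar>u (torus_shift x h) - u x - h \<bullet> q\<bar> \<le> ?i k * norm h" using jq unfolding S_def by blast
        also have "\<dots> \<le> \<epsilon> * norm h" using k by (intro mult_right_mono) auto
        finally show "\<bar>u (torus_shift x h) - u x - h \<bullet> q\<bar> \<le> \<epsilon> * norm h" .
      qed simp
    qed
    obtain \<rho>1 q1 where q1: "\<rho>1 > 0" "\<And>h. norm h \<le> \<rho>1 \<Longrightarrow> \<bar>u (torus_shift x h) - u x - h \<bullet> q1\<bar> \<le> 1 * norm h"
      using main[of 1] by auto
    \<comment> \<open>Comparison with the fixed slope \<open>q1\<close> on a common ball, in the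
      direction of \<open>q\<close>, bounds every other slope.\<close>
    have bound: "norm q \<le> norm q1 + 1 + \<epsilon>"
      if "\<rho> > 0" and q: "\<And>h. norm h \<le> \<rho> \<Longrightarrow> \<bar>u (torus_shift x h) - u x - h \<bullet> q\<bar> \<le> \<epsilon> * norm h" for \<epsilon> \<rho> q
    proof (cases "q = 0")
      case False
      define s where "s = min \<rho> \<rho>1"
      define h where "h = (s / norm q) *\<^sub>R q"
      have s: "s > 0" using q1(1) \<open>\<rho> > 0\<close> unfolding s_def by simp
      have h: "norm h = s" using False s by (simp add: h_def)
      have "h \<bullet> q = s * norm q" using False by (simp add: h_def dot_square_norm power2_eq_square)
      moreover have "h \<bullet> q - h \<bullet> q1 \<le> (1 + \<epsilon>) * s"
      proof -
        have "norm h \<le> \<rho>" "norm h \<le> \<rho>1" using h unfolding s_def by auto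
        from q[OF this(1)] q1(2)[OF this(2)] show ?thesis unfolding h distrib_right by linarith
      qed
      moreover have "h \<bullet> q1 \<le> s * norm q1" using norm_cauchy_schwarz[of h q1] h by simp
      ultimately have "s * norm q \<le> s * (norm q1 + 1 + \<epsilon>)" by (simp add: algebra_simps)
      then show ?thesis using s by simp
    next
      case True
      have "0 \<le> \<epsilon> * \<rho>" using q[of "\<rho> *\<^sub>R axis undefined 1"] \<open>\<rho> > 0\<close> by (simp add: norm_axis_1)
      then have "0 \<le> \<epsilon>" using \<open>\<rho> > 0\<close> by (simp add: zero_le_mult_iff)
      then show ?thesis using True by simp
    qed
    have "\<exists>\<rho>>0. \<exists>p p'. norm p \<le> norm q1 + 2 \<and> (\<forall>h. norm h \<le> \<rho> \<longrightarrow> u (torus_shift x h) - u (torus_shift x 0) \<le> p \<bullet> h + \<epsilon> * norm h) \<and>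
      (\<forall>h. norm h \<le> \<rho> \<longrightarrow> p' \<bullet> h - \<epsilon> * norm h \<le> u (torus_shift x h) - u (torus_shift x 0)) \<and> 0 \<le> p \<bullet> 0 + \<epsilon> * norm (0 :: real ^ 'a)" if "\<epsilon> > 0" for \<epsilon>
    proof -
      have "min \<epsilon> 1 > 0" using that by simp
      then obtain \<rho> q where q: "\<rho> > 0" "\<And>h. norm h \<le> \<rho> \<Longrightarrow> \<bar>u (torus_shift x h) - u x - h \<bullet> q\<bar> \<le> min \<epsilon> 1 * norm h"
        using main by blast
      have "norm q \<le> norm q1 + 2" using bound[OF q] by simp
      moreover have "\<bar>u (torus_shift x h) - u x - h \<bullet> q\<bar> \<le> \<epsilon> * norm h" if "norm h \<le> \<rho>" for h
        by (rule order_trans[OF q(2)[OF that]]) (intro mult_right_mono, auto)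
      ultimately show ?thesis using q(1)
        by (intro exI[of _ \<rho>] conjI exI[of _ q]) (auto simp: abs_le_iff inner_commute algebra_simps)
    qed
    then obtain q where "GDERIV (\<lambda>h. u (torus_shift x h)) 0 :> q"
      by (rule GDERIV_two_sided_limit[of "norm q1 + 2" "\<lambda>h. u (torus_shift x h)" 0 0])
    then show "x \<in> {x. torus_differentiable u x}" using torus_differentiableI(1) by blast
  qed
  also have "\<dots> \<in> sets borel"
    using Sb Q(1) by (intro sets.countable_INT sets.countable_UN image_subsetI sets.countable_UN'') auto
  finally show ?thesis .
qed

lemma torus_gradient_borel_measurable:
  assumes u: "continuous_on UNIV u"
  shows "torus_gradient u \<in> borel_measurable borel"
proof (rule borel_measurable_euclidean_space[THEN iffD2], rule ballI)
  fix i :: "real ^ 'a" assume "i \<in> Basis"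
  define D where "D = {x. torus_differentiable u x}"
  have D [measurable]: "D \<in> sets borel" unfolding D_def by (rule torus_differentiable_borel[OF u])
  \<comment> \<open>Off the set of differentiability no vector satisfies the description of the
    gradient, so the definite description takes this one default value at every such point.\<close>
  define z :: "real ^ 'a" where "z = (THE D. False)"
  have off: "torus_gradient u x = z" if "x \<notin> D" for x
  proof -
    have "\<not> GDERIV (\<lambda>v. u (torus_shift x v)) 0 :> p" for p using that torus_differentiableI(1) unfolding D_def by blast
    then have "gderiv (\<lambda>v. u (torus_shift x v)) 0 = (\<lambda>_. False)" by (simp add: fun_eq_iff)
    then show ?thesis unfolding torus_gradient_def gradient_def z_def by simp
  qed
  define q where "q n x = (if x \<in> D then real (Suc n) * (u (torus_shift x (inverse (real (Suc n)) *\<^sub>R i)) - u x) else z \<bullet> i)" for n x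
  show "(\<lambda>x. torus_gradient u x \<bullet> i) \<in> borel_measurable borel"
  proof (rule borel_measurable_LIMSEQ_real)
    have "(\<lambda>x. real (Suc n) * (u (torus_shift x (inverse (real (Suc n)) *\<^sub>R i)) - u x)) \<in> borel_measurable borel" for n
      by (intro borel_measurable_continuous_onI continuous_intros continuous_on_compose2[OF u] u) auto
    then show "q n \<in> borel_measurable borel" for n unfolding q_def using D by (intro measurable_If_set) auto
    fix x :: "'a torus"
    show "(\<lambda>n. q n x) \<longlonglongrightarrow> torus_gradient u x \<bullet> i"
    proof (cases "x \<in> D")
      case True
      then have d: "torus_differentiable u x" by (simp add: D_def)
      show ?thesis
      proof (rule LIMSEQ_I)
        fix e :: real assume "e > 0"
        obtain \<rho> where \<rho>: "\<rho> > 0" "\<And>h. norm h < \<rho> \<Longrightarrow> \<bar>u (torus_shift x h) - u x - torus_gradient u x \<bullet> h\<bar> \<le> e / 2 * norm h"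
          using torus_differentiable_eps[OF d, of "e / 2"] \<open>e > 0\<close> by auto
        obtain N where N: "inverse (real (Suc N)) < \<rho>" using reals_Archimedean[OF \<rho>(1)] by blast
        have "norm (q n x - torus_gradient u x \<bullet> i) < e" if "n \<ge> N" for n
        proof -
          let ?t = "inverse (real (Suc n))"
          have "?t \<le> inverse (real (Suc N))" using that by (intro le_imp_inverse_le) auto
          then have t: "?t < \<rho>" using N by linarith
          have "\<bar>u (torus_shift x (?t *\<^sub>R i)) - u x - torus_gradient u x \<bullet> (?t *\<^sub>R i)\<bar> \<le> e / 2 * norm (?t *\<^sub>R i)"
            using t \<open>i \<in> Basis\<close> by (intro \<rho>(2)) simp
          also have "e / 2 * norm (?t *\<^sub>R i) = e / 2 * ?t" using \<open>i \<in> Basis\<close> by simp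
          finally have "real (Suc n) * \<bar>u (torus_shift x (?t *\<^sub>R i)) - u x - ?t * (torus_gradient u x \<bullet> i)\<bar> \<le> real (Suc n) * (e / 2 * ?t)"
            by (intro mult_left_mono) auto
          also have "\<dots> = e / 2" by simp
          also have "real (Suc n) * \<bar>u (torus_shift x (?t *\<^sub>R i)) - u x - ?t * (torus_gradient u x \<bullet> i)\<bar>
              = \<bar>real (Suc n) * (u (torus_shift x (?t *\<^sub>R i)) - u x - ?t * (torus_gradient u x \<bullet> i))\<bar>" by (simp add: abs_mult)
          also have "real (Suc n) * (u (torus_shift x (?t *\<^sub>R i)) - u x - ?t * (torus_gradient u x \<bullet> i)) = q n x - torus_gradient u x \<bullet> i"
            using True unfolding q_def by (simp add: right_diff_distrib del: of_nat_Suc)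
          finally show ?thesis using \<open>e > 0\<close> by simp
        qed
        then show "\<exists>N. \<forall>n\<ge>N. norm (q n x - torus_gradient u x \<bullet> i) < e" by blast
      qed
    next
      case False
      then show ?thesis unfolding q_def off[OF False] by simp
    qed
  qed
qed

section \<open>Calibrated orbits and their perturbation\<close>

context bounded_lagrangian
begin

text \<open>Along a calibrated orbit each step is an equality; the competitor with velocities
  \<open>v k + e\<close> and positions shifted by \<open>d k\<close> satisfies the subsolution
  inequality. In the difference the momenta are paired with \<open>e\<close>, and shifting the
  positions costs at most \<open>\<Lambda> (r + 1) * D\<close> per unit time.\<close>

lemma perturbed_chain:
  fixes x :: "nat \<Rightarrow> 'n torus" and v d :: "nat \<Rightarrow> real ^ 'n"
  assumes \<tau>: "\<tau> > 0" and sub: "subsolution \<tau> c u"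
    and chain: "\<And>k. k < N \<Longrightarrow> x (Suc k) = torus_shift (x k) (\<tau> *\<^sub>R v k)" "\<And>k. k < N \<Longrightarrow> calibrated \<tau> c u (x k) (v k)"
      "\<And>k. k < N \<Longrightarrow> norm (v k) \<le> r"
    and expand: "\<And>x v. norm v \<le> r \<Longrightarrow> l x (v + e) \<le> l x v + \<beta> x v \<bullet> e + \<epsilon> * norm e" and e: "norm e \<le> 1"
    and d: "\<And>k. k < N \<Longrightarrow> d (Suc k) = d k + \<tau> *\<^sub>R e" "\<And>k. k < N \<Longrightarrow> norm (d k) \<le> D"
  shows "u (torus_shift (x N) (d N)) - u (torus_shift (x 0) (d 0))
    \<le> u (x N) - u (x 0) + real N * \<tau> * (\<Lambda> (r + 1) * D + \<epsilon> * norm e) + \<tau> * ((\<Sum>k<N. \<beta> (x k) (v k)) \<bullet> e)"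
proof -
  have "u (torus_shift (x n) (d n)) - u (torus_shift (x 0) (d 0))
    \<le> u (x n) - u (x 0) + real n * \<tau> * (\<Lambda> (r + 1) * D + \<epsilon> * norm e) + \<tau> * ((\<Sum>k<n. \<beta> (x k) (v k)) \<bullet> e)" if "n \<le> N" for n
    using that
  proof (induction n)
    case (Suc k)
    then have k: "k < N" by simp
    let ?y = "torus_shift (x k) (d k)"
    have "torus_shift ?y (\<tau> *\<^sub>R (v k + e)) = torus_shift (x (Suc k)) (d (Suc k))"
      unfolding chain(1)[OF k] d(1)[OF k] by (simp add: scaleR_add_right algebra_simps)
    then have "u (torus_shift (x (Suc k)) (d (Suc k))) + \<tau> * c \<le> u ?y + \<tau> * l ?y (v k + e)"
      using sub unfolding subsolution_def by metis
    moreover have "u (x (Suc k)) + \<tau> * c = u (x k) + \<tau> * l (x k) (v k)"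
      using chain(2)[OF k] unfolding calibrated_def chain(1)[OF k] .
    moreover have "l ?y (v k + e) \<le> l (x k) (v k) + \<beta> (x k) (v k) \<bullet> e + (\<Lambda> (r + 1) * D + \<epsilon> * norm e)"
    proof -
      have "norm (v k + e) \<le> r + 1" using chain(3)[OF k] e norm_triangle_ineq[of "v k" e] by linarith
      then have "l ?y (v k + e) \<le> l (x k) (v k + e) + \<Lambda> (r + 1) * dist ?y (x k)"
        using lipschitz_x[of "v k + e" "r + 1" ?y "x k"] by (simp add: abs_le_iff)
      also have "\<Lambda> (r + 1) * dist ?y (x k) \<le> \<Lambda> (r + 1) * D"
        using dist_torus_shift[of "x k" "d k"] d(2)[OF k] by (intro mult_left_mono \<Lambda>_nonneg) (simp add: dist_commute)
      finally show ?thesis using expand[OF chain(3)[OF k], of "x k"] by linarith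
    qed
    then have "\<tau> * l ?y (v k + e) \<le> \<tau> * (l (x k) (v k) + \<beta> (x k) (v k) \<bullet> e + (\<Lambda> (r + 1) * D + \<epsilon> * norm e))"
      using \<tau> by simp
    ultimately show ?case using Suc by (simp add: algebra_simps inner_add_left)
  qed simp
  then show ?thesis by simp
qed

lemma weak_kam_subsolution: "weak_kam \<tau> c u \<Longrightarrow> subsolution \<tau> c u"
  unfolding weak_kam_def by blast

lemma backward_orbit:
  assumes "\<tau> > 0" "weak_kam \<tau> c u"
  obtains z w where "z 0 = y" "\<And>j. torus_shift (z (Suc j)) (\<tau> *\<^sub>R w j) = z j"
    "\<And>j. calibrated \<tau> c u (z (Suc j)) (w j)" "\<And>j. norm (w j) \<le> Rv"
proof -
  have "\<exists>z. torus_shift (fst z) (\<tau> *\<^sub>R snd z) = y \<and> calibrated \<tau> c u (fst z) (snd z)" for y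
    using weak_kamD(3)[OF assms(2), of y] by auto
  then obtain P where P: "\<And>y. torus_shift (fst (P y)) (\<tau> *\<^sub>R snd (P y)) = y" "\<And>y. calibrated \<tau> c u (fst (P y)) (snd (P y))"
    by metis
  define z where "z j = ((\<lambda>y. fst (P y)) ^^ j) y" for j :: nat
  have zS: "z (Suc j) = fst (P (z j))" for j by (simp add: z_def)
  show ?thesis
  proof (rule that[of z "\<lambda>j. snd (P (z j))"])
    show "calibrated \<tau> c u (z (Suc j)) (snd (P (z j)))" for j unfolding zS by (rule P(2))
    show "norm (snd (P (z j))) \<le> Rv" for j by (rule calibrated_bounded[OF assms P(2)])
    show "torus_shift (z (Suc j)) (\<tau> *\<^sub>R snd (P (z j))) = z j" for j unfolding zS by (rule P(1))
    show "z 0 = y" by (simp add: z_def)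
  qed
qed

text \<open>Weak KAM solutions provide calibrated orbits backward in time only; having forward ones
  is a property of the point. Finite lengths and speeds at most \<open>Rv\<close> keep the set of
  such points closed.\<close>

primrec forward_calibrated :: "real \<Rightarrow> real \<Rightarrow> ('n torus \<Rightarrow> real) \<Rightarrow> nat \<Rightarrow> 'n torus \<Rightarrow> bool" where
  "forward_calibrated \<tau> c u 0 x \<longleftrightarrow> True"
| "forward_calibrated \<tau> c u (Suc k) x \<longleftrightarrow>
     (\<exists>v. norm v \<le> Rv \<and> calibrated \<tau> c u x v \<and> forward_calibrated \<tau> c u k (torus_shift x (\<tau> *\<^sub>R v)))"

lemma forward_orbit:
  assumes "forward_calibrated \<tau> c u N y"
  shows "\<exists>x v. x 0 = y \<and> (\<forall>k<N. x (Suc k) = torus_shift (x k) (\<tau> *\<^sub>R v k) \<and> calibrated \<tau> c u (x k) (v k) \<and> norm (v k) \<le> Rv)"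
  using assms
proof (induction N arbitrary: y)
  case (Suc N)
  then obtain v0 where v0: "norm v0 \<le> Rv" "calibrated \<tau> c u y v0" "forward_calibrated \<tau> c u N (torus_shift y (\<tau> *\<^sub>R v0))" by auto
  obtain x v where xv: "x 0 = torus_shift y (\<tau> *\<^sub>R v0)"
    "\<And>k. k < N \<Longrightarrow> x (Suc k) = torus_shift (x k) (\<tau> *\<^sub>R v k) \<and> calibrated \<tau> c u (x k) (v k) \<and> norm (v k) \<le> Rv"
    using Suc.IH[OF v0(3)] by blast
  show ?case
  proof (intro exI[of _ "case_nat y x"] exI[of _ "case_nat v0 v"] conjI allI impI)
    fix k assume "k < Suc N"
    then show "case_nat y x (Suc k) = torus_shift (case_nat y x k) (\<tau> *\<^sub>R case_nat v0 v k)"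
      "calibrated \<tau> c u (case_nat y x k) (case_nat v0 v k)" "norm (case_nat v0 v k) \<le> Rv"
      using xv(1) xv(2)[of "k - 1"] v0 by (cases k; simp)+
  qed simp
qed auto

lemma closed_calibrated:
  assumes "continuous_on UNIV u" shows "closed {z. calibrated \<tau> c u (fst z) (snd z)}"
  unfolding calibrated_def
  by (intro closed_Collect_eq continuous_intros continuous_on_compose2[OF assms]) auto

text \<open>The set for \<open>Suc k\<close> is the projection, along the velocity, of a compact
  set, velocities being confined to a ball.\<close>

lemma closed_forward_calibrated:
  assumes u: "continuous_on UNIV u"
  shows "closed {x. forward_calibrated \<tau> c u k x}"
proof (induction k)
  case (Suc k)
  let ?K = "(UNIV \<times> cball 0 Rv) \<inter> ({z. calibrated \<tau> c u (fst z) (snd z)}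
    \<inter> (\<lambda>z. torus_shift (fst z) (\<tau> *\<^sub>R snd z)) -` {x. forward_calibrated \<tau> c u k x})"
  have "{x. forward_calibrated \<tau> c u (Suc k) x} = fst ` ?K" by (force simp: image_iff)
  moreover have "compact ?K"
  proof (rule compact_Int_closed)
    show "compact ((UNIV :: 'n torus set) \<times> (cball 0 Rv :: (real ^ 'n) set))" by (intro compact_Times compact_torus compact_cball)
    show "closed ({z. calibrated \<tau> c u (fst z) (snd z)} \<inter> (\<lambda>z. torus_shift (fst z) (\<tau> *\<^sub>R snd z)) -` {x. forward_calibrated \<tau> c u k x})"
      by (intro closed_Int closed_calibrated u closed_vimage Suc continuous_intros)
  qed
  ultimately show ?case
    by (metis (no_types, lifting) compact_continuous_image[OF continuous_on_fst[OF continuous_on_id]] compact_imp_closed)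
qed simp

text \<open>Shifting the orbit of length about \<open>\<epsilon>\<close> linearly in time gives a competitor, so \<open>u\<close> has
  first-order upper bounds at every point and lower bounds at points with a forward calibrated orbit.\<close>

lemma first_order_bounds:
  assumes \<tau>: "0 < \<tau>" "\<tau> \<le> \<epsilon>" and u: "weak_kam \<tau> c u"
    and expand: "\<And>x v e. norm v \<le> Rv \<Longrightarrow> norm e \<le> \<delta> \<Longrightarrow> l x (v + e) \<le> l x v + \<beta> x v \<bullet> e + \<epsilon> * norm e"
    and \<delta>: "0 < \<delta>" "\<delta> \<le> 1" and \<beta>: "\<And>x v. norm v \<le> Rv \<Longrightarrow> norm (\<beta> x v) \<le> P"
  defines "K \<equiv> 2 * \<Lambda> (Rv + 1) + 1"
  shows "\<exists>p. norm p \<le> P \<and> (\<forall>h. norm h \<le> \<delta> * \<epsilon> \<longrightarrow> u (torus_shift y h) - u y \<le> p \<bullet> h + K * \<epsilon> * norm h)"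
    and "(\<And>N. forward_calibrated \<tau> c u N y) \<Longrightarrow>
      \<exists>p. norm p \<le> P \<and> (\<forall>h. norm h \<le> \<delta> * \<epsilon> \<longrightarrow> p \<bullet> h - K * \<epsilon> * norm h \<le> u (torus_shift y h) - u y)"
proof -
  \<comment> \<open>About \<open>\<epsilon> / \<tau>\<close> steps, so the time span
    \<open>T\<close> lies between \<epsilon> and \<open>2 * \<epsilon>\<close> however small \<tau>
    is.\<close>
  define N where "N = nat \<lceil>\<epsilon> / \<tau>\<rceil>"
  have "1 \<le> \<epsilon> / \<tau>" using \<tau> by simp
  then have N: "N > 0" "\<epsilon> / \<tau> \<le> real N" "real N \<le> \<epsilon> / \<tau> + 1" unfolding N_def by linarith+
  define T where "T = real N * \<tau>"
  have T: "\<epsilon> \<le> T" "T \<le> 2 * \<epsilon>" using N(2,3) \<tau> unfolding T_def by (auto simp: field_simps)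
  have "\<epsilon> > 0" using \<tau> by linarith
  have main: "u (torus_shift (x N) (d N)) - u (torus_shift (x 0) (d 0))
    \<le> u (x N) - u (x 0) + ((1 / real N) *\<^sub>R (\<Sum>k<N. \<beta> (x k) (v k))) \<bullet> g + K * \<epsilon> * norm h"
    if x: "\<And>k. k < N \<Longrightarrow> x (Suc k) = torus_shift (x k) (\<tau> *\<^sub>R v k)" "\<And>k. k < N \<Longrightarrow> calibrated \<tau> c u (x k) (v k)"
      "\<And>k. k < N \<Longrightarrow> norm (v k) \<le> Rv" and h: "norm h \<le> \<delta> * \<epsilon>" "norm g = norm h"
      and d: "\<And>k. d (Suc k) = d k + (1 / real N) *\<^sub>R g" "\<And>k. k < N \<Longrightarrow> norm (d k) \<le> norm h" for x v d g h
  proof -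
    \<comment> \<open>The constant change of velocity that produces the displacement
      \<open>g\<close> over the time \<open>T\<close>. As \<open>T \<ge> \<epsilon>\<close>, the
      restriction \<open>norm h \<le> \<delta> * \<epsilon>\<close> keeps it within \<delta>, where
      the expansion of the Lagrangian is available.\<close>
    define e where "e = (1 / T) *\<^sub>R g"
    have \<tau>e: "\<tau> *\<^sub>R e = (1 / real N) *\<^sub>R g" using \<tau> N(1) by (simp add: e_def T_def)
    have ne: "T * norm e = norm h" using T(1) \<open>\<epsilon> > 0\<close> h(2) by (simp add: e_def)
    have "norm e \<le> norm h / \<epsilon>" using T(1) \<open>\<epsilon> > 0\<close> h(2) by (simp add: e_def frac_le)
    also have "\<dots> \<le> \<delta>" using h(1) \<open>\<epsilon> > 0\<close> by (simp add: divide_le_eq)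
    finally have e: "norm e \<le> \<delta>" .
    have "u (torus_shift (x N) (d N)) - u (torus_shift (x 0) (d 0))
      \<le> u (x N) - u (x 0) + real N * \<tau> * (\<Lambda> (Rv + 1) * norm h + \<epsilon> * norm e) + \<tau> * ((\<Sum>k<N. \<beta> (x k) (v k)) \<bullet> e)"
      using \<tau> u e \<delta> d expand[OF _ e]
      by (intro perturbed_chain[where c = c] x weak_kam_subsolution) (auto simp: \<tau>e)
    \<comment> \<open>Origin of \<open>K\<close>: the shifted positions cost
      \<open>T \<le> 2 * \<epsilon>\<close> times \<open>\<Lambda> (Rv + 1) * norm h\<close>, and
      the expansion error adds \<open>\<epsilon> * norm h\<close>.\<close>
    also have "real N * \<tau> * (\<Lambda> (Rv + 1) * norm h + \<epsilon> * norm e) = T * (\<Lambda> (Rv + 1) * norm h) + \<epsilon> * norm h"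
      unfolding T_def[symmetric] ne[symmetric] by (simp add: distrib_left)
    also have "T * (\<Lambda> (Rv + 1) * norm h) \<le> 2 * \<epsilon> * (\<Lambda> (Rv + 1) * norm h)"
      using T(2) \<Lambda>_nonneg by (intro mult_right_mono) auto
    also have "\<tau> * ((\<Sum>k<N. \<beta> (x k) (v k)) \<bullet> e) = (\<Sum>k<N. \<beta> (x k) (v k)) \<bullet> (\<tau> *\<^sub>R e)" by simp
    also have "\<dots> = ((1 / real N) *\<^sub>R (\<Sum>k<N. \<beta> (x k) (v k))) \<bullet> g" unfolding \<tau>e by simp
    finally show ?thesis unfolding K_def by (simp add: algebra_simps)
  qed
  have avg: "norm ((1 / real N) *\<^sub>R (\<Sum>k<N. \<beta> (x k) (v k))) \<le> P" if "\<And>k. k < N \<Longrightarrow> norm (v k) \<le> Rv" for x v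
  proof -
    have "norm (\<Sum>k<N. \<beta> (x k) (v k)) \<le> (\<Sum>k<N. P)" using that \<beta> by (intro order_trans[OF norm_sum] sum_mono) auto
    then show ?thesis using N(1) by (simp add: field_simps)
  qed
  show "\<exists>p. norm p \<le> P \<and> (\<forall>h. norm h \<le> \<delta> * \<epsilon> \<longrightarrow> u (torus_shift y h) - u y \<le> p \<bullet> h + K * \<epsilon> * norm h)"
  proof -
    obtain z w where zw: "z 0 = y" "\<And>j. torus_shift (z (Suc j)) (\<tau> *\<^sub>R w j) = z j"
      "\<And>j. calibrated \<tau> c u (z (Suc j)) (w j)" "\<And>j. norm (w j) \<le> Rv" using backward_orbit[OF \<tau>(1) u] by blast
    \<comment> \<open>Time reversal: \<open>x 0\<close> is the far end of the backward orbit and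
      \<open>x N\<close> is \<open>y\<close>.\<close>
    define x v where "x k = z (N - k)" and "v k = w (N - Suc k)" for k
    have x: "x (Suc k) = torus_shift (x k) (\<tau> *\<^sub>R v k)" "calibrated \<tau> c u (x k) (v k)" "norm (v k) \<le> Rv" if "k < N" for k
      using zw(2,3,4)[of "N - Suc k"] that unfolding x_def v_def by (simp_all add: Suc_diff_Suc)
    show ?thesis
    proof (intro exI conjI allI impI)
      fix h :: "real ^ 'n" assume h: "norm h \<le> \<delta> * \<epsilon>"
      \<comment> \<open>Shift 0 at the far end and \<open>h\<close> at \<open>y\<close>: the value
        at the displaced end point is bounded from above.\<close>
      define d where "d k = (real k / real N) *\<^sub>R h" for k
      have "norm (d k) \<le> norm h" if "k < N" for k
      proof -
        have "real k / real N * norm h \<le> 1 * norm h" using that by (intro mult_right_mono) auto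
        then show ?thesis by (simp add: d_def)
      qed
      moreover have "d (Suc k) = d k + (1 / real N) *\<^sub>R h" for k
        by (simp add: d_def add_divide_distrib scaleR_left_distrib add.commute)
      ultimately show "u (torus_shift y h) - u y \<le> ((1 / real N) *\<^sub>R (\<Sum>k<N. \<beta> (x k) (v k))) \<bullet> h + K * \<epsilon> * norm h"
        using main[of x v h h d, OF x h refl] N(1) zw(1) by (simp add: d_def x_def)
    qed (rule avg[OF x(3)])
  qed
  assume "\<And>N. forward_calibrated \<tau> c u N y"
  then obtain x v where x0: "x 0 = y"
    and x: "\<And>k. k < N \<Longrightarrow> x (Suc k) = torus_shift (x k) (\<tau> *\<^sub>R v k)" "\<And>k. k < N \<Longrightarrow> calibrated \<tau> c u (x k) (v k)"
      "\<And>k. k < N \<Longrightarrow> norm (v k) \<le> Rv" using forward_orbit[of \<tau> c u N y] by blast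
  show "\<exists>p. norm p \<le> P \<and> (\<forall>h. norm h \<le> \<delta> * \<epsilon> \<longrightarrow> p \<bullet> h - K * \<epsilon> * norm h \<le> u (torus_shift y h) - u y)"
  proof (intro exI conjI allI impI)
    fix h :: "real ^ 'n" assume h: "norm h \<le> \<delta> * \<epsilon>"
    \<comment> \<open>Now \<open>y\<close> is the start of the orbit. With shift \<open>h\<close> at
      \<open>y\<close> and 0 at the other end, the displaced value enters with a minus sign, which
      yields the lower bound.\<close>
    define d where "d k = (1 - real k / real N) *\<^sub>R h" for k
    have "norm (d k) \<le> norm h" if "k < N" for k
    proof -
      have "\<bar>1 - real k / real N\<bar> * norm h \<le> 1 * norm h" using that by (intro mult_right_mono) auto
      then show ?thesis by (simp add: d_def)
    qed
    moreover have "d (Suc k) = d k + (1 / real N) *\<^sub>R (- h)" for k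
      by (simp add: d_def add_divide_distrib algebra_simps scaleR_left_distrib)
    ultimately show "((1 / real N) *\<^sub>R (\<Sum>k<N. \<beta> (x k) (v k))) \<bullet> h - K * \<epsilon> * norm h \<le> u (torus_shift y h) - u y"
      using main[of x v h "- h" d, OF x h] N(1) x0 by (simp add: d_def)
  qed (rule avg[OF x(3)])
qed

end

section \<open>The limit of vanishing time step\<close>

lemma nat_ceiling_step:
  assumes "t > 0" "\<tau> > 0"
  shows "t \<le> real (nat \<lceil>t / \<tau>\<rceil>) * \<tau>" "real (nat \<lceil>t / \<tau>\<rceil>) * \<tau> \<le> t + \<tau>"
proof -
  have "t / \<tau> > 0" using assms by simp
  then have "t / \<tau> \<le> real (nat \<lceil>t / \<tau>\<rceil>)" "real (nat \<lceil>t / \<tau>\<rceil>) \<le> t / \<tau> + 1" by linarith+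
  from mult_right_mono[OF this(1), of \<tau>] mult_right_mono[OF this(2), of \<tau>] assms
  show "t \<le> real (nat \<lceil>t / \<tau>\<rceil>) * \<tau>" "real (nat \<lceil>t / \<tau>\<rceil>) * \<tau> \<le> t + \<tau>"
    by (simp_all add: distrib_right)
qed

lemma nat_ceiling_step_tendsto:
  assumes "t > 0" "\<And>i. \<tau> i > 0" "\<tau> \<longlonglongrightarrow> 0"
  shows "(\<lambda>i. real (nat \<lceil>t / \<tau> i\<rceil>) * \<tau> i) \<longlonglongrightarrow> t"
proof (rule tendsto_sandwich[of "\<lambda>_. t" _ _ "\<lambda>i. t + \<tau> i"])
  show "(\<lambda>i. t + \<tau> i) \<longlonglongrightarrow> t" using tendsto_add[OF tendsto_const assms(3), of t] by simp
qed (use nat_ceiling_step[OF assms(1,2)] in auto)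

context bounded_lagrangian
begin

text \<open>For a fixed momentum \<open>p\<close> the Lagrangian is bounded below by
  \<open>p \<bullet> v - G x\<close>. Summed along a backward orbit, the linear part depends only on
  the total displacement \<open>V j\<close>, and \<open>G\<close> can be frozen at \<open>y\<close>
  at the cost of \<open>K\<close> times the distance travelled.\<close>

lemma backward_orbit_lower:
  assumes z: "z 0 = y" "\<And>j. torus_shift (z (Suc j)) (\<tau> *\<^sub>R w j) = z j" "\<And>j. calibrated \<tau> c u (z (Suc j)) (w j)" "\<And>j. norm (w j) \<le> r"
    and \<tau>: "\<tau> > 0" and G: "\<And>x v. p \<bullet> v - G x \<le> l x v" "\<And>x x'. \<bar>G x - G x'\<bar> \<le> K * dist x x'" "K \<ge> 0" and "j \<le> N"
  defines "V \<equiv> \<lambda>j. \<tau> *\<^sub>R (\<Sum>i<j. w i)"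
  shows "z j = torus_shift y (- V j)" "norm (V j) \<le> real j * \<tau> * r"
    "p \<bullet> V j - real j * \<tau> * (G y + c + K * (real N * \<tau> * r)) \<le> u y - u (z j)"
proof -
  have r: "0 \<le> r" using z(4)[of 0] norm_ge_zero by (rule order_trans[rotated])
  have zV: "z j = torus_shift y (- V j)" for j
  proof (induction j)
    case (Suc j)
    have "z (Suc j) = torus_shift (torus_shift (z (Suc j)) (\<tau> *\<^sub>R w j)) (- (\<tau> *\<^sub>R w j))" by simp
    also have "\<dots> = torus_shift (torus_shift y (- V j)) (- (\<tau> *\<^sub>R w j))" unfolding z(2) Suc ..
    also have "\<dots> = torus_shift y (- V (Suc j))" by (simp add: V_def scaleR_add_right)
    finally show ?case .
  qed (simp add: z V_def)
  have nV: "norm (V j) \<le> real j * \<tau> * r" for j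
  proof -
    have "norm (\<Sum>i<j. w i) \<le> (\<Sum>i<j. r)" using z(4) by (intro order_trans[OF norm_sum] sum_mono) auto
    then show ?thesis using \<tau> by (simp add: V_def algebra_simps mult_left_mono)
  qed
  show "z j = torus_shift y (- V j)" "norm (V j) \<le> real j * \<tau> * r" by (rule zV, rule nV)
  have "p \<bullet> V j - real j * \<tau> * (G y + c + K * (real N * \<tau> * r)) \<le> u y - u (z j)" if "j \<le> N" for j
    using that
  proof (induction j)
    case (Suc j)
    have "dist (z (Suc j)) y \<le> real N * \<tau> * r"
    proof -
      have "dist y (z (Suc j)) \<le> norm (- V (Suc j))" unfolding zV[of "Suc j"] by (rule dist_torus_shift)
      also have "\<dots> \<le> real (Suc j) * \<tau> * r" using nV[of "Suc j"] by simp
      also have "\<dots> \<le> real N * \<tau> * r" using Suc.prems \<tau> r by (intro mult_right_mono) auto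
      finally show ?thesis by (simp add: dist_commute)
    qed
    then have "K * dist (z (Suc j)) y \<le> K * (real N * \<tau> * r)" using G(3) by (rule mult_left_mono)
    then have "p \<bullet> w j - (G y + K * (real N * \<tau> * r)) \<le> l (z (Suc j)) (w j)"
      using G(1)[of "w j" "z (Suc j)"] G(2)[of "z (Suc j)" y] by linarith
    then have "\<tau> * (p \<bullet> w j - (G y + K * (real N * \<tau> * r))) \<le> \<tau> * l (z (Suc j)) (w j)" using \<tau> by simp
    moreover have "u (z j) + \<tau> * c = u (z (Suc j)) + \<tau> * l (z (Suc j)) (w j)"
      using z(3)[of j] unfolding calibrated_def z(2) .
    ultimately show ?case using Suc by (simp add: V_def algebra_simps inner_add_right)
  qed (simp add: z V_def)
  then show "p \<bullet> V j - real j * \<tau> * (G y + c + K * (real N * \<tau> * r)) \<le> u y - u (z j)" using \<open>j \<le> N\<close> .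
qed

end

text \<open>Points of \<open>A n\<close> are chosen within \<open>1 / (n + 1)\<close> of the infimal
  distance, so the sequence is defined from the first index on.\<close>

lemma approximating_sequence:
  fixes z :: "'a::metric_space"
  assumes "\<forall>e>0. \<forall>\<^sub>F n in sequentially. \<exists>z'\<in>A n. dist z z' < e" "\<And>n. A n \<noteq> {}"
  obtains y where "\<And>n. y n \<in> A n" "y \<longlonglongrightarrow> z"
proof -
  have "\<exists>z'\<in>A n. dist z z' < infdist z (A n) + inverse (real (Suc n))" for n
  proof (rule ccontr)
    assume "\<not> ?thesis"
    then have "infdist z (A n) + inverse (real (Suc n)) \<le> infdist z (A n)"
      unfolding infdist_notempty[OF assms(2)] by (intro cINF_greatest assms(2)) (auto simp: not_less)
    moreover have "inverse (real (Suc n)) > 0" by simp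
    ultimately show False by linarith
  qed
  then obtain y where y: "\<And>n. y n \<in> A n" "\<And>n. dist z (y n) < infdist z (A n) + inverse (real (Suc n))" by metis
  have "(\<lambda>n. infdist z (A n)) \<longlonglongrightarrow> 0"
  proof (rule tendstoI)
    fix e :: real assume "e > 0"
    then have "\<forall>\<^sub>F n in sequentially. \<exists>z'\<in>A n. dist z z' < e" using assms(1) by blast
    then show "\<forall>\<^sub>F n in sequentially. dist (infdist z (A n)) 0 < e"
    proof eventually_elim
      case (elim n)
      then obtain z' where "z' \<in> A n" "dist z z' < e" by blast
      then show ?case using infdist_le[of z' "A n" z] infdist_nonneg[of z "A n"] by simp
    qed
  qed
  from tendsto_add[OF this LIMSEQ_inverse_real_of_nat] have lim: "(\<lambda>n. infdist z (A n) + inverse (real (Suc n))) \<longlonglongrightarrow> 0" by simp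
  have "(\<lambda>n. dist (y n) z) \<longlonglongrightarrow> 0"
    by (rule Lim_null_comparison[OF _ lim]) (use y(2) in \<open>auto simp: dist_commute intro!: always_eventually less_imp_le\<close>)
  then have "y \<longlonglongrightarrow> z" by (rule tendsto_dist_iff[THEN iffD2])
  then show ?thesis using that y(1) by blast
qed

text \<open>For a minimizing measure the nonnegative defect in the subsolution inequality has
  integral 0, so almost every step is calibrated. By holonomy arrival points are distributed like
  base points; hence almost every arrival point again has a calibrated step, and forward orbits of
  every finite length follow by induction.\<close>

lemma (in mfg) calibrated_orbits_AE:
  assumes "\<tau> > 0" "\<eta> \<in> KR \<tau>" and m': "m' \<in> borel_prob" and kam: "bounded_lagrangian.weak_kam (lm m') \<tau> c u"
    and min: "(\<integral>z. lm m' (fst z) (snd z) \<partial>\<eta>) = c"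
  shows "AE z in \<eta>. z \<in> X \<and> bounded_lagrangian.calibrated (lm m') \<tau> c u (fst z) (snd z) \<and>
    (\<forall>k. bounded_lagrangian.forward_calibrated (lm m') Cs M \<tau> c u k (fst z))"
proof -
  interpret bounded_lagrangian "lm m'" Cs M \<Lambda> by (rule bounded_lagrangian_lm[OF m'])
  interpret prob_space \<eta> by (rule borel_probD(1)[OF KR_D(1)[OF assms(2)]])
  note \<eta> = KR_D[OF assms(2)]
  have u: "continuous_on UNIV u" by (rule weak_kamD(1)[OF kam])
  define f where "f z = \<tau> * lm m' (fst z) (snd z) - \<tau> * c - shift_diff \<tau> u z" for z
  have fc: "continuous_on UNIV f" unfolding f_def
    by (intro continuous_intros lm_continuous[OF m'] continuous_shift_diff u)
  have "0 \<le> f z" for z using weak_kamD(2)[OF kam, of "fst z" "snd z"] unfolding f_def shift_diff_def by simp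
  moreover have "(\<integral>z. f z \<partial>\<eta>) = 0"
    unfolding f_def using \<eta>(4)[OF lm_continuous[OF m']] \<eta>(4)[OF continuous_shift_diff[OF u]] \<eta>(2)[OF u] min
    by (simp add: prob_space)
  ultimately have "AE z in \<eta>. f z = 0" using integral_nonneg_eq_0_iff_AE[OF \<eta>(4)[OF fc]] by simp
  then have cal: "AE z in \<eta>. z \<in> X \<and> calibrated \<tau> c u (fst z) (snd z)"
    using \<eta>(3) by eventually_elim (simp add: f_def shift_diff_def calibrated_def)
  have "AE z in \<eta>. forward_calibrated \<tau> c u k (fst z)" for k
  proof (induction k)
    case (Suc k)
    define A where "A = {x. forward_calibrated \<tau> c u k x}"
    have A: "closed A" unfolding A_def by (rule closed_forward_calibrated[OF u])
    have AE1: "AE z in \<eta>. fst z \<in> A" using Suc by (simp add: A_def)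
    have "A \<noteq> {}"
    proof
      assume "A = {}"
      with AE1 show False using AE_False by simp
    qed
    have fst_b: "fst \<in> borel_measurable borel" by (intro borel_measurable_continuous_onI continuous_intros)
    have sh_b: "(\<lambda>z :: 'n torus \<times> (real ^ 'n). torus_shift (fst z) (\<tau> *\<^sub>R snd z)) \<in> borel_measurable borel"
      by (intro borel_measurable_continuous_onI continuous_intros)
    \<comment> \<open>Holonomy applied to the truncated distance to \<open>A\<close> transfers
      membership in \<open>A\<close> from base points to arrival points.\<close>
    define \<phi> where "\<phi> x = min 1 (infdist x A)" for x
    have \<phi>: "continuous_on UNIV \<phi>" unfolding \<phi>_def by (intro continuous_intros)
    have "(\<integral>z. \<phi> (torus_shift (fst z) (\<tau> *\<^sub>R snd z)) \<partial>\<eta>) = (\<integral>z. shift_diff \<tau> \<phi> z + \<phi> (fst z) \<partial>\<eta>)"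
      by (simp add: shift_diff_def)
    also have "\<dots> = (\<integral>z. \<phi> (fst z) \<partial>\<eta>)"
      using \<eta>(4)[OF continuous_shift_diff[OF \<phi>]] \<eta>(4)[OF continuous_on_fst_snd_comp[OF \<phi>]] \<eta>(2)[OF \<phi>] by simp
    also have "\<dots> = 0"
      using AE1 borel_prob_integral_0_AE_in_closed[OF \<eta>(1) A \<open>A \<noteq> {}\<close> fst_b] unfolding \<phi>_def by simp
    finally have "AE z in \<eta>. torus_shift (fst z) (\<tau> *\<^sub>R snd z) \<in> A"
      using borel_prob_integral_0_AE_in_closed[OF \<eta>(1) A \<open>A \<noteq> {}\<close> sh_b] unfolding \<phi>_def by simp
    with cal show ?case
      by eventually_elim (auto simp: A_def X_def R_def mem_Times_iff)
  qed simp
  then have "AE z in \<eta>. \<forall>k. forward_calibrated \<tau> c u k (fst z)" by (simp add: AE_all_countable)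
  with cal show ?thesis by eventually_elim simp
qed

text \<open>Equilibria along a sequence for which all limits in question exist. Packaging the data
  allows reinterpretation along further subsequences, see \<open>subseq_limit\<close>.\<close>

locale mfg_limit = mfg H F for H :: "'n::finite torus \<Rightarrow> real ^ 'n \<Rightarrow> real" and F +
  fixes \<tau> :: "nat \<Rightarrow> real" and \<eta> :: "nat \<Rightarrow> ('n torus \<times> (real ^ 'n)) measure" and m :: "nat \<Rightarrow> 'n torus measure"
    and u :: "nat \<Rightarrow> 'n torus \<Rightarrow> real" and c :: "nat \<Rightarrow> real"
    and \<eta>0 :: "('n torus \<times> (real ^ 'n)) measure" and m0 :: "'n torus measure" and u0 :: "'n torus \<Rightarrow> real" and c0 :: real
  assumes \<tau>: "\<And>i. \<tau> i > 0" "\<tau> \<longlonglongrightarrow> 0"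
    and \<eta>: "\<And>i. \<eta> i \<in> KR (\<tau> i)"
    and m: "\<And>i. m i = distr (\<eta> i) borel fst"
    and minimizing: "\<And>i. (\<integral>z. lm (m i) (fst z) (snd z) \<partial>\<eta> i) = c i"
    and kam: "\<And>i. bounded_lagrangian.weak_kam (lm (m i)) (\<tau> i) (c i) (u i)"
    and \<eta>0: "\<eta>0 \<in> borel_prob" "AE z in \<eta>0. z \<in> X"
    and \<eta>_lim: "\<And>f :: _ \<Rightarrow> real. continuous_on UNIV f \<Longrightarrow> (\<lambda>i. \<integral>z. f z \<partial>\<eta> i) \<longlonglongrightarrow> (\<integral>z. f z \<partial>\<eta>0)"
    and m0: "m0 = distr \<eta>0 borel fst"
    and u_lim: "uniform_limit UNIV u u0 sequentially"
    and c_lim: "c \<longlonglongrightarrow> c0"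
begin

lemma m_prob: "m i \<in> borel_prob" unfolding m by (rule distr_fst_borel_prob(1)[OF KR_D(1)[OF \<eta>]])
lemma m0_prob: "m0 \<in> borel_prob" unfolding m0 by (rule distr_fst_borel_prob(1)[OF \<eta>0(1)])

lemma m_lim:
  fixes \<phi> :: "'n torus \<Rightarrow> real"
  assumes \<phi>: "continuous_on UNIV \<phi>" shows "(\<lambda>n. \<integral>x. \<phi> x \<partial>m n) \<longlonglongrightarrow> (\<integral>x. \<phi> x \<partial>m0)"
  unfolding m m0 distr_fst_borel_prob(2)[OF KR_D(1)[OF \<eta>] borel_measurable_continuous_onI[OF \<phi>]]
    distr_fst_borel_prob(2)[OF \<eta>0(1) borel_measurable_continuous_onI[OF \<phi>]]
  by (rule \<eta>_lim[OF continuous_on_fst_snd_comp[OF \<phi>]])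

lemma weak_star_lim: "limitin weak_star m m0 sequentially"
  by (rule limitin_weak_star[OF m_prob m0_prob m_lim])

lemma F_lim: "uniform_limit UNIV (\<lambda>n x. F x (m n)) (\<lambda>x. F x m0) sequentially"
  by (rule F_uniform_limit[OF m_prob m0_prob m_lim])

sublocale B: bounded_lagrangian "lm (m i)" Cs M \<Lambda> for i by (rule bounded_lagrangian_lm[OF m_prob])
sublocale B0: bounded_lagrangian "lm m0" Cs M \<Lambda> by (rule bounded_lagrangian_lm[OF m0_prob])

lemma R_eq: "bounded_lagrangian.Rv Cs M = R" by (simp add: R_def)

lemma u0_continuous: "continuous_on UNIV u0"
  using B.weak_kamD(1)[OF kam] by (intro uniform_limit_theorem[OF _ u_lim]) auto

lemma u_tendsto: "Y \<longlonglongrightarrow> y \<Longrightarrow> (\<lambda>i. u i (Y i)) \<longlonglongrightarrow> u0 y"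
  using u0_continuous by (intro uniform_limit_tendsto_compose[OF u_lim]) (simp_all add: continuous_on_eq_continuous_at)

lemma lm_tendsto:
  assumes "Y \<longlonglongrightarrow> y" "V \<longlonglongrightarrow> v"
  shows "(\<lambda>i. lm (m i) (Y i) (V i)) \<longlonglongrightarrow> lm m0 y v"
proof -
  have "isCont (\<lambda>x. F x m0) y" using F_continuous[OF m0_prob] by (simp add: continuous_on_eq_continuous_at)
  from uniform_limit_tendsto_compose[OF F_lim this assms(1)] show ?thesis
    unfolding lm_eq by (intro tendsto_intros L_tendsto assms)
qed

lemma subseq_limit:
  assumes "strict_mono s"
  shows "mfg_limit H F (\<lambda>i. \<tau> (s i)) (\<lambda>i. \<eta> (s i)) (\<lambda>i. m (s i)) (\<lambda>i. u (s i)) (\<lambda>i. c (s i)) \<eta>0 m0 u0 c0"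
proof unfold_locales
  show "uniform_limit UNIV (\<lambda>i. u (s i)) u0 sequentially"
    using filterlim_compose[OF u_lim filterlim_subseq[OF assms]] by simp
  show "(\<lambda>i. \<tau> (s i)) \<longlonglongrightarrow> 0" "(\<lambda>i. c (s i)) \<longlonglongrightarrow> c0"
    using LIMSEQ_subseq_LIMSEQ[OF \<tau>(2) assms] LIMSEQ_subseq_LIMSEQ[OF c_lim assms] by (simp_all add: o_def)
  show "(\<lambda>i. \<integral>z. f z \<partial>\<eta> (s i)) \<longlonglongrightarrow> (\<integral>z. f z \<partial>\<eta>0)" if "continuous_on UNIV f" for f :: "_ \<Rightarrow> real"
    using LIMSEQ_subseq_LIMSEQ[OF \<eta>_lim[OF that] assms] by (simp add: o_def)
qed (use \<tau>(1) \<eta> m minimizing kam \<eta>0 m0 in auto)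

text \<open>Straight orbits of total time about \<open>t\<close> ending at \<open>x\<close>, with
  step sizes tending to 0. One error term stems from the drift along the orbit, the other from
  moving the base point of the Lagrangian to \<open>x\<close>; hence the factor 2.\<close>

lemma limit_subsolution:
  assumes "t > 0"
  shows "u0 x - u0 (torus_shift x (- (t *\<^sub>R w))) \<le> t * (lm m0 x w - c0 + 2 * (\<Lambda> (norm w) * (t * norm w)))"
proof -
  define T where "T i = real (nat \<lceil>t / \<tau> i\<rceil>) * \<tau> i" for i
  have T: "T \<longlonglongrightarrow> t" unfolding T_def by (rule nat_ceiling_step_tendsto[OF assms \<tau>])
  define y where "y i = torus_shift x (- (T i *\<^sub>R w))" for i
  define y0 where "y0 = torus_shift x (- (t *\<^sub>R w))"
  have y: "y \<longlonglongrightarrow> y0" unfolding y_def y0_def by (intro tendsto_intros T)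
  have "u i x + T i * c i \<le> u i (y i) + T i * (lm (m i) (y i) w + \<Lambda> (norm w) * (T i * norm w))" for i
    using B.straight_chain[OF \<tau>(1) B.weak_kam_subsolution[OF kam], of i "y i" "nat \<lceil>t / \<tau> i\<rceil>" w]
    unfolding T_def[symmetric] by (simp add: y_def)
  moreover have "(\<lambda>i. u i x + T i * c i) \<longlonglongrightarrow> u0 x + t * c0" by (intro tendsto_intros u_tendsto T c_lim)
  moreover have "(\<lambda>i. u i (y i) + T i * (lm (m i) (y i) w + \<Lambda> (norm w) * (T i * norm w)))
      \<longlonglongrightarrow> u0 y0 + t * (lm m0 y0 w + \<Lambda> (norm w) * (t * norm w))"
    by (intro tendsto_intros u_tendsto lm_tendsto T y)
  ultimately have 1: "u0 x + t * c0 \<le> u0 y0 + t * (lm m0 y0 w + \<Lambda> (norm w) * (t * norm w))"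
    by (intro LIMSEQ_le) auto
  have "dist y0 x \<le> t * norm w" using dist_torus_shift[of x "- (t *\<^sub>R w)"] assms unfolding y0_def by (simp add: dist_commute)
  then have "\<Lambda> (norm w) * dist y0 x \<le> \<Lambda> (norm w) * (t * norm w)" by (intro mult_left_mono B0.\<Lambda>_nonneg)
  then have "lm m0 y0 w \<le> lm m0 x w + \<Lambda> (norm w) * (t * norm w)"
    using B0.lipschitz_x[of w "norm w" y0 x] by linarith
  then have "t * (lm m0 y0 w + \<Lambda> (norm w) * (t * norm w)) \<le> t * (lm m0 x w + 2 * (\<Lambda> (norm w) * (t * norm w)))"
    using assms by (intro mult_left_mono) linarith+
  then show ?thesis using 1 unfolding y0_def[symmetric] by (simp add: algebra_simps)
qed

text \<open>The subsolution property in dual form. The test function has to be differentiable only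
  at the point, so that \<open>u0\<close> itself can serve as one wherever it is
  differentiable.\<close>

lemma test_upper:
  assumes \<phi>: "torus_differentiable \<phi> x" and touch: "\<forall>\<^sub>F y in nhds x. u0 y - \<phi> y \<le> u0 x - \<phi> x"
  shows "torus_gradient \<phi> x \<bullet> w \<le> lm m0 x w - c0"
proof (rule field_le_epsilon)
  fix e :: real assume "e > 0"
  obtain \<rho>1 where \<rho>1: "\<rho>1 > 0" "\<And>y. dist y x < \<rho>1 \<Longrightarrow> u0 y - \<phi> y \<le> u0 x - \<phi> x"
    using touch unfolding eventually_nhds_metric by blast
  define \<epsilon> where "\<epsilon> = e / (2 * (norm w + 1))"
  have w1: "norm w + 1 > 0" using norm_ge_zero[of w] by linarith
  have "\<epsilon> > 0" unfolding \<epsilon>_def using \<open>e > 0\<close> w1 by simp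
  obtain \<rho> where \<rho>: "\<rho> > 0" "\<And>h. norm h < \<rho> \<Longrightarrow> \<bar>\<phi> (torus_shift x h) - \<phi> x - torus_gradient \<phi> x \<bullet> h\<bar> \<le> \<epsilon> * norm h"
    using torus_differentiable_eps[OF \<phi> \<open>\<epsilon> > 0\<close>] by blast
  define K where "K = 2 * (\<Lambda> (norm w) * norm w)"
  have K: "K \<ge> 0" unfolding K_def using B0.\<Lambda>_nonneg by simp
  \<comment> \<open>Short enough that the displacement stays within both radii and that the error
    \<open>t * K\<close> is at most \<open>e / 2\<close>.\<close>
  define t where "t = min (min \<rho> \<rho>1 / (2 * (norm w + 1))) (e / (2 * (K + 1)))"
  have t: "t > 0" unfolding t_def using \<rho>(1) \<rho>1(1) \<open>e > 0\<close> w1 K by simp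
  have "t \<le> min \<rho> \<rho>1 / (2 * (norm w + 1))" unfolding t_def by simp
  then have "t * (2 * (norm w + 1)) \<le> min \<rho> \<rho>1" using w1 by (simp add: pos_le_divide_eq)
  moreover have "norm w < 2 * (norm w + 1)" using norm_ge_zero[of w] unfolding distrib_left by linarith
  then have "t * norm w < t * (2 * (norm w + 1))" using t by (rule mult_strict_left_mono)
  ultimately have tw: "t * norm w < \<rho>" "t * norm w < \<rho>1" by linarith+
  have tK: "t * K \<le> e / 2"
  proof -
    have "t \<le> e / (2 * (K + 1))" unfolding t_def by simp
    then have "t * (2 * (K + 1)) \<le> e" using K by (simp add: pos_le_divide_eq)
    then show ?thesis using t by (simp add: algebra_simps)
  qed
  have \<epsilon>w: "\<epsilon> * norm w \<le> e / 2"
  proof -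
    have "\<epsilon> * norm w \<le> \<epsilon> * (norm w + 1)" using \<open>\<epsilon> > 0\<close> by simp
    also have "\<dots> = e / 2" unfolding \<epsilon>_def using w1 by (simp add: field_simps)
    finally show ?thesis .
  qed
  let ?h = "- (t *\<^sub>R w)"
  have nh: "norm ?h = t * norm w" using t by simp
  have "dist (torus_shift x ?h) x < \<rho>1" using dist_torus_shift[of x ?h] tw(2) unfolding nh by (simp add: dist_commute)
  from \<rho>1(2)[OF this] have "\<phi> x - \<phi> (torus_shift x ?h) \<le> u0 x - u0 (torus_shift x ?h)" by simp
  also have "\<dots> \<le> t * (lm m0 x w - c0 + 2 * (\<Lambda> (norm w) * (t * norm w)))" by (rule limit_subsolution[OF t])
  also have "\<dots> = t * (lm m0 x w - c0 + t * K)" by (simp add: K_def algebra_simps)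
  finally have 1: "\<phi> x - \<phi> (torus_shift x ?h) \<le> t * (lm m0 x w - c0 + t * K)" .
  have "\<bar>\<phi> (torus_shift x ?h) - \<phi> x - torus_gradient \<phi> x \<bullet> ?h\<bar> \<le> \<epsilon> * norm ?h" using tw(1) nh by (intro \<rho>(2)) (simp only:)
  then have "t * (torus_gradient \<phi> x \<bullet> w) - t * (\<epsilon> * norm w) \<le> \<phi> x - \<phi> (torus_shift x ?h)"
    unfolding nh by (simp add: abs_le_iff algebra_simps)
  with 1 have "t * (torus_gradient \<phi> x \<bullet> w) \<le> t * (lm m0 x w - c0 + t * K + \<epsilon> * norm w)" by (simp add: algebra_simps)
  then have "torus_gradient \<phi> x \<bullet> w \<le> lm m0 x w - c0 + t * K + \<epsilon> * norm w" using t by (rule mult_left_le_imp_le)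
  then show "torus_gradient \<phi> x \<bullet> w \<le> lm m0 x w - c0 + e" using tK \<epsilon>w by linarith
qed

lemma subsolution_H:
  assumes "\<And>w. p \<bullet> w \<le> lm m0 x w - c0"
  shows "H x p \<le> F x m0 - c0"
  using assms[of "gradient (H x) p"] L_H_gradient[of x p] unfolding lm_eq by linarith


text \<open>For each \<open>i\<close> a backward calibrated orbit of time about \<open>t\<close> is
  tested against the momentum \<open>p\<close>. Only its total displacement enters the estimate;
  these displacements are bounded and subconverge.\<close>

lemma limit_supersolution:
  obtains K where "K \<ge> 0" "\<And>t. t > 0 \<Longrightarrow> \<exists>V. norm V \<le> t * R \<and>
    p \<bullet> V - t * (H x p - F x m0 + c0 + K * (t * R)) \<le> u0 x - u0 (torus_shift x (- V))"
proof -
  obtain C where C: "C \<ge> 0" "\<And>x y q. norm q \<le> norm p \<Longrightarrow> \<bar>H x q - H y q\<bar> \<le> C * dist x y"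
    using H_lipschitz_x[of "norm p"] by blast
  define K where "K = C + FB"
  have K: "K \<ge> 0" unfolding K_def using C(1) FB(1) by simp
  show ?thesis
  proof (rule that[OF K])
    fix t :: real assume t: "t > 0"
    define N where "N i = nat \<lceil>t / \<tau> i\<rceil>" for i
    define T where "T i = real (N i) * \<tau> i" for i
    have T: "T \<longlonglongrightarrow> t" unfolding T_def N_def by (rule nat_ceiling_step_tendsto[OF t \<tau>])
    have "\<exists>V. norm V \<le> T i * R \<and> p \<bullet> V - T i * (H x p - F x (m i) + c i + K * (T i * R)) \<le> u i x - u i (torus_shift x (- V))" for i
    proof -
      obtain z w where zw: "z 0 = x" "\<And>j. torus_shift (z (Suc j)) (\<tau> i *\<^sub>R w j) = z j"
        "\<And>j. bounded_lagrangian.calibrated (lm (m i)) (\<tau> i) (c i) (u i) (z (Suc j)) (w j)" "\<And>j. norm (w j) \<le> R"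
        using B.backward_orbit[OF \<tau>(1)[of i] kam[of i], of x] unfolding R_eq by blast
      have G1: "p \<bullet> v - (H y p - F y (m i)) \<le> lm (m i) y v" for y v using fenchel_young[of p v y] unfolding lm_eq by linarith
      have G2: "\<bar>(H y p - F y (m i)) - (H y' p - F y' (m i))\<bar> \<le> K * dist y y'" for y y'
        using C(2)[OF order_refl, of y y'] FB(3)[OF m_prob[of i], of y y'] unfolding K_def distrib_right by linarith
      note bo = B.backward_orbit_lower[OF zw \<tau>(1) G1 G2 K order_refl, of "N i"]
      show ?thesis
        using bo(2,3) unfolding bo(1) T_def[symmetric] by blast
    qed
    then obtain V where V: "\<And>i. norm (V i) \<le> T i * R"
      "\<And>i. p \<bullet> V i - T i * (H x p - F x (m i) + c i + K * (T i * R)) \<le> u i x - u i (torus_shift x (- V i))" by metis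
    obtain B where B: "\<And>i. norm (T i) \<le> B" using convergent_imp_Bseq[OF convergentI[OF T]] unfolding Bseq_def by blast
    have "V i \<in> cball 0 (B * R)" for i
    proof -
      have "T i \<le> B" using B[of i] by simp
      then have "T i * R \<le> B * R" using R_nonneg by (rule mult_right_mono)
      then show ?thesis using V(1)[of i] by simp
    qed
    then obtain V0 s where s: "strict_mono s" "(\<lambda>n. V (s n)) \<longlonglongrightarrow> V0"
      using compact_subsequence[OF compact_cball, of V 0 "B * R"] by metis
    interpret S: mfg_limit H F "\<lambda>i. \<tau> (s i)" "\<lambda>i. \<eta> (s i)" "\<lambda>i. m (s i)" "\<lambda>i. u (s i)" "\<lambda>i. c (s i)" \<eta>0 m0 u0 c0
      by (rule subseq_limit[OF s(1)])
    have Ts: "(\<lambda>i. T (s i)) \<longlonglongrightarrow> t" using LIMSEQ_subseq_LIMSEQ[OF T s(1)] by (simp add: o_def)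
    have Fs: "(\<lambda>i. F x (m (s i))) \<longlonglongrightarrow> F x m0" by (rule tendsto_uniform_limitI[OF S.F_lim]) simp
    show "\<exists>V. norm V \<le> t * R \<and> p \<bullet> V - t * (H x p - F x m0 + c0 + K * (t * R)) \<le> u0 x - u0 (torus_shift x (- V))"
    proof (intro exI conjI)
      show "norm V0 \<le> t * R"
        by (rule LIMSEQ_le[OF tendsto_norm[OF s(2)] tendsto_mult_right[OF Ts, of R]]) (use V(1) in blast)
      have 1: "(\<lambda>i. p \<bullet> V (s i) - T (s i) * (H x p - F x (m (s i)) + c (s i) + K * (T (s i) * R)))
        \<longlonglongrightarrow> p \<bullet> V0 - t * (H x p - F x m0 + c0 + K * (t * R))"
        by (intro tendsto_intros s(2) Ts Fs S.c_lim)
      have 2: "(\<lambda>i. u (s i) x - u (s i) (torus_shift x (- V (s i)))) \<longlonglongrightarrow> u0 x - u0 (torus_shift x (- V0))"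
        by (intro tendsto_intros S.u_tendsto s(2))
      show "p \<bullet> V0 - t * (H x p - F x m0 + c0 + K * (t * R)) \<le> u0 x - u0 (torus_shift x (- V0))"
        by (rule LIMSEQ_le[OF 1 2]) (use V(2) in blast)
    qed
  qed
qed

lemma test_lower:
  assumes \<phi>: "torus_differentiable \<phi> x" and touch: "\<forall>\<^sub>F y in nhds x. u0 y - \<phi> y \<ge> u0 x - \<phi> x"
  shows "F x m0 - c0 \<le> H x (torus_gradient \<phi> x)"
proof (rule field_le_epsilon)
  fix e :: real assume "e > 0"
  define p where "p = torus_gradient \<phi> x"
  obtain K where K: "K \<ge> 0" "\<And>t. t > 0 \<Longrightarrow> \<exists>V. norm V \<le> t * R \<and>
    p \<bullet> V - t * (H x p - F x m0 + c0 + K * (t * R)) \<le> u0 x - u0 (torus_shift x (- V))"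
    using limit_supersolution by blast
  obtain \<rho>1 where \<rho>1: "\<rho>1 > 0" "\<And>y. dist y x < \<rho>1 \<Longrightarrow> u0 x - \<phi> x \<le> u0 y - \<phi> y"
    using touch unfolding eventually_nhds_metric by blast
  define \<epsilon> where "\<epsilon> = e / (2 * (R + 1))"
  have R1: "R + 1 > 0" using R_nonneg by linarith
  have "\<epsilon> > 0" unfolding \<epsilon>_def using \<open>e > 0\<close> R1 by simp
  obtain \<rho> where \<rho>: "\<rho> > 0" "\<And>h. norm h < \<rho> \<Longrightarrow> \<bar>\<phi> (torus_shift x h) - \<phi> x - p \<bullet> h\<bar> \<le> \<epsilon> * norm h"
    using torus_differentiable_eps[OF \<phi> \<open>\<epsilon> > 0\<close>] unfolding p_def by blast
  have KR: "K * R + 1 > 0" using K(1) R_nonneg mult_nonneg_nonneg[of K R] by linarith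
  define t where "t = min (min \<rho> \<rho>1 / (2 * (R + 1))) (e / (2 * (K * R + 1)))"
  have t: "t > 0" unfolding t_def using \<rho>(1) \<rho>1(1) \<open>e > 0\<close> R1 KR by simp
  have "t \<le> min \<rho> \<rho>1 / (2 * (R + 1))" unfolding t_def by simp
  then have "t * (2 * (R + 1)) \<le> min \<rho> \<rho>1" using R1 by (simp add: pos_le_divide_eq)
  moreover have "R < 2 * (R + 1)" using R_nonneg unfolding distrib_left by linarith
  then have "t * R < t * (2 * (R + 1))" using t by (rule mult_strict_left_mono)
  ultimately have tR: "t * R < \<rho>" "t * R < \<rho>1" by linarith+
  have tK: "K * (t * R) \<le> e / 2"
  proof -
    have "t \<le> e / (2 * (K * R + 1))" unfolding t_def by simp
    then have "t * (2 * (K * R + 1)) \<le> e" using KR by (simp add: pos_le_divide_eq)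
    then show ?thesis using t by (simp add: algebra_simps)
  qed
  have \<epsilon>R: "\<epsilon> * R \<le> e / 2"
  proof -
    have "\<epsilon> * R \<le> \<epsilon> * (R + 1)" using \<open>\<epsilon> > 0\<close> by simp
    also have "\<dots> = e / 2" unfolding \<epsilon>_def using R1 by (simp add: field_simps)
    finally show ?thesis .
  qed
  obtain V where V: "norm V \<le> t * R"
    "p \<bullet> V - t * (H x p - F x m0 + c0 + K * (t * R)) \<le> u0 x - u0 (torus_shift x (- V))" using K(2)[OF t] by blast
  have "dist (torus_shift x (- V)) x < \<rho>1" using dist_torus_shift[of x "- V"] V(1) tR(2) by (simp add: dist_commute)
  from \<rho>1(2)[OF this] have 1: "u0 x - u0 (torus_shift x (- V)) \<le> \<phi> x - \<phi> (torus_shift x (- V))" by simp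
  have "\<bar>\<phi> (torus_shift x (- V)) - \<phi> x - p \<bullet> (- V)\<bar> \<le> \<epsilon> * norm (- V)" using V(1) tR(1) by (intro \<rho>(2)) simp
  moreover have "\<epsilon> * norm (- V) \<le> \<epsilon> * (t * R)" using V(1) \<open>\<epsilon> > 0\<close> by (intro mult_left_mono) auto
  ultimately have "\<phi> x - \<phi> (torus_shift x (- V)) \<le> p \<bullet> V + \<epsilon> * (t * R)" by (simp add: abs_le_iff)
  with V(2) 1 have "0 \<le> t * (H x p - F x m0 + c0 + K * (t * R) + \<epsilon> * R)" by (simp add: algebra_simps)
  then have "0 \<le> H x p - F x m0 + c0 + K * (t * R) + \<epsilon> * R" using t by (simp add: zero_le_mult_iff)
  then show "F x m0 - c0 \<le> H x (torus_gradient \<phi> x) + e" using tK \<epsilon>R unfolding p_def by linarith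
qed

lemma limit_viscosity_solution: "viscosity_solution H (\<lambda>x. F x m0 - c0) u0"
  unfolding viscosity_solution_def One_nat_def
  using u0_continuous subsolution_H[OF test_upper] test_lower torus_C_k_differentiable by blast

text \<open>For fixed \<epsilon> the affine bounds at the approximating points have slopes bounded
  by \<open>P\<close> and a radius independent of the index, so they pass to the limit point and
  \<open>GDERIV_two_sided_limit\<close> gives the gradient \<open>q\<close>. Calibration adds
  \<open>lm m0 x v - c0 \<le> q \<bullet> v\<close>, the inequality opposite to
  Fenchel-Young.\<close>

lemma limit_differentiable_at:
  assumes z: "\<And>i. y i \<in> X" "\<And>i. bounded_lagrangian.calibrated (lm (m i)) (\<tau> i) (c i) (u i) (fst (y i)) (snd (y i))"
      "\<And>i k. bounded_lagrangian.forward_calibrated (lm (m i)) Cs M (\<tau> i) (c i) (u i) k (fst (y i))"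
    and lim: "y \<longlonglongrightarrow> z"
  shows "torus_differentiable u0 (fst z)" "snd z = gradient (H (fst z)) (torus_gradient u0 (fst z))"
proof -
  define x v where "x = fst z" and "v = snd z"
  have xl: "(\<lambda>i. fst (y i)) \<longlonglongrightarrow> x" and vl: "(\<lambda>i. snd (y i)) \<longlonglongrightarrow> v"
    unfolding x_def v_def by (intro tendsto_intros lim)+
  define K where "K = 2 * \<Lambda> (R + 1) + 1"
  have K: "K \<ge> 1" unfolding K_def using B0.\<Lambda>_nonneg[of "R + 1"] by simp
  define P where "P = \<Lambda>L R"
  obtain q where q: "GDERIV (\<lambda>h. u0 (torus_shift x h)) 0 :> q" "lm m0 x v - c0 \<le> q \<bullet> v"
  proof (rule GDERIV_two_sided_limit[of P "\<lambda>h. u0 (torus_shift x h)" "lm m0 x v - c0" v])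
    fix \<epsilon> :: real assume "\<epsilon> > 0"
    \<comment> \<open>The bounds of \<open>first_order_bounds\<close> carry the error
      \<open>K * \<kappa>\<close>, which this scaling turns into \<epsilon>.\<close>
    define \<kappa> where "\<kappa> = \<epsilon> / K"
    have \<kappa>: "\<kappa> > 0" "K * \<kappa> = \<epsilon>" unfolding \<kappa>_def using \<open>\<epsilon> > 0\<close> K by auto
    obtain \<delta>1 where \<delta>1: "\<delta>1 > 0" "\<And>x v e. norm v \<le> R \<Longrightarrow> norm e \<le> \<delta>1 \<Longrightarrow> L x (v + e) \<le> L x v + b x v \<bullet> e + \<kappa> * norm e"
      using L_first_order[OF \<kappa>(1), of R] by blast
    define \<delta> where "\<delta> = min \<delta>1 1"
    have \<delta>: "0 < \<delta>" "\<delta> \<le> 1" "\<delta> \<le> \<delta>1" unfolding \<delta>_def using \<delta>1(1) by auto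
    have expand: "lm (m i) x (v + e) \<le> lm (m i) x v + b x v \<bullet> e + \<kappa> * norm e" if "norm v \<le> R" "norm e \<le> \<delta>" for i x v e
      using \<delta>1(2)[OF that(1), of e x] that(2) \<delta>(3) unfolding lm_eq by simp
    define \<rho> where "\<rho> = \<delta> * \<kappa>"
    have \<rho>: "\<rho> > 0" unfolding \<rho>_def using \<delta>(1) \<kappa>(1) by simp
    \<comment> \<open>Early indices are dropped: \<open>first_order_bounds\<close> wants the time
      step below \<kappa>, and \<open>\<tau> i * R\<close> below \<rho> lets a single calibrated
      step serve as a displacement \<open>h\<close>.\<close>
    have "(\<lambda>i. \<tau> i * R) \<longlonglongrightarrow> 0" using tendsto_mult_right[OF \<tau>(2), of R] by simp
    then have "\<forall>\<^sub>F i in sequentially. \<tau> i < \<kappa> \<and> \<tau> i * R < \<rho>"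
      using order_tendstoD(2)[OF \<tau>(2) \<kappa>(1)] order_tendstoD(2)[OF _ \<rho>] by (simp add: eventually_conj_iff)
    then obtain I where I: "\<And>i. i \<ge> I \<Longrightarrow> \<tau> i < \<kappa>" "\<And>i. i \<ge> I \<Longrightarrow> \<tau> i * R < \<rho>" unfolding eventually_sequentially by blast
    define j where "j i = i + I" for i
    have j: "strict_mono j" "\<tau> (j i) \<le> \<kappa>" "\<tau> (j i) * R \<le> \<rho>" for i
      using I[of "i + I"] unfolding j_def strict_mono_def by auto
    define \<Delta> where "\<Delta> i h = u (j i) (torus_shift (fst (y (j i))) h) - u (j i) (fst (y (j i)))" for i h
    have ex: "\<exists>p. norm p \<le> P \<and> (\<forall>h. norm h \<le> \<rho> \<longrightarrow> \<Delta> i h \<le> p \<bullet> h + \<epsilon> * norm h)"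
      "\<exists>p. norm p \<le> P \<and> (\<forall>h. norm h \<le> \<rho> \<longrightarrow> p \<bullet> h - \<epsilon> * norm h \<le> \<Delta> i h)" for i
    proof -
      have *: "lm (m (j i)) x (v + e) \<le> lm (m (j i)) x v + b x v \<bullet> e + \<kappa> * norm e"
        if "norm v \<le> bounded_lagrangian.Rv Cs M" "norm e \<le> \<delta>" for x v e
        using expand[of v e] that unfolding R_eq by blast
      have **: "norm (b x v) \<le> P" if "norm v \<le> bounded_lagrangian.Rv Cs M" for x v
        using \<Lambda>L(4)[of v R] that unfolding R_eq P_def by blast
      have up: "\<exists>p. norm p \<le> P \<and> (\<forall>h. norm h \<le> \<delta> * \<kappa> \<longrightarrow> u (j i) (torus_shift (fst (y (j i))) h) - u (j i) (fst (y (j i)))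
          \<le> p \<bullet> h + (2 * \<Lambda> (bounded_lagrangian.Rv Cs M + 1) + 1) * \<kappa> * norm h)"
        by (rule B.first_order_bounds(1)[OF \<tau>(1) j(2) kam]) (fact * | fact ** | fact \<delta>)+
      have lo: "\<exists>p. norm p \<le> P \<and> (\<forall>h. norm h \<le> \<delta> * \<kappa> \<longrightarrow> p \<bullet> h - (2 * \<Lambda> (bounded_lagrangian.Rv Cs M + 1) + 1) * \<kappa> * norm h
          \<le> u (j i) (torus_shift (fst (y (j i))) h) - u (j i) (fst (y (j i))))"
        by (rule B.first_order_bounds(2)[OF \<tau>(1) j(2) kam]) (fact * | fact ** | fact \<delta> | rule z(3))+
      show "\<exists>p. norm p \<le> P \<and> (\<forall>h. norm h \<le> \<rho> \<longrightarrow> \<Delta> i h \<le> p \<bullet> h + \<epsilon> * norm h)"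
        "\<exists>p. norm p \<le> P \<and> (\<forall>h. norm h \<le> \<rho> \<longrightarrow> p \<bullet> h - \<epsilon> * norm h \<le> \<Delta> i h)"
        using up lo unfolding R_eq K_def[symmetric] \<kappa>(2) \<rho>_def[symmetric] \<Delta>_def by blast+
    qed
    obtain p where p': "\<forall>i. norm (p i) \<le> P \<and> (\<forall>h. norm h \<le> \<rho> \<longrightarrow> \<Delta> i h \<le> p i \<bullet> h + \<epsilon> * norm h)"
    proof -
      have "\<forall>i. \<exists>p. norm p \<le> P \<and> (\<forall>h. norm h \<le> \<rho> \<longrightarrow> \<Delta> i h \<le> p \<bullet> h + \<epsilon> * norm h)" using ex(1) ..
      from choice[OF this] show ?thesis using that by blast
    qed
    obtain p' where p'': "\<forall>i. norm (p' i) \<le> P \<and> (\<forall>h. norm h \<le> \<rho> \<longrightarrow> p' i \<bullet> h - \<epsilon> * norm h \<le> \<Delta> i h)"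
    proof -
      have "\<forall>i. \<exists>p. norm p \<le> P \<and> (\<forall>h. norm h \<le> \<rho> \<longrightarrow> p \<bullet> h - \<epsilon> * norm h \<le> \<Delta> i h)" using ex(2) ..
      from choice[OF this] show ?thesis using that by blast
    qed
    have p: "\<And>i. norm (p i) \<le> P" "\<And>i. norm (p' i) \<le> P"
      "\<And>i h. norm h \<le> \<rho> \<Longrightarrow> u (j i) (torus_shift (fst (y (j i))) h) - u (j i) (fst (y (j i))) \<le> p i \<bullet> h + \<epsilon> * norm h"
      "\<And>i h. norm h \<le> \<rho> \<Longrightarrow> p' i \<bullet> h - \<epsilon> * norm h \<le> u (j i) (torus_shift (fst (y (j i))) h) - u (j i) (fst (y (j i)))"
    proof -
      show "norm (p i) \<le> P" "norm (p' i) \<le> P" for i using p'[rule_format, of i] p''[rule_format, of i] by simp_all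
      show "u (j i) (torus_shift (fst (y (j i))) h) - u (j i) (fst (y (j i))) \<le> p i \<bullet> h + \<epsilon> * norm h" if "norm h \<le> \<rho>" for i h
        using p'[THEN spec, of i, THEN conjunct2, THEN spec, of h] that unfolding \<Delta>_def by (rule mp)
      show "p' i \<bullet> h - \<epsilon> * norm h \<le> u (j i) (torus_shift (fst (y (j i))) h) - u (j i) (fst (y (j i)))" if "norm h \<le> \<rho>" for i h
        using p''[THEN spec, of i, THEN conjunct2, THEN spec, of h] that unfolding \<Delta>_def by (rule mp)
    qed
    have in_ball: "(p i, p' i) \<in> cball 0 P \<times> cball 0 P" for i using p(1,2) by simp
    obtain pp s where s: "pp \<in> cball 0 P \<times> cball 0 P" "strict_mono s" "(\<lambda>i. (p (s i), p' (s i))) \<longlonglongrightarrow> pp"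
      by (rule compact_subsequence[OF compact_Times[OF compact_cball compact_cball], of "\<lambda>i. (p i, p' i)" 0 P 0 P, OF in_ball])
    have pl: "(\<lambda>i. p (s i)) \<longlonglongrightarrow> fst pp" "(\<lambda>i. p' (s i)) \<longlonglongrightarrow> snd pp"
      using tendsto_fst[OF s(3)] tendsto_snd[OF s(3)] by simp_all
    define k where "k i = j (s i)" for i
    have k: "strict_mono k" unfolding k_def using j(1) s(2) by (simp add: strict_mono_def)
    interpret S: mfg_limit H F "\<lambda>i. \<tau> (k i)" "\<lambda>i. \<eta> (k i)" "\<lambda>i. m (k i)" "\<lambda>i. u (k i)" "\<lambda>i. c (k i)" \<eta>0 m0 u0 c0
      by (rule subseq_limit[OF k])
    have xk: "(\<lambda>i. fst (y (k i))) \<longlonglongrightarrow> x" and vk: "(\<lambda>i. snd (y (k i))) \<longlonglongrightarrow> v"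
      using LIMSEQ_subseq_LIMSEQ[OF xl k] LIMSEQ_subseq_LIMSEQ[OF vl k] by (simp_all add: o_def)
    have ul: "(\<lambda>i. u (k i) (torus_shift (fst (y (k i))) h) - u (k i) (fst (y (k i)))) \<longlonglongrightarrow> u0 (torus_shift x h) - u0 x" for h
      by (intro tendsto_intros S.u_tendsto xk)
    have "norm (fst pp) \<le> P" using s(1) by (simp add: mem_Times_iff)
    moreover have "u0 (torus_shift x h) - u0 (torus_shift x 0) \<le> fst pp \<bullet> h + \<epsilon> * norm h" if "norm h \<le> \<rho>" for h
    proof -
      have "(\<lambda>i. p (s i) \<bullet> h + \<epsilon> * norm h) \<longlonglongrightarrow> fst pp \<bullet> h + \<epsilon> * norm h" by (intro tendsto_intros pl)
      from LIMSEQ_le[OF ul[of h] this] show ?thesis using p(3)[OF that] unfolding k_def by simp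
    qed
    moreover have "snd pp \<bullet> h - \<epsilon> * norm h \<le> u0 (torus_shift x h) - u0 (torus_shift x 0)" if "norm h \<le> \<rho>" for h
    proof -
      have "(\<lambda>i. p' (s i) \<bullet> h - \<epsilon> * norm h) \<longlonglongrightarrow> snd pp \<bullet> h - \<epsilon> * norm h" by (intro tendsto_intros pl)
      from LIMSEQ_le[OF this ul[of h]] show ?thesis using p(4)[OF that] unfolding k_def by simp
    qed
    moreover have "lm m0 x v - c0 \<le> fst pp \<bullet> v + \<epsilon> * norm v"
    proof (rule LIMSEQ_le)
      show "(\<lambda>i. lm (m (k i)) (fst (y (k i))) (snd (y (k i))) - c (k i)) \<longlonglongrightarrow> lm m0 x v - c0"
        by (intro tendsto_intros S.lm_tendsto S.c_lim xk vk)
      show "(\<lambda>i. p (s i) \<bullet> snd (y (k i)) + \<epsilon> * norm (snd (y (k i)))) \<longlonglongrightarrow> fst pp \<bullet> v + \<epsilon> * norm v"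
        by (intro tendsto_intros pl vk)
      \<comment> \<open>The upper bound at the displacement of one calibrated step, divided by the
        time step.\<close>
      have "lm (m (k i)) (fst (y (k i))) (snd (y (k i))) - c (k i) \<le> p (s i) \<bullet> snd (y (k i)) + \<epsilon> * norm (snd (y (k i)))" for i
      proof -
        let ?t = "\<tau> (k i)" and ?x = "fst (y (k i))" and ?v = "snd (y (k i))"
        have t: "?t > 0" by (rule \<tau>(1))
        have "norm ?v \<le> R" using z(1)[of "k i"] by (simp add: X_def mem_Times_iff)
        then have "?t * norm ?v \<le> ?t * R" using t by simp
        also have "\<dots> \<le> \<rho>" using j(3)[of "s i"] unfolding k_def .
        finally have "norm (?t *\<^sub>R ?v) \<le> \<rho>" using t by simp
        from p(3)[OF this, of "s i", folded k_def] have "u (k i) (torus_shift ?x (?t *\<^sub>R ?v)) - u (k i) ?x \<le> ?t * (p (s i) \<bullet> ?v + \<epsilon> * norm ?v)"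
          using t by (simp add: algebra_simps)
        moreover have "u (k i) (torus_shift ?x (?t *\<^sub>R ?v)) + ?t * c (k i) = u (k i) ?x + ?t * lm (m (k i)) ?x ?v"
          using z(2)[of "k i"] unfolding B.calibrated_def .
        ultimately have "?t * (lm (m (k i)) ?x ?v - c (k i)) \<le> ?t * (p (s i) \<bullet> ?v + \<epsilon> * norm ?v)" by (simp add: right_diff_distrib)
        then show ?thesis using t by (rule mult_left_le_imp_le)
      qed
      then show "\<exists>N. \<forall>n\<ge>N. lm (m (k n)) (fst (y (k n))) (snd (y (k n))) - c (k n) \<le> p (s n) \<bullet> snd (y (k n)) + \<epsilon> * norm (snd (y (k n)))" by blast
    qed
    ultimately show "\<exists>\<rho>>0. \<exists>p p'. norm p \<le> P \<and>
      (\<forall>h. norm h \<le> \<rho> \<longrightarrow> u0 (torus_shift x h) - u0 (torus_shift x 0) \<le> p \<bullet> h + \<epsilon> * norm h) \<and>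
      (\<forall>h. norm h \<le> \<rho> \<longrightarrow> p' \<bullet> h - \<epsilon> * norm h \<le> u0 (torus_shift x h) - u0 (torus_shift x 0)) \<and>
      lm m0 x v - c0 \<le> p \<bullet> v + \<epsilon> * norm v"
      using \<rho> by blast
  qed blast
  show d: "torus_differentiable u0 (fst z)" using torus_differentiableI(1)[OF q(1)] unfolding x_def .
  have g: "torus_gradient u0 x = q" by (rule torus_differentiableI(2)[OF q(1)])
  \<comment> \<open>\<open>u0\<close> touches itself from above, so differentiability alone gives
    the subsolution inequality for its own gradient.\<close>
  have "H x q \<le> F x m0 - c0"
  proof (rule subsolution_H)
    show "q \<bullet> w \<le> lm m0 x w - c0" for w
      using test_upper[of u0 x w] d unfolding g x_def[symmetric] by simp
  qed
  then have "L x v + H x q \<le> q \<bullet> v" using q(2) unfolding lm_eq by linarith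
  then show "snd z = gradient (H (fst z)) (torus_gradient u0 (fst z))"
    unfolding x_def[symmetric] v_def[symmetric] g by (rule fenchel_eq_imp)
qed

text \<open>Weak convergence does not preserve sets of full measure, but almost every point for
  \<open>\<eta>0\<close> is a limit of points from such sets, and this is all that
  \<open>limit_differentiable_at\<close> asks.\<close>

lemma limit_AE:
  "AE z in \<eta>0. torus_differentiable u0 (fst z) \<and> snd z = gradient (H (fst z)) (torus_gradient u0 (fst z))"
proof -
  define E where "E i = {z. z \<in> X \<and> bounded_lagrangian.calibrated (lm (m i)) (\<tau> i) (c i) (u i) (fst z) (snd z) \<and>
    (\<forall>k. bounded_lagrangian.forward_calibrated (lm (m i)) Cs M (\<tau> i) (c i) (u i) k (fst z))}" for i
  have AE_E: "AE z in \<eta> i. z \<in> E i" for i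
    unfolding E_def using calibrated_orbits_AE[OF \<tau>(1) \<eta> m_prob kam minimizing, of i] by simp
  have ne: "E i \<noteq> {}" for i
  proof
    assume "E i = {}"
    then show False using AE_E[of i] prob_space.AE_False[OF borel_probD(1)[OF KR_D(1)[OF \<eta>]]] by simp
  qed
  have "AE z in \<eta>0. \<forall>e>0. \<forall>\<^sub>F i in sequentially. \<exists>z'\<in>E i. dist z z' < e"
  proof (rule AE_limit_of_full_sets[OF KR_D(1)[OF \<eta>] \<eta>0(1) AE_E])
    show "(\<lambda>n. \<integral>z. f z \<partial>\<eta> n) \<longlonglongrightarrow> (\<integral>z. f z \<partial>\<eta>0)" if "continuous_on UNIV f" for f :: "_ \<Rightarrow> real"
      by (rule \<eta>_lim[OF that])
  qed
  then show ?thesis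
  proof eventually_elim
    case (elim z)
    obtain y where y: "\<And>i. y i \<in> E i" "y \<longlonglongrightarrow> z" using approximating_sequence[OF elim ne] by blast
    show ?case
    proof (intro conjI)
      show "torus_differentiable u0 (fst z)" by (rule limit_differentiable_at(1)[OF _ _ _ y(2)]) (use y(1) in \<open>auto simp: E_def\<close>)
      show "snd z = gradient (H (fst z)) (torus_gradient u0 (fst z))" by (rule limit_differentiable_at(2)[OF _ _ _ y(2)]) (use y(1) in \<open>auto simp: E_def\<close>)
    qed
  qed
qed

text \<open>Holonomy divided by the time step. By the mean value theorem the difference quotient of
  \<open>f\<close> over one step is the gradient at an intermediate point paired with the velocity;
  bounded speeds and uniform continuity make its discrepancy with the gradient at the base point
  vanish.\<close>

lemma limit_closed:
  assumes f: "torus_C_k (Suc 0) f"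
  shows "(\<integral>z. torus_gradient f (fst z) \<bullet> snd z \<partial>\<eta>0) = 0"
proof -
  define g where "g z = torus_gradient f (fst z) \<bullet> snd z" for z :: "'n torus \<times> (real ^ 'n)"
  have gc: "continuous_on UNIV (torus_gradient f)" by (rule torus_C_k_continuous_gradient[OF f])
  have g: "continuous_on UNIV g" unfolding g_def by (intro continuous_intros continuous_on_compose2[OF gc]) auto
  obtain Bg where Bg: "\<And>x. \<bar>norm (torus_gradient f x)\<bar> \<le> Bg" using torus_abs_bounded[OF continuous_on_norm[OF gc]] by blast
  have "Bg \<ge> 0" using Bg[of undefined] by linarith
  have fc: "continuous_on UNIV f"
  proof (rule lipschitz_on_continuous_on[of Bg], rule lipschitz_onI)
    fix x y :: "'n torus"
    obtain h where h: "torus_shift y h = x" "norm h = dist y x" using torus_displacement by blast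
    obtain t where "f x - f y = torus_gradient f (torus_shift y (t *\<^sub>R h)) \<bullet> h"
      using torus_C_k_mvt[OF f, of y h] h(1) by auto
    then have "\<bar>f x - f y\<bar> \<le> norm (torus_gradient f (torus_shift y (t *\<^sub>R h))) * norm h"
      using Cauchy_Schwarz_ineq2 by simp
    also have "\<dots> \<le> Bg * norm h" using Bg by (intro mult_right_mono) auto
    finally show "dist (f x) (f y) \<le> Bg * dist x y" using h(2) by (simp add: dist_real_def dist_commute)
  qed (rule \<open>Bg \<ge> 0\<close>)
  have "\<bar>\<integral>z. g z \<partial>\<eta>0\<bar> \<le> 0 + e" if e: "e > 0" for e
  proof -
    have R1: "R + 1 > 0" using R_nonneg by linarith
    have "uniformly_continuous_on UNIV (torus_gradient f)" by (rule compact_uniformly_continuous[OF gc compact_torus])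
    moreover have "e / (R + 1) > 0" using e R1 by simp
    ultimately obtain d where d: "d > 0" "\<And>x y. dist x y < d \<Longrightarrow> dist (torus_gradient f x) (torus_gradient f y) < e / (R + 1)"
      unfolding uniformly_continuous_on_def by (metis UNIV_I)
    have "(\<lambda>i. \<tau> i * R) \<longlonglongrightarrow> 0" using tendsto_mult_right[OF \<tau>(2), of R] by simp
    then have "\<forall>\<^sub>F i in sequentially. \<tau> i * R < d" using d(1) by (rule order_tendstoD(2))
    then have ev: "\<forall>\<^sub>F i in sequentially. \<bar>\<integral>z. g z \<partial>\<eta> i\<bar> \<le> e"
    proof eventually_elim
      case (elim i)
      interpret prob_space "\<eta> i" by (rule borel_probD(1)[OF KR_D(1)[OF \<eta>]])
      define D where "D z = g z - (1 / \<tau> i) * shift_diff (\<tau> i) f z" for z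
      have Dc: "continuous_on UNIV D" unfolding D_def by (intro continuous_intros g continuous_shift_diff fc)
      have "AE z in \<eta> i. \<bar>D z\<bar> \<le> e"
        using KR_D(3)[OF \<eta>, of i]
      proof eventually_elim
        case (elim z)
        then have nv: "norm (snd z) \<le> R" by (simp add: X_def mem_Times_iff)
        obtain t where t: "t \<in> {0<..<1}" "shift_diff (\<tau> i) f z = torus_gradient f (torus_shift (fst z) (t *\<^sub>R (\<tau> i *\<^sub>R snd z))) \<bullet> (\<tau> i *\<^sub>R snd z)"
          using torus_C_k_mvt[OF f, of "fst z" "\<tau> i *\<^sub>R snd z"] unfolding shift_diff_def by blast
        let ?y = "torus_shift (fst z) (t *\<^sub>R (\<tau> i *\<^sub>R snd z))"
        have "dist (fst z) ?y \<le> t * (\<tau> i * norm (snd z))" using dist_torus_shift[of "fst z" "t *\<^sub>R (\<tau> i *\<^sub>R snd z)"] t(1) \<tau>(1)[of i] by (simp add: abs_mult)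
        also have "\<dots> \<le> 1 * (\<tau> i * R)" using t(1) nv \<tau>(1)[of i] by (intro mult_mono) auto
        finally have "dist (fst z) ?y < d" using \<open>\<tau> i * R < d\<close> by simp
        from d(2)[OF this] have nd: "norm (torus_gradient f (fst z) - torus_gradient f ?y) \<le> e / (R + 1)" by (simp add: dist_norm)
        have "D z = (torus_gradient f (fst z) - torus_gradient f ?y) \<bullet> snd z"
          unfolding D_def g_def t(2) using \<tau>(1)[of i] by (simp add: inner_diff_left)
        then have "\<bar>D z\<bar> \<le> norm (torus_gradient f (fst z) - torus_gradient f ?y) * norm (snd z)" using Cauchy_Schwarz_ineq2 by simp
        also have "\<dots> \<le> e / (R + 1) * (R + 1)" using nd nv R1 e by (intro mult_mono) auto
        finally show ?case using R1 by simp
      qed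
      moreover have i: "integrable (\<eta> i) D" "integrable (\<eta> i) g" "integrable (\<eta> i) (shift_diff (\<tau> i) f)"
        by (intro KR_D(4)[OF \<eta>] Dc g continuous_shift_diff fc)+
      ultimately have "\<bar>\<integral>z. D z \<partial>\<eta> i\<bar> \<le> (\<integral>z. e \<partial>\<eta> i)"
        by (intro order_trans[OF integral_abs_bound integral_mono_AE]) auto
      moreover have "(\<integral>z. D z \<partial>\<eta> i) = (\<integral>z. g z \<partial>\<eta> i)"
        unfolding D_def using i(2,3) KR_D(2)[OF \<eta> fc, of i] by simp
      ultimately show ?case by (simp add: prob_space)
    qed
    show ?thesis using tendsto_upperbound[OF tendsto_rabs[OF \<eta>_lim[OF g]] ev] by simp
  qed
  then have "\<bar>\<integral>z. g z \<partial>\<eta>0\<bar> \<le> 0" by (rule field_le_epsilon)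
  then show ?thesis unfolding g_def by simp
qed

text \<open>Under \<open>\<eta>0\<close> the velocity is almost surely a function of the base point,
  so integrating this velocity field against \<open>m0\<close> amounts to integrating
  \<open>snd\<close> against \<open>\<eta>0\<close>, where \<open>limit_closed\<close>
  applies.\<close>

lemma limit_mfg_solution:
  assumes crit: "critical_value (mfg_hamiltonian H F m0) = - c0"
  shows "mfg_solution H F u0 m0"
  unfolding mfg_solution_def
proof (intro conjI allI impI)
  have fst_b: "fst \<in> measurable \<eta>0 borel"
    using borel_probD(2)[OF \<eta>0(1)] measurable_fst[of borel borel] by (simp add: borel_prod[symmetric] cong: measurable_cong_sets)
  show "m0 \<in> borel_prob" by (rule m0_prob)
  show "viscosity_solution H (\<lambda>x. F x m0 + critical_value (mfg_hamiltonian H F m0)) u0"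
    using limit_viscosity_solution unfolding crit by simp
  show "AE x in m0. torus_differentiable u0 x"
    unfolding m0
  proof (subst AE_distr_iff[OF fst_b])
    show "{x \<in> space borel. torus_differentiable u0 x} \<in> sets borel" using torus_differentiable_borel[OF u0_continuous] by simp
    show "AE z in \<eta>0. torus_differentiable u0 (fst z)" using limit_AE by eventually_elim simp
  qed
  fix f :: "'n torus \<Rightarrow> real" assume "torus_smooth f"
  then have f: "torus_C_k (Suc 0) f" unfolding torus_smooth_def by blast
  have gc: "continuous_on UNIV (torus_gradient f)" by (rule torus_C_k_continuous_gradient[OF f])
  define G where "G x = torus_gradient f x \<bullet> gradient (H x) (torus_gradient u0 x)" for x
  have "(\<lambda>x. (x, torus_gradient u0 x)) \<in> borel_measurable borel"
    using borel_measurable_Pair[OF measurable_ident_sets[OF refl] torus_gradient_borel_measurable[OF u0_continuous]] by simp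
  from measurable_compose[OF this borel_measurable_continuous_onI[OF H_gradient_continuous]]
  have "(\<lambda>x. gradient (H x) (torus_gradient u0 x)) \<in> borel_measurable borel" by simp
  then have G: "G \<in> borel_measurable borel"
    unfolding G_def by (intro borel_measurable_inner borel_measurable_continuous_onI[OF gc])
  define g where "g z = torus_gradient f (fst z) \<bullet> snd z" for z :: "'n torus \<times> (real ^ 'n)"
  have g: "continuous_on UNIV g" unfolding g_def by (intro continuous_intros continuous_on_compose2[OF gc]) auto
  have AE_eq: "AE z in \<eta>0. G (fst z) = g z" using limit_AE by eventually_elim (simp add: G_def g_def)
  have Gm: "(\<lambda>z. G (fst z)) \<in> borel_measurable \<eta>0" using measurable_compose[OF fst_b G] .
  have gm: "g \<in> borel_measurable \<eta>0"
    using borel_measurable_continuous_onI[OF g] borel_probD(2)[OF \<eta>0(1)] by (simp cong: measurable_cong_sets)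
  have "integrable \<eta>0 g" by (rule borel_prob_integrable_compact[OF \<eta>0(1) compact_X \<eta>0(2) g])
  then have "integrable \<eta>0 (\<lambda>z. G (fst z))" using integrable_cong_AE[OF Gm gm AE_eq] by simp
  then have i: "integrable m0 G" unfolding m0 using integrable_distr_eq[OF fst_b G] by simp
  have "(\<integral>x. G x \<partial>m0) = (\<integral>z. G (fst z) \<partial>\<eta>0)" unfolding m0 by (rule integral_distr[OF fst_b G])
  also have "\<dots> = (\<integral>z. g z \<partial>\<eta>0)" by (rule integral_cong_AE[OF Gm gm AE_eq])
  also have "\<dots> = 0" unfolding g_def by (rule limit_closed[OF f])
  finally show "has_bochner_integral m0 (\<lambda>x. torus_gradient f x \<bullet> gradient (H x) (torus_gradient u0 x)) 0"
    using i has_bochner_integral_integrable[of m0 G] unfolding G_def by metis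
qed

end

section \<open>The critical value and the main theorem\<close>

definition torus_rep :: "'n::finite torus \<Rightarrow> real ^ 'n" where "torus_rep x = (SOME a. torus_of a = x)"

text \<open>A smooth periodic substitute for the squared distance in the doubling of variables.\<close>

definition penalty :: "'n::finite torus \<Rightarrow> 'n torus \<Rightarrow> real" where
  "penalty y x = (\<Sum>i\<in>UNIV. 1 - cos (2 * pi * (torus_rep x $ i - torus_rep y $ i)))"

lemma torus_of_rep: "torus_of (torus_rep x) = x"
  unfolding torus_rep_def by (rule someI_ex[OF torus_of_surj])

text \<open>Representatives differ by integer vectors, which the period of the cosine absorbs, so
  arbitrary lifts compute \<open>penalty\<close>.\<close>

lemma penalty_of: "penalty (torus_of b) (torus_of a) = (\<Sum>i\<in>UNIV. 1 - cos (2 * pi * (a $ i - b $ i)))"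
  unfolding penalty_def
proof (rule sum.cong[OF refl])
  fix i :: 'a
  define k where "k = (torus_rep (torus_of a) $ i - a $ i) - (torus_rep (torus_of b) $ i - b $ i)"
  have "k \<in> \<int>" unfolding k_def
    using torus_of_rep[of "torus_of a"] torus_of_rep[of "torus_of b"] unfolding torus_of_eq_iff
    by (intro Ints_diff[of "torus_rep (torus_of a) $ i - a $ i"]) blast+
  then have "cos (2 * pi * (a $ i - b $ i) + 2 * pi * k) = cos (2 * pi * (a $ i - b $ i))"
    unfolding cos_add by (simp add: cos_integer_2pi sin_integer_2pi)
  moreover have "2 * pi * (torus_rep (torus_of a) $ i - torus_rep (torus_of b) $ i) = 2 * pi * (a $ i - b $ i) + 2 * pi * k"
    by (simp add: k_def algebra_simps)
  ultimately show "1 - cos (2 * pi * (torus_rep (torus_of a) $ i - torus_rep (torus_of b) $ i)) = 1 - cos (2 * pi * (a $ i - b $ i))"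
    by simp
qed

lemma penalty_commute: "penalty x y = penalty y x"
  unfolding penalty_def by (intro sum.cong refl) (metis cos_minus minus_diff_eq mult_minus_right)

lemma penalty_nonneg: "0 \<le> penalty y x"
  unfolding penalty_def by (intro sum_nonneg) simp

lemma penalty_self [simp]: "penalty x x = 0"
  by (simp add: penalty_def)

lemma penalty_eq_0_imp: "penalty y x = 0 \<Longrightarrow> x = y"
proof -
  assume 0: "penalty y x = 0"
  have "torus_rep x $ i - torus_rep y $ i \<in> \<int>" for i
  proof -
    have "\<forall>i\<in>UNIV. 1 - cos (2 * pi * (torus_rep x $ i - torus_rep y $ i)) = 0"
      using 0 unfolding penalty_def by (subst (asm) sum_nonneg_eq_0_iff) auto
    then have "cos (2 * pi * (torus_rep x $ i - torus_rep y $ i)) = 1" by simp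
    then obtain n :: int where "2 * pi * (torus_rep x $ i - torus_rep y $ i) = real_of_int n * 2 * pi"
      unfolding cos_one_2pi_int by blast
    then have "torus_rep x $ i - torus_rep y $ i = real_of_int n" by simp
    then show ?thesis by simp
  qed
  then have "torus_of (torus_rep x) = torus_of (torus_rep y)" unfolding torus_of_eq_iff by blast
  then show "x = y" unfolding torus_of_rep .
qed

lemma penalty_continuous: "continuous_on UNIV (\<lambda>(x, y). penalty y x)"
proof (rule continuous_on_torus_prodI)
  have "continuous_on UNIV (\<lambda>(y, a). penalty y (torus_of a))"
  proof (rule continuous_on_torus_prodI)
    show "continuous_on UNIV (\<lambda>(b, a). penalty (torus_of b) (torus_of a))"
      unfolding penalty_of case_prod_unfold by (intro continuous_intros)
  qed
  from continuous_on_compose2[OF this continuous_on_swap] show "continuous_on UNIV (\<lambda>(a, y). penalty y (torus_of a))"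
    by (simp add: case_prod_unfold)
qed

lemma penalty_has_derivative:
  "((\<lambda>a. c * penalty (torus_of b) (torus_of a)) has_derivative
     (\<lambda>h. c * (\<Sum>i\<in>UNIV. 2 * pi * sin (2 * pi * (a $ i - b $ i)) * h $ i))) (at a)"
proof -
  have nth: "((\<lambda>a. a $ i) has_derivative (\<lambda>h. h $ i)) (at a)" for i
    by (rule bounded_linear_imp_has_derivative[OF bounded_linear_vec_nth])
  have "((\<lambda>a. 1 - cos (2 * pi * (a $ i - b $ i))) has_derivative (\<lambda>h. 2 * pi * sin (2 * pi * (a $ i - b $ i)) * h $ i)) (at a)" for i
    by (rule derivative_eq_intros nth refl | simp add: fun_eq_iff mult_ac)+
  then show ?thesis unfolding penalty_of by (intro has_derivative_mult_right has_derivative_sum)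
qed

lemma penalty_torus_C_1: "torus_C_k (Suc 0) (\<lambda>x. c * penalty y x)"
proof -
  obtain b where b: "torus_of b = y" using torus_of_surj by blast
  have "frechet_derivative (\<lambda>a. c * penalty y (torus_of a)) (at a) = (\<lambda>h. c * (\<Sum>i\<in>UNIV. 2 * pi * sin (2 * pi * (a $ i - b $ i)) * h $ i))" for a
    using frechet_derivative_at[OF penalty_has_derivative[of c b a]] unfolding b by simp
  moreover have "(\<lambda>a. c * penalty y (torus_of a)) differentiable (at a)" for a
    using penalty_has_derivative[of c b a] unfolding b differentiable_def by blast
  ultimately show ?thesis unfolding torus_C_k_def by (auto intro!: continuous_intros)
qed

lemma penalty_gradient:
  "torus_gradient (\<lambda>x. c * penalty (torus_of b) x) (torus_of a) = (\<chi> i. c * (2 * pi * sin (2 * pi * (a $ i - b $ i))))"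
proof -
  have shift: "((\<lambda>v. a + v) has_derivative (\<lambda>h. h)) (at 0)" by (auto intro!: derivative_eq_intros)
  have "((\<lambda>x. c * penalty (torus_of b) (torus_of x)) has_derivative
      (\<lambda>h. c * (\<Sum>i\<in>UNIV. 2 * pi * sin (2 * pi * (a $ i - b $ i)) * h $ i))) (at (a + 0))"
    using penalty_has_derivative[of c b a] by simp
  from has_derivative_compose[OF shift this]
  have "((\<lambda>v. c * penalty (torus_of b) (torus_of (a + v))) has_derivative
      (\<lambda>h. c * (\<Sum>i\<in>UNIV. 2 * pi * sin (2 * pi * (a $ i - b $ i)) * h $ i))) (at 0)" .
  then have "GDERIV (\<lambda>v. c * penalty (torus_of b) (torus_shift (torus_of a) v)) 0 :> (\<chi> i. c * (2 * pi * sin (2 * pi * (a $ i - b $ i))))"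
    unfolding gderiv_def torus_shift_of by (rule has_derivative_eq_rhs) (simp add: fun_eq_iff inner_vec_def sum_distrib_left algebra_simps)
  then show ?thesis by (rule torus_differentiableI(2))
qed

text \<open>The sine is odd, so the two tests in the doubling argument see the same
  momentum.\<close>

lemma penalty_gradient_swap:
  "torus_gradient (\<lambda>y. - c * penalty x y) y = torus_gradient (\<lambda>x. c * penalty y x) x"
proof -
  obtain a where a: "torus_of a = x" using torus_of_surj by blast
  obtain b where b: "torus_of b = y" using torus_of_surj by blast
  have "sin (2 * pi * (b $ i - a $ i)) = - sin (2 * pi * (a $ i - b $ i))" for i
    by (metis sin_minus minus_diff_eq mult_minus_right)
  then show ?thesis unfolding a[symmetric] b[symmetric] penalty_gradient by (simp add: vec_eq_iff)
qed

lemma viscosity_solutionD: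
  assumes "viscosity_solution H f u" "torus_C_k (Suc 0) \<phi>"
  shows "\<forall>\<^sub>F y in nhds x. u y - \<phi> y \<le> u x - \<phi> x \<Longrightarrow> H x (torus_gradient \<phi> x) \<le> f x"
    "\<forall>\<^sub>F y in nhds x. u y - \<phi> y \<ge> u x - \<phi> x \<Longrightarrow> f x \<le> H x (torus_gradient \<phi> x)"
  using assms unfolding viscosity_solution_def One_nat_def by blast+

section \<open>Comparison principle and uniqueness of the critical value\<close>

context mfg
begin

text \<open>At a maximum point of \<open>u x - w y - real n * penalty y x\<close> both equations are
  tested with the same momentum. The growing penalty forces the two points together; coercivity
  bounds the momenta, so a subsequence converges and continuity of the Hamiltonian compares the
  constants.\<close>

lemma viscosity_comparison:
  assumes m: "m \<in> borel_prob"
    and u: "viscosity_solution (mfg_hamiltonian H F m) (\<lambda>_. k1) u"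
    and w: "viscosity_solution (mfg_hamiltonian H F m) (\<lambda>_. k2) w"
  shows "k2 \<le> k1"
proof -
  have uc: "continuous_on UNIV u" and wc: "continuous_on UNIV w" using u w unfolding viscosity_solution_def by auto
  have "\<exists>x y. \<forall>x' y'. u x' - w y' - real n * penalty y' x' \<le> u x - w y - real n * penalty y x" for n
  proof -
    have "compact (UNIV :: ('n torus \<times> 'n torus) set)" using compact_Times[OF compact_torus compact_torus] by simp
    moreover have "continuous_on UNIV (\<lambda>z. u (fst z) - w (snd z) - real n * penalty (snd z) (fst z))"
      using penalty_continuous unfolding case_prod_unfold
      by (intro continuous_intros continuous_on_compose2[OF uc] continuous_on_compose2[OF wc]) auto
    ultimately obtain z where z: "\<forall>z'\<in>UNIV. u (fst z') - w (snd z') - real n * penalty (snd z') (fst z') \<le> u (fst z) - w (snd z) - real n * penalty (snd z) (fst z)"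
      using continuous_attains_sup[of UNIV "\<lambda>z. u (fst z) - w (snd z) - real n * penalty (snd z) (fst z)"] by auto
    have "u x' - w y' - real n * penalty y' x' \<le> u (fst z) - w (snd z) - real n * penalty (snd z) (fst z)" for x' y'
      using bspec[OF z UNIV_I, of "(x', y')"] by simp
    then show ?thesis by blast
  qed
  then obtain x y where xy: "\<And>n x' y'. u x' - w y' - real n * penalty y' x' \<le> u (x n) - w (y n) - real n * penalty (y n) (x n)" by metis
  define p where "p n = torus_gradient (\<lambda>x. real n * penalty (y n) x) (x n)" for n
  have sub: "mfg_hamiltonian H F m (x n) (p n) \<le> k1" for n
  proof -
    have "\<forall>\<^sub>F x' in nhds (x n). u x' - real n * penalty (y n) x' \<le> u (x n) - real n * penalty (y n) (x n)"
      using xy[of _ "y n" n] by (intro always_eventually allI) (simp add: algebra_simps)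
    then show ?thesis unfolding p_def by (rule viscosity_solutionD(1)[OF u penalty_torus_C_1])
  qed
  have super: "k2 \<le> mfg_hamiltonian H F m (y n) (p n)" for n
  proof -
    have "\<forall>\<^sub>F y' in nhds (y n). w y' - (- real n * penalty (x n) y') \<ge> w (y n) - (- real n * penalty (x n) (y n))"
      using xy[of "x n" _ n] unfolding penalty_commute[of "x n"] by (intro always_eventually allI) (simp add: algebra_simps)
    then have "k2 \<le> mfg_hamiltonian H F m (y n) (torus_gradient (\<lambda>y'. - real n * penalty (x n) y') (y n))"
      by (rule viscosity_solutionD(2)[OF w penalty_torus_C_1])
    then show ?thesis unfolding p_def penalty_gradient_swap[of "real n" "x n" "y n"] .
  qed
  obtain C where C: "\<And>x p. H x p \<ge> 1 * norm p - C" using H_coercive[of 1] by auto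
  have pb: "norm (p n) \<le> k1 + C + FB" for n
    using C[of "p n" "x n"] sub[of n] FB(2)[OF m, of "x n"] unfolding mfg_hamiltonian_def by linarith
  obtain Bu where Bu: "\<And>x. \<bar>u x\<bar> \<le> Bu" using torus_abs_bounded[OF uc] by blast
  obtain Bw where Bw: "\<And>x. \<bar>w x\<bar> \<le> Bw" using torus_abs_bounded[OF wc] by blast
  \<comment> \<open>Comparison with the diagonal pair \<open>(x n, x n)\<close> bounds the penalty
    term, so the penalty itself is O(1/n).\<close>
  have pen: "real n * penalty (y n) (x n) \<le> 2 * Bu + 2 * Bw" for n
    using xy[of "x n" "x n" n] Bu[of "x n"] Bw[of "x n"] Bw[of "y n"] Bu[of "y n"] by simp
  have "(x n, y n, p n) \<in> UNIV \<times> UNIV \<times> cball 0 (k1 + C + FB)" for n using pb by simp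
  then obtain q s where s: "strict_mono s" "(\<lambda>n. (x (s n), y (s n), p (s n))) \<longlonglongrightarrow> q"
    by (rule compact_subsequence[OF compact_Times[OF compact_torus compact_Times[OF compact_torus compact_cball]],
        of "\<lambda>n. (x n, y n, p n)" 0 "k1 + C + FB"]) blast
  obtain x0 y0 p0 where q: "q = (x0, y0, p0)" by (cases q)
  have lims: "(\<lambda>n. x (s n)) \<longlonglongrightarrow> x0" "(\<lambda>n. y (s n)) \<longlonglongrightarrow> y0" "(\<lambda>n. p (s n)) \<longlonglongrightarrow> p0"
    using tendsto_fst[OF s(2)] tendsto_fst[OF tendsto_snd[OF s(2)]] tendsto_snd[OF tendsto_snd[OF s(2)]] by (simp_all add: q)
  have "(\<lambda>n. penalty (y (s n)) (x (s n))) \<longlonglongrightarrow> penalty y0 x0"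
    using continuous_on_tendsto_compose[OF penalty_continuous tendsto_Pair[OF lims(1,2)]] by simp
  moreover have "(\<lambda>n. penalty (y (s n)) (x (s n))) \<longlonglongrightarrow> 0"
  proof (rule Lim_null_comparison)
    have "(\<lambda>n. (2 * Bu + 2 * Bw) * inverse (real n)) \<longlonglongrightarrow> (2 * Bu + 2 * Bw) * 0"
      by (intro tendsto_intros lim_inverse_n)
    from LIMSEQ_subseq_LIMSEQ[OF this s(1)] show "(\<lambda>n. (2 * Bu + 2 * Bw) * inverse (real (s n))) \<longlonglongrightarrow> 0" by (simp add: o_def)
    have "norm (penalty (y (s n)) (x (s n))) \<le> (2 * Bu + 2 * Bw) * inverse (real (s n))" if "n \<ge> 1" for n
    proof -
      have "s n > 0" using seq_suble[OF s(1), of n] that by linarith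
      then show ?thesis using pen[of "s n"] penalty_nonneg[of "y (s n)" "x (s n)"] by (simp add: field_simps)
    qed
    then show "\<forall>\<^sub>F n in sequentially. norm (penalty (y (s n)) (x (s n))) \<le> (2 * Bu + 2 * Bw) * inverse (real (s n))"
      unfolding eventually_sequentially by blast
  qed
  ultimately have "penalty y0 x0 = 0" by (rule LIMSEQ_unique)
  then have "x0 = y0" by (rule penalty_eq_0_imp)
  have ham: "(\<lambda>n. mfg_hamiltonian H F m (z n) (p (s n))) \<longlonglongrightarrow> mfg_hamiltonian H F m z0 p0" if "z \<longlonglongrightarrow> z0" for z z0
    unfolding mfg_hamiltonian_def
    using continuous_on_tendsto_compose[OF F_continuous[OF m] that] by (intro tendsto_intros H_tendsto that lims(3)) simp
  have "mfg_hamiltonian H F m x0 p0 \<le> k1" using sub by (intro LIMSEQ_le_const2[OF ham[OF lims(1)]]) blast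
  moreover have "k2 \<le> mfg_hamiltonian H F m y0 p0" using super by (intro LIMSEQ_le_const[OF ham[OF lims(2)]]) blast
  ultimately show ?thesis using \<open>x0 = y0\<close> by simp
qed

lemma critical_value_eq:
  assumes "m \<in> borel_prob" "viscosity_solution (mfg_hamiltonian H F m) (\<lambda>_. k) u"
  shows "critical_value (mfg_hamiltonian H F m) = k"
  unfolding critical_value_def
proof (rule the_equality)
  show "\<exists>u. viscosity_solution (mfg_hamiltonian H F m) (\<lambda>_. k) u" using assms(2) by blast
  show "k' = k" if "\<exists>u. viscosity_solution (mfg_hamiltonian H F m) (\<lambda>_. k') u" for k'
    using that viscosity_comparison[OF assms(1)] assms(2) by (meson order_antisym)
qed

end

text \<open>\<open>c0\<close> is a limit of minimal average actions, and the critical value is its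
  negative. F moves from the right-hand side into the Hamiltonian.\<close>

lemma (in mfg_limit) limit_is_mfg_solution: "mfg_solution H F u0 m0"
proof (rule limit_mfg_solution, rule critical_value_eq[OF m0_prob])
  show "viscosity_solution (mfg_hamiltonian H F m0) (\<lambda>_. - c0) u0"
    using limit_viscosity_solution unfolding viscosity_solution_def mfg_hamiltonian_def by (simp add: algebra_simps)
qed

lemma (in bounded_lagrangian) weak_kam_diff_const: "weak_kam \<tau> c u \<Longrightarrow> weak_kam \<tau> c (\<lambda>x. u x - a)"
  unfolding weak_kam_def subsolution_def calibrated_def by (auto intro!: continuous_intros simp: algebra_simps)

theorem theorem1:
  fixes H :: "'n::finite torus \<Rightarrow> real ^ 'n \<Rightarrow> real"
    and F :: "'n torus \<Rightarrow> 'n torus measure \<Rightarrow> real"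
  assumes "tonelli H"
    and "L1 (lagrangian H)" and "L2 (lagrangian H)"
    and "F1 F" and "F2 F" and "F3 F"
  shows "(\<forall>\<tau>>0. \<exists>m\<in>borel_prob. discrete_equilibrium H F \<tau> m) \<and>
    (\<exists>(\<tau> :: nat \<Rightarrow> real) m m0 u u0.
       (\<forall>i. \<tau> i > 0) \<and> \<tau> \<longlonglongrightarrow> 0 \<and>
       (\<forall>i. discrete_equilibrium H F (\<tau> i) (m i)) \<and>
       m0 \<in> borel_prob \<and> limitin weak_star m m0 sequentially \<and>
       (\<forall>i. lax_oleinik_solution (\<tau> i) (mfg_lagrangian H F (m i))
              (L_bar (\<tau> i) (mfg_lagrangian H F (m i))) (u i)) \<and>
       uniform_limit UNIV u u0 sequentially \<and>
       mfg_solution H F u0 m0)"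
proof (rule conjI)
  interpret mfg H F by unfold_locales (use assms in auto)
  show "\<forall>\<tau>>0. \<exists>m\<in>borel_prob. discrete_equilibrium H F \<tau> m"
  proof (intro allI impI)
    fix \<tau> :: real assume "\<tau> > 0"
    obtain \<eta> where "\<eta> \<in> KR \<tau>" "(\<integral>z. lm (distr \<eta> borel fst) (fst z) (snd z) \<partial>\<eta>) = cc \<tau> (distr \<eta> borel fst)"
      using equilibrium_exists[OF \<open>\<tau> > 0\<close>] .
    from equilibrium_discrete_equilibrium[OF \<open>\<tau> > 0\<close> this]
    show "\<exists>m\<in>borel_prob. discrete_equilibrium H F \<tau> m" unfolding discrete_equilibrium_def by blast
  qed
  define \<tau> where "\<tau> i = inverse (real (Suc i))" for i
  have \<tau>_pos: "\<tau> i > 0" for i by (simp add: \<tau>_def)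
  have "\<exists>\<eta>. \<eta> \<in> KR (\<tau> i) \<and> (\<integral>z. lm (distr \<eta> borel fst) (fst z) (snd z) \<partial>\<eta>) = cc (\<tau> i) (distr \<eta> borel fst)" for i
    using equilibrium_exists[OF \<tau>_pos] by blast
  then have "\<exists>\<eta>. \<forall>i. \<eta> i \<in> KR (\<tau> i) \<and> (\<integral>z. lm (distr (\<eta> i) borel fst) (fst z) (snd z) \<partial>\<eta> i) = cc (\<tau> i) (distr (\<eta> i) borel fst)"
    by (rule choice[OF allI])
  then obtain \<eta> where \<eta>: "\<forall>i. \<eta> i \<in> KR (\<tau> i) \<and> (\<integral>z. lm (distr (\<eta> i) borel fst) (fst z) (snd z) \<partial>\<eta> i) = cc (\<tau> i) (distr (\<eta> i) borel fst)" ..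
  have \<eta>K: "\<eta> i \<in> KR (\<tau> i)" and \<eta>min: "(\<integral>z. lm (distr (\<eta> i) borel fst) (fst z) (snd z) \<partial>\<eta> i) = cc (\<tau> i) (distr (\<eta> i) borel fst)" for i
    using \<eta> by auto
  define m where "m i = distr (\<eta> i) borel fst" for i
  have m: "m i \<in> borel_prob" for i unfolding m_def by (rule distr_fst_borel_prob(1)[OF KR_D(1)[OF \<eta>K]])
  interpret B: bounded_lagrangian "lm (m i)" Cs M \<Lambda> for i by (rule bounded_lagrangian_lm[OF m])
  define c where "c i = cc (\<tau> i) (m i)" for i
  obtain z0 :: "'n torus" where True by simp
  \<comment> \<open>Adding constants preserves the equation; normalising at \<open>z0\<close> turns
    the common Lipschitz constant into the uniform bound \<open>Lip * D\<close>.\<close>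
  have "\<exists>u. bounded_lagrangian.weak_kam (lm (m i)) (\<tau> i) (c i) u \<and> u z0 = 0" for i
  proof -
    obtain u where "bounded_lagrangian.weak_kam (lm (m i)) (\<tau> i) (c i) u" using cc_weak_kam[OF \<tau>_pos m] unfolding c_def .
    from B.weak_kam_diff_const[OF this, of "u z0"] show ?thesis by (intro exI[of _ "\<lambda>x. u x - u z0"]) simp
  qed
  then obtain u where u: "\<And>i. bounded_lagrangian.weak_kam (lm (m i)) (\<tau> i) (c i) (u i)" "\<And>i. u i z0 = 0" by metis
  obtain D where D: "0 \<le> D" "\<And>x y :: 'n torus. dist x y \<le> D" using torus_dist_bounded by blast
  have lip: "\<bar>u i x - u i y\<bar> \<le> Lip * dist x y" for i x y
    using B.weak_kam_lipschitz[OF \<tau>_pos u(1)] unfolding Lip_def .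
  have Lip0: "0 \<le> Lip" using B.Lp_nonneg unfolding Lip_def .
  obtain u0 r1 where r1: "strict_mono r1" "uniform_limit UNIV (\<lambda>i. u (r1 i)) u0 sequentially"
  proof (rule torus_Arzela_Ascoli[of u "Lip * D" Lip])
    show "\<bar>u i x\<bar> \<le> Lip * D" for i x
      using lip[of i x z0] u(2)[of i] mult_left_mono[OF D(2)[of x z0] Lip0] by simp
  qed (use lip in blast)+
  obtain c0 r2 where r2: "strict_mono r2" "(\<lambda>i. c (r1 (r2 i))) \<longlonglongrightarrow> c0"
  proof (rule compact_subsequence[of "{Cs 0..M}" "\<lambda>i. c (r1 i)"])
    show "c (r1 i) \<in> {Cs 0..M}" for i using B.weak_kam_c_bounds[OF \<tau>_pos u(1)] by simp
  qed auto
  obtain r3 \<eta>0 where r3: "strict_mono (r3 :: nat \<Rightarrow> nat)" "\<eta>0 \<in> borel_prob" "AE z in \<eta>0. z \<in> X"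
    "\<And>f :: _ \<Rightarrow> real. continuous_on UNIV f \<Longrightarrow> (\<lambda>i. \<integral>z. f z \<partial>\<eta> (r1 (r2 (r3 i)))) \<longlonglongrightarrow> (\<integral>z. f z \<partial>\<eta>0)"
  proof (rule borel_prob_seq_compact[of X "\<lambda>i. \<eta> (r1 (r2 i))", OF compact_X])
    show "\<eta> (r1 (r2 i)) \<in> borel_prob" "AE z in \<eta> (r1 (r2 i)). z \<in> X" for i using KR_D(1,3)[OF \<eta>K] by blast+
  qed blast
  \<comment> \<open>Three nested extractions: functions, constants, measures. Convergence obtained
    first persists along the later subsequences.\<close>
  define r where "r i = r1 (r2 (r3 i))" for i
  have r: "strict_mono r" unfolding r_def using r1(1) r2(1) r3(1) by (simp add: strict_mono_def)
  have "\<tau> \<longlonglongrightarrow> 0" unfolding \<tau>_def by (rule LIMSEQ_inverse_real_of_nat)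
  then have \<tau>_lim: "(\<lambda>i. \<tau> (r i)) \<longlonglongrightarrow> 0" using LIMSEQ_subseq_LIMSEQ[OF _ r] by (simp add: o_def)
  interpret mfg_limit H F "\<lambda>i. \<tau> (r i)" "\<lambda>i. \<eta> (r i)" "\<lambda>i. m (r i)" "\<lambda>i. u (r i)" "\<lambda>i. c (r i)" \<eta>0 "distr \<eta>0 borel fst" u0 c0
  proof unfold_locales
    show "(\<lambda>i. \<tau> (r i)) \<longlonglongrightarrow> 0" by (rule \<tau>_lim)
    show "uniform_limit UNIV (\<lambda>i. u (r i)) u0 sequentially"
      using filterlim_compose[OF r1(2) filterlim_subseq[OF strict_mono_o[OF r2(1) r3(1)]]] by (simp add: r_def o_def)
    show "(\<lambda>i. c (r i)) \<longlonglongrightarrow> c0" using LIMSEQ_subseq_LIMSEQ[OF r2(2) r3(1)] by (simp add: r_def o_def)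
    show "(\<lambda>i. \<integral>z. f z \<partial>\<eta> (r i)) \<longlonglongrightarrow> (\<integral>z. f z \<partial>\<eta>0)" if "continuous_on UNIV f" for f :: "_ \<Rightarrow> real"
      using r3(4)[OF that] unfolding r_def .
    show "(\<integral>z. lm (m (r i)) (fst z) (snd z) \<partial>\<eta> (r i)) = c (r i)" for i
      using \<eta>min[of "r i"] unfolding m_def c_def .
  qed (use \<tau>_pos \<eta>K u(1) r3(2,3) in \<open>auto simp: m_def\<close>)
  show "\<exists>(\<tau> :: nat \<Rightarrow> real) m m0 u u0.
       (\<forall>i. \<tau> i > 0) \<and> \<tau> \<longlonglongrightarrow> 0 \<and>
       (\<forall>i. discrete_equilibrium H F (\<tau> i) (m i)) \<and>
       m0 \<in> borel_prob \<and> limitin weak_star m m0 sequentially \<and>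
       (\<forall>i. lax_oleinik_solution (\<tau> i) (mfg_lagrangian H F (m i))
              (L_bar (\<tau> i) (mfg_lagrangian H F (m i))) (u i)) \<and>
       uniform_limit UNIV u u0 sequentially \<and>
       mfg_solution H F u0 m0"
  proof (intro exI conjI allI)
    show "\<tau> (r i) > 0" for i by (rule \<tau>_pos)
    show "(\<lambda>i. \<tau> (r i)) \<longlonglongrightarrow> 0" by (rule \<tau>_lim)
    show "discrete_equilibrium H F (\<tau> (r i)) (m (r i))" for i
      unfolding m_def by (rule equilibrium_discrete_equilibrium[OF \<tau>_pos \<eta>K \<eta>min])
    show "distr \<eta>0 borel fst \<in> borel_prob" by (rule m0_prob)
    show "limitin weak_star (\<lambda>i. m (r i)) (distr \<eta>0 borel fst) sequentially" by (rule weak_star_lim)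
    show "lax_oleinik_solution (\<tau> (r i)) (mfg_lagrangian H F (m (r i))) (L_bar (\<tau> (r i)) (mfg_lagrangian H F (m (r i)))) (u (r i))" for i
      using B.weak_kam_lax_oleinik[OF \<tau>_pos u(1)] unfolding c_def cc_def .
    show "uniform_limit UNIV (\<lambda>i. u (r i)) u0 sequentially" by (rule u_lim)
    show "mfg_solution H F u0 (distr \<eta>0 borel fst)" by (rule limit_is_mfg_solution)
  qed
qed

end
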